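(* Let $\theta : \mathcal{E} \to \mathcal{F}$ be a completely contractive homomorphism between operator algebras which is also a complete quotient map. Let $B$ be a closed subalgebra of $\mathcal{E}$, and suppose that there is a contractive approximate identity (cai) for $\mathrm{Ker}(\theta)$ which either (a) lies in $B$, or (b) has a weak* limit point in $B^{\perp\perp} \subset \mathcal{E}^{**}$. Then $\theta(B)$ is closed, and $\theta_{|B}$ is a complete quotient map onto $\theta(B)$. Indeed, $\theta(\mathrm{Ball}(B)) = \mathrm{Ball}(\theta(B))$, and similarly at all matrix levels (that is, the $n$-th amplification of $\theta$ maps $\mathrm{Ball}(M_n(B))$ onto $\mathrm{Ball}(M_n(\theta(B)))$ for every $n$). Moreover $\theta(B) \cong B/\mathrm{Ker}(\theta_{|B}) \subset \mathcal{E}/\mathrm{Ker}(\theta)$ completely isometrically isomorphically (via the canonical maps).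
   Context: An operator algebra is a norm-closed, not necessarily selfadjoint, subalgebra of a $C^*$-algebra, with the inherited matrix norms; it need not have any identity or approximate identity. A cai is a contractive two-sided approximate identity. $\mathrm{Ball}(X)$ denotes the closed unit ball of $X$. A complete quotient map $u : X \to Y$ is a completely contractive surjection such that the induced map $X/\mathrm{Ker}(u) \to Y$ is a complete isometry. Quotients carry the operator space quotient structure. $B^{\perp\perp}$ is the weak* closure of $B$ in $\mathcal{E}^{**}$. *)

theory Defs
  imports "HOL-Analysis.Analysis" "Jordan_Normal_Form.Matrix"
begin

section \<open>C*-algebras and operator algebras\<close>

text \<open>A C*-algebra is a type of this class; no identity is assumed.\<close>

class cstar_algebra = real_normed_algebra + banach +
  fixes scaleC :: "complex \<Rightarrow> 'a \<Rightarrow> 'a"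
    and star :: "'a \<Rightarrow> 'a"
  assumes scaleC_of_real: "scaleC (complex_of_real r) x = r *\<^sub>R x"
    and scaleC_add_right: "scaleC c (x + y) = scaleC c x + scaleC c y"
    and scaleC_add_left: "scaleC (c + d) x = scaleC c x + scaleC d x"
    and scaleC_scaleC: "scaleC c (scaleC d x) = scaleC (c * d) x"
    and mult_scaleC_left: "scaleC c x * y = scaleC c (x * y)"
    and mult_scaleC_right: "x * scaleC c y = scaleC c (x * y)"
    and norm_scaleC: "norm (scaleC c x) = cmod c * norm x"
    and star_star: "star (star x) = x"
    and star_add: "star (x + y) = star x + star y"
    and star_scaleC: "star (scaleC c x) = scaleC (cnj c) (star x)"
    and star_mult: "star (x * y) = star y * star x"
    and cstar_identity: "norm (star x * x) = (norm x)\<^sup>2"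

text \<open>An operator algebra is given by its underlying set in a C*-algebra. A closed subalgebra of
  an operator algebra \<open>E\<close> is an operator algebra that is a subset of \<open>E\<close>.\<close>

definition operator_algebra :: "'a::cstar_algebra set \<Rightarrow> bool" where
  "operator_algebra E \<longleftrightarrow>
     closed E \<and> 0 \<in> E \<and>
     (\<forall>x\<in>E. \<forall>y\<in>E. x + y \<in> E \<and> x * y \<in> E) \<and>
     (\<forall>c. \<forall>x\<in>E. scaleC c x \<in> E)"

section \<open>Matrix norms\<close>

definition mats :: "nat \<Rightarrow> 'x set \<Rightarrow> 'x mat set" where
  "mats n X = {a \<in> carrier_mat n n. elements_mat a \<subseteq> X}"

definition mat_star :: "'a::cstar_algebra mat \<Rightarrow> 'a mat" where
  "mat_star a = map_mat star (transpose_mat a)"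

text \<open>\<open>N\<close> is a norm which makes the *-algebra of \<open>n\<close> by \<open>n\<close> matrices over the C*-algebra \<open>'a\<close>
  a C*-algebra.\<close>

definition cstar_norm_on_mats :: "nat \<Rightarrow> ('a::cstar_algebra mat \<Rightarrow> real) \<Rightarrow> bool" where
  "cstar_norm_on_mats n N \<longleftrightarrow>
     (\<forall>a\<in>carrier_mat n n. 0 \<le> N a \<and> (N a = 0 \<longleftrightarrow> a = 0\<^sub>m n n)) \<and>
     (\<forall>a\<in>carrier_mat n n. \<forall>b\<in>carrier_mat n n. N (a + b) \<le> N a + N b) \<and>
     (\<forall>c. \<forall>a\<in>carrier_mat n n. N (map_mat (scaleC c) a) = cmod c * N a) \<and>
     (\<forall>a\<in>carrier_mat n n. \<forall>b\<in>carrier_mat n n. N (a * b) \<le> N a * N b) \<and>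
     (\<forall>a\<in>carrier_mat n n. N (mat_star a * a) = (N a)\<^sup>2) \<and>
     Metric_space.mcomplete (carrier_mat n n) (\<lambda>a b. N (a - b))"

text \<open>The matrix norms of the C*-algebra \<open>'a\<close>. Every C*-algebra carries exactly one family
  \<open>N\<close> with this property (up to the values outside the square matrices), since a *-algebra has at
  most one complete C*-norm and the matrix algebras over a C*-algebra have one. Operator algebras
  in \<open>'a\<close> inherit \<open>N\<close> by restriction.\<close>

definition cstar_matrix_norms :: "(nat \<Rightarrow> 'a::cstar_algebra mat \<Rightarrow> real) \<Rightarrow> bool" where
  "cstar_matrix_norms N \<longleftrightarrow>
     (\<forall>n. cstar_norm_on_mats n (N n)) \<and>
     (\<forall>x. N 1 (mat 1 1 (\<lambda>_. x)) = norm x)"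

definition mat_ball :: "(nat \<Rightarrow> 'x mat \<Rightarrow> real) \<Rightarrow> nat \<Rightarrow> 'x set \<Rightarrow> 'x mat set" where
  "mat_ball N n X = {a \<in> mats n X. N n a \<le> 1}"

section \<open>Algebras with matrix norms and their quotients\<close>

text \<open>Algebras with matrix norms are bundled in a record, so that subalgebras of C*-algebras and
  quotients of such (whose elements are cosets) can be treated alike.\<close>

record 'x mn_algebra =
  mn_carrier :: "'x set"
  mn_add :: "'x \<Rightarrow> 'x \<Rightarrow> 'x"
  mn_scale :: "complex \<Rightarrow> 'x \<Rightarrow> 'x"
  mn_mult :: "'x \<Rightarrow> 'x \<Rightarrow> 'x"
  mn_norm :: "nat \<Rightarrow> 'x mat \<Rightarrow> real"

definition sub_alg :: "(nat \<Rightarrow> 'a::cstar_algebra mat \<Rightarrow> real) \<Rightarrow> 'a set \<Rightarrow> 'a mn_algebra" where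
  "sub_alg N X =
     \<lparr>mn_carrier = X, mn_add = (+), mn_scale = scaleC, mn_mult = (*), mn_norm = N\<rparr>"

definition coset :: "'a::cstar_algebra set \<Rightarrow> 'a \<Rightarrow> 'a set" where
  "coset K x = {x + k | k. k \<in> K}"

definition quotient_norm ::
    "(nat \<Rightarrow> 'a::cstar_algebra mat \<Rightarrow> real) \<Rightarrow> nat \<Rightarrow> 'a set mat \<Rightarrow> real" where
  "quotient_norm N n Q =
     Inf {N n a | a. a \<in> carrier_mat n n \<and> (\<forall>i<n. \<forall>j<n. a $$ (i, j) \<in> Q $$ (i, j))}"

text \<open>The quotient of \<open>X\<close> by an ideal \<open>K\<close> of \<open>X\<close>, with \<open>(x + K) (y + K) = x y + K\<close> etc. The
  summand \<open>k\<close> makes products and multiples of cosets full cosets again.\<close>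

definition quotient_alg ::
    "(nat \<Rightarrow> 'a::cstar_algebra mat \<Rightarrow> real) \<Rightarrow> 'a set \<Rightarrow> 'a set \<Rightarrow> 'a set mn_algebra" where
  "quotient_alg N X K =
     \<lparr>mn_carrier = coset K ` X,
      mn_add = (\<lambda>P Q. {x + y | x y. x \<in> P \<and> y \<in> Q}),
      mn_scale = (\<lambda>c P. {scaleC c x + k | x k. x \<in> P \<and> k \<in> K}),
      mn_mult = (\<lambda>P Q. {x * y + k | x y k. x \<in> P \<and> y \<in> Q \<and> k \<in> K}),
      mn_norm = quotient_norm N\<rparr>"

section \<open>Maps\<close>

definition linear_map :: "'x mn_algebra \<Rightarrow> 'y mn_algebra \<Rightarrow> ('x \<Rightarrow> 'y) \<Rightarrow> bool" where
  "linear_map X Y u \<longleftrightarrow>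
     u ` mn_carrier X \<subseteq> mn_carrier Y \<and>
     (\<forall>x\<in>mn_carrier X. \<forall>y\<in>mn_carrier X. u (mn_add X x y) = mn_add Y (u x) (u y)) \<and>
     (\<forall>c. \<forall>x\<in>mn_carrier X. u (mn_scale X c x) = mn_scale Y c (u x))"

definition homomorphism :: "'x mn_algebra \<Rightarrow> 'y mn_algebra \<Rightarrow> ('x \<Rightarrow> 'y) \<Rightarrow> bool" where
  "homomorphism X Y u \<longleftrightarrow>
     linear_map X Y u \<and>
     (\<forall>x\<in>mn_carrier X. \<forall>y\<in>mn_carrier X. u (mn_mult X x y) = mn_mult Y (u x) (u y))"

definition completely_contractive :: "'x mn_algebra \<Rightarrow> 'y mn_algebra \<Rightarrow> ('x \<Rightarrow> 'y) \<Rightarrow> bool" where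
  "completely_contractive X Y u \<longleftrightarrow>
     (\<forall>n. \<forall>a\<in>mats n (mn_carrier X). mn_norm Y n (map_mat u a) \<le> mn_norm X n a)"

definition complete_isometry :: "'x mn_algebra \<Rightarrow> 'y mn_algebra \<Rightarrow> ('x \<Rightarrow> 'y) \<Rightarrow> bool" where
  "complete_isometry X Y u \<longleftrightarrow>
     (\<forall>n. \<forall>a\<in>mats n (mn_carrier X). mn_norm Y n (map_mat u a) = mn_norm X n a)"

definition ker_on :: "'a::cstar_algebra set \<Rightarrow> ('a \<Rightarrow> 'b::cstar_algebra) \<Rightarrow> 'a set" where
  "ker_on X u = {x \<in> X. u x = 0}"

text \<open>The map \<open>x + Ker u \<mapsto> u x\<close>: on such a coset \<open>u\<close> has a single value.\<close>

definition induced_map :: "('a \<Rightarrow> 'b) \<Rightarrow> 'a set \<Rightarrow> 'b" where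
  "induced_map u Q = the_elem (u ` Q)"

text \<open>The map \<open>x + K \<mapsto> x + J\<close>, for \<open>K \<subseteq> J\<close>.\<close>

definition quotient_incl :: "'a::cstar_algebra set \<Rightarrow> 'a set \<Rightarrow> 'a set" where
  "quotient_incl J Q = {x + j | x j. x \<in> Q \<and> j \<in> J}"

definition complete_quotient_map ::
    "(nat \<Rightarrow> 'a::cstar_algebra mat \<Rightarrow> real) \<Rightarrow> 'a set \<Rightarrow>
     (nat \<Rightarrow> 'b::cstar_algebra mat \<Rightarrow> real) \<Rightarrow> 'b set \<Rightarrow> ('a \<Rightarrow> 'b) \<Rightarrow> bool" where
  "complete_quotient_map N X M Y u \<longleftrightarrow>
     linear_map (sub_alg N X) (sub_alg M Y) u \<and>
     completely_contractive (sub_alg N X) (sub_alg M Y) u \<and>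
     u ` X = Y \<and>
     complete_isometry (quotient_alg N X (ker_on X u)) (sub_alg M Y) (induced_map u)"

section \<open>Contractive approximate identities\<close>

text \<open>Nets are families \<open>e\<close> indexed by a type with a proper filter \<open>F\<close>, as usual for limits in
  the library; for a directed index set, \<open>F\<close> is the filter of its tails.\<close>

definition cai :: "'a::cstar_algebra set \<Rightarrow> 'i filter \<Rightarrow> ('i \<Rightarrow> 'a) \<Rightarrow> bool" where
  "cai J F e \<longleftrightarrow>
     F \<noteq> bot \<and>
     (\<forall>i. e i \<in> J \<and> norm (e i) \<le> 1) \<and>
     (\<forall>x\<in>J. ((\<lambda>i. e i * x) \<longlongrightarrow> x) F \<and> ((\<lambda>i. x * e i) \<longlongrightarrow> x) F)"

section \<open>The bidual and its weak* topology\<close>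

text \<open>Functionals on \<open>E\<close> and on its dual are extensional functions, so that they are determined
  by their values there.\<close>

definition dual_space :: "'a::cstar_algebra set \<Rightarrow> ('a \<Rightarrow> complex) set" where
  "dual_space E =
     {f \<in> extensional E.
        (\<forall>x\<in>E. \<forall>y\<in>E. f (x + y) = f x + f y) \<and>
        (\<forall>c. \<forall>x\<in>E. f (scaleC c x) = c * f x) \<and>
        (\<exists>C. \<forall>x\<in>E. cmod (f x) \<le> C * norm x)}"

definition dual_norm :: "'a::cstar_algebra set \<Rightarrow> ('a \<Rightarrow> complex) \<Rightarrow> real" where
  "dual_norm E f = Sup {cmod (f x) | x. x \<in> E \<and> norm x \<le> 1}"

definition bidual_space :: "'a::cstar_algebra set \<Rightarrow> (('a \<Rightarrow> complex) \<Rightarrow> complex) set" where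
  "bidual_space E =
     {\<Phi> \<in> extensional (dual_space E).
        (\<forall>f\<in>dual_space E. \<forall>g\<in>dual_space E. \<Phi> (\<lambda>x\<in>E. f x + g x) = \<Phi> f + \<Phi> g) \<and>
        (\<forall>c. \<forall>f\<in>dual_space E. \<Phi> (\<lambda>x\<in>E. c * f x) = c * \<Phi> f) \<and>
        (\<exists>C. \<forall>f\<in>dual_space E. cmod (\<Phi> f) \<le> C * dual_norm E f)}"

definition bidual_embedding :: "'a::cstar_algebra set \<Rightarrow> 'a \<Rightarrow> ('a \<Rightarrow> complex) \<Rightarrow> complex" where
  "bidual_embedding E x = (\<lambda>f\<in>dual_space E. f x)"

definition weak_star_topology ::
    "'a::cstar_algebra set \<Rightarrow> (('a \<Rightarrow> complex) \<Rightarrow> complex) topology" where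
  "weak_star_topology E =
     subtopology (product_topology (\<lambda>_. euclidean) (dual_space E)) (bidual_space E)"

definition perp_perp ::
    "'a::cstar_algebra set \<Rightarrow> 'a set \<Rightarrow> (('a \<Rightarrow> complex) \<Rightarrow> complex) set" where
  "perp_perp E B = weak_star_topology E closure_of (bidual_embedding E ` B)"

text \<open>\<open>p\<close> is a limit point (cluster point) of the net \<open>s\<close>: the net is frequently in every
  neighbourhood of \<open>p\<close>, equivalently some subnet converges to \<open>p\<close>.\<close>

definition net_limit_point :: "'x topology \<Rightarrow> 'i filter \<Rightarrow> ('i \<Rightarrow> 'x) \<Rightarrow> 'x \<Rightarrow> bool" where
  "net_limit_point T F s p \<longleftrightarrow>
     p \<in> topspace T \<and> (\<forall>U. openin T U \<and> p \<in> U \<longrightarrow> (\<exists>\<^sub>F i in F. s i \<in> U))"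

end

theory Submission
  imports Defs
begin

text \<open>Let \<open>J = Ker \<theta>\<close>. In case (b), Mazur's argument (Hahn--Banach separation) shows that convex
  combinations of the cai come arbitrarily close to \<open>B\<close> in norm, so in both cases \<open>J\<close> has
  approximate units consisting of contractions that are almost in \<open>B\<close>, although perhaps not in
  \<open>B \<inter> J\<close>.

  A contraction \<open>e\<close> of a C*-algebra that almost fixes \<open>w\<close> has an adjoint that almost fixes \<open>w\<close>.
  Hence differences of successive approximate units act on almost orthogonal blocks, and after
  averaging there are units \<open>x\<close> with \<open>\<parallel>x u + (1 - x) v\<parallel> \<le> max \<parallel>u\<parallel> \<parallel>v\<parallel> + \<delta>\<close>; in the bidual this is
  the statement that the support projection of \<open>J\<close> is central. Applied to \<open>u = b / (1 + \<epsilon>)\<close> and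
  \<open>v = b - j\<close> it replaces \<open>b\<close> by \<open>b - \<lambda> x b\<close> with \<open>\<lambda> \<le> \<epsilon>\<close>, which lowers the norm of \<open>b\<close> from
  \<open>1 + \<epsilon>\<close> almost to the quotient norm, moves \<open>b\<close> by \<open>O(\<epsilon>)\<close> and stays close to \<open>B\<close>. Successive
  approximation, first with scalars to correct the small errors in \<open>\<theta>\<close> and then with matrices,
  yields preimages in \<open>B\<close> that attain the quotient norm.

  No representation theory is used: norms of matrices enter only through the C*-identity, and the
  scalar matrices and matrix units are controlled because *-homomorphisms out of a C*-algebra are
  contractive.\<close>

section \<open>C*-normed algebras\<close>

text \<open>With \<open>p\<close> the support projection of the kernel,
  \<open>p u + (1 - p) v\<close> would have norm at most the larger of the two norms. Only
  approximants of \<open>p\<close> are at hand, and for a single unit \<open>x\<close> the factor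
  \<open>1 - x\<close> may have norm 2. Weak convergence is replaced by explicit midpoints: the
  invariants are quantified over all finite sets and tolerances, so a second unit can be chosen
  after the first and adapted to it, and the C*-identity turns a small cross term into a shorter
  midpoint. The step \<open>b - \<lambda> c b\<close> with \<open>c\<close> in \<open>B\<close> near
  \<open>x\<close> lowers the norm but shifts \<open>\<theta> b\<close>, because
  \<open>\<theta> c\<close> is small without being zero. The shift has to be undone inside
  \<open>B\<close>, entry by entry, at a cost proportional to its size. Hence a lift of single
  elements with the crude constant 2, which also yields closedness, must precede the matrix case.
  The matrix iteration then moves each entry by a multiple of the current excess of the norm over 1;
  with geometrically decreasing excesses the limit exists and the norm is attained exactly.\<close>

lemma star_zero [simp]: "star (0::'a::cstar_algebra) = 0"
proof -
  have "star (0 + 0::'a) = star 0 + star 0" by (rule star_add)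
  then show ?thesis by simp
qed

lemma star_minus: "star (- x) = - star (x::'a::cstar_algebra)"
  using star_add[of x "- x"] by (simp add: eq_neg_iff_add_eq_0 add.commute)

lemma star_diff: "star (x - y) = star x - star (y::'a::cstar_algebra)"
  using star_add[of x "- y"] by (simp add: star_minus)

lemma star_scaleR: "star (r *\<^sub>R x) = r *\<^sub>R star (x::'a::cstar_algebra)"
  using star_scaleC[of "complex_of_real r" x] by (simp add: scaleC_of_real)

lemma norm_star [simp]: "norm (star x) = norm (x::'a::cstar_algebra)"
proof -
  have "norm y \<le> norm (star y)" for y :: 'a
  proof (cases "y = 0")
    case False
    have "norm y * norm y \<le> norm (star y) * norm y"
      using norm_mult_ineq[of "star y" y] by (simp add: cstar_identity power2_eq_square)
    with False show ?thesis by simp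
  qed simp
  from this[of x] this[of "star x"] show ?thesis by (simp add: star_star)
qed

lemma continuous_on_star: "continuous_on A (star :: 'a::cstar_algebra \<Rightarrow> 'a)"
proof (rule continuous_onI)
  fix x and e :: real assume "0 < e"
  then show "\<exists>d>0. \<forall>x'\<in>A. dist x' x < d \<longrightarrow> dist (star x') (star x) \<le> e"
    by (intro exI[of _ e]) (simp add: dist_norm flip: star_diff)
qed

text \<open>The element \<open>1 - g\<close> of the unitization is the square root of \<open>1 - h\<close>; it is the fixed point
  of \<open>g \<mapsto> (h + g\<^sup>2) / 2\<close>.\<close>

lemma cstar_sqrt_one_minus:
  fixes h k :: "'a::cstar_algebra"
  assumes h: "norm h < 1" "star h = h" "k * h = h * k"
  obtains g where "star g = g" "k * g = g * k" "g + g - g * g = h"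
proof -
  \<comment> \<open>The smaller root of \<open>R\<^sup>2 - 2 R + norm h = 0\<close>, which makes the
    ball of radius \<open>R\<close> invariant; it is below 1 and thus also serves as the contraction
    constant.\<close>
  define R where "R = 1 - sqrt (1 - norm h)"
  have R: "0 \<le> R" "R < 1" using h by (auto simp: R_def real_sqrt_le_1_iff)
  have RR: "norm h + R * R = 2 * R"
  proof -
    have "(1 - R) * (1 - R) = 1 - norm h" using h by (simp add: R_def)
    then show ?thesis by (simp add: algebra_simps)
  qed
  \<comment> \<open>Selfadjointness and commutation with \<open>k\<close> are closed conditions that
    the iteration preserves, so the fixed point inherits them.\<close>
  define S where "S = {g. norm g \<le> R \<and> star g = g \<and> k * g = g * k}"
  have "closed S" unfolding S_def
    by (intro closed_Collect_conj closed_Collect_le closed_Collect_eq continuous_intros continuous_on_star)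
  then have cS: "complete S" by (simp add: complete_eq_closed)
  have "0 \<in> S" using R by (simp add: S_def)
  then have neS: "S \<noteq> {}" by blast
  define T where "T g = (1/2) *\<^sub>R (h + g * g)" for g
  have "T g \<in> S" if g: "g \<in> S" for g
  proof -
    have "norm (g * g) \<le> R * R"
      using g R by (intro order_trans[OF norm_mult_ineq] mult_mono) (auto simp: S_def)
    then have "norm (h + g * g) \<le> 2 * R" using norm_triangle_ineq[of h "g * g"] RR by simp
    moreover have "k * (g * g) = g * g * k" using g by (metis (mono_tags, lifting) S_def mem_Collect_eq mult.assoc)
    ultimately show ?thesis using g h
      by (simp add: S_def T_def star_scaleR star_add star_mult distrib_left distrib_right)
  qed
  then have TS: "T ` S \<subseteq> S" by blast
  have lip: "dist (T g) (T g') \<le> R * dist g g'" if g: "g \<in> S" "g' \<in> S" for g g'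
  proof -
    have "T g - T g' = (1/2) *\<^sub>R (g * (g - g') + (g - g') * g')"
      by (simp add: T_def algebra_simps)
    moreover have "norm (g * (g - g')) \<le> R * norm (g - g')"
      using g by (intro order_trans[OF norm_mult_ineq] mult_right_mono) (auto simp: S_def)
    moreover have "norm ((g - g') * g') \<le> norm (g - g') * R"
      using g by (intro order_trans[OF norm_mult_ineq] mult_left_mono) (auto simp: S_def)
    ultimately show ?thesis
      using norm_triangle_ineq[of "g * (g - g')" "(g - g') * g'"] by (simp add: dist_norm mult.commute)
  qed
  obtain g where g: "g \<in> S" "T g = g"
    using Banach_fix[OF cS neS R TS] lip by blast
  have "g + g = 2 *\<^sub>R T g" by (simp add: g scaleR_2)
  then have "g + g - g * g = h" by (simp add: T_def)
  with g show thesis by (intro that[of g]) (auto simp: S_def)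
qed

text \<open>\<open>C\<close> is a C*-normed algebra, where \<open>im\<close> is multiplication by \<open>\<i>\<close>; completeness is not
  assumed, and the operations are total on the ambient algebra.\<close>

locale cstar_normed =
  fixes C :: "'m::real_algebra set" and \<nu> :: "'m \<Rightarrow> real" and st im :: "'m \<Rightarrow> 'm"
  assumes C_add [simp, intro]: "a \<in> C \<Longrightarrow> b \<in> C \<Longrightarrow> a + b \<in> C"
    and C_mult [simp, intro]: "a \<in> C \<Longrightarrow> b \<in> C \<Longrightarrow> a * b \<in> C"
    and C_scaleR [simp, intro]: "a \<in> C \<Longrightarrow> r *\<^sub>R a \<in> C"
    and C_st [simp, intro]: "a \<in> C \<Longrightarrow> st a \<in> C"
    and C_im [simp, intro]: "a \<in> C \<Longrightarrow> im a \<in> C"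
    and nu_triangle: "a \<in> C \<Longrightarrow> b \<in> C \<Longrightarrow> \<nu> (a + b) \<le> \<nu> a + \<nu> b"
    and nu_scaleR: "a \<in> C \<Longrightarrow> \<nu> (r *\<^sub>R a) = \<bar>r\<bar> * \<nu> a"
    and nu_mult: "a \<in> C \<Longrightarrow> b \<in> C \<Longrightarrow> \<nu> (a * b) \<le> \<nu> a * \<nu> b"
    and nu_nonneg [simp]: "a \<in> C \<Longrightarrow> 0 \<le> \<nu> a"
    and nu_cstar: "a \<in> C \<Longrightarrow> \<nu> (st a * a) = (\<nu> a)\<^sup>2"
    and st_st [simp]: "st (st a) = a"
    and st_add: "st (a + b) = st a + st b"
    and st_scaleR: "st (r *\<^sub>R a) = r *\<^sub>R st a"
    and st_mult: "st (a * b) = st b * st a"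
    and im_add: "im (a + b) = im a + im b"
    and im_mult_left: "im a * b = im (a * b)"
    and im_mult_right: "a * im b = im (a * b)"
    and im_im: "im (im a) = - a"
    and st_im: "st (im a) = - im (st a)"
begin

lemma C_minus [simp, intro]: "a \<in> C \<Longrightarrow> - a \<in> C"
  using C_scaleR[of a "-1"] by simp

lemma C_diff [simp, intro]: "a \<in> C \<Longrightarrow> b \<in> C \<Longrightarrow> a - b \<in> C"
  using C_add[of a "- b"] by simp

lemma nu_minus: "a \<in> C \<Longrightarrow> \<nu> (- a) = \<nu> a"
  using nu_scaleR[of a "-1"] by simp

lemma nu_diff: "a \<in> C \<Longrightarrow> b \<in> C \<Longrightarrow> \<nu> (a - b) \<le> \<nu> a + \<nu> b"
  using nu_triangle[of a "- b"] by (simp add: nu_minus)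

lemma nu_minus_commute: "a \<in> C \<Longrightarrow> b \<in> C \<Longrightarrow> \<nu> (a - b) = \<nu> (b - a)"
  using nu_minus[of "a - b"] by simp

lemma st_minus: "st (- a) = - st a"
  using st_scaleR[of "-1" a] by simp

lemma st_diff: "st (a - b) = st a - st b"
  using st_add[of a "- b"] by (simp add: st_minus)

lemma im_minus: "im (- a) = - im a"
proof -
  have "im 0 + im 0 = im 0" using im_add[of 0 0] by simp
  then have "im 0 = 0" by simp
  then show ?thesis using im_add[of a "- a"] by (simp add: eq_neg_iff_add_eq_0 add.commute)
qed

lemma im_diff: "im (a - b) = im a - im b"
  using im_add[of a "- b"] by (simp add: im_minus)

lemma nu_st [simp]:
  assumes "a \<in> C" shows "\<nu> (st a) = \<nu> a"
proof -
  have "\<nu> b \<le> \<nu> (st b)" if b: "b \<in> C" for b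
  proof (cases "\<nu> b = 0")
    case False
    have "\<nu> b * \<nu> b \<le> \<nu> (st b) * \<nu> b"
      using nu_mult[of "st b" b] b by (simp add: nu_cstar power2_eq_square)
    with False nu_nonneg[OF b] show ?thesis by simp
  qed (use b in simp)
  from this[OF assms] this[of "st a"] assms show ?thesis by simp
qed

lemma nu_cstar': "a \<in> C \<Longrightarrow> \<nu> (a * st a) = (\<nu> a)\<^sup>2"
  using nu_cstar[of "st a"] by simp

lemma nu_mult_le: "a \<in> C \<Longrightarrow> b \<in> C \<Longrightarrow> \<nu> a \<le> s \<Longrightarrow> \<nu> b \<le> t \<Longrightarrow> \<nu> (a * b) \<le> s * t"
  by (rule order_trans[OF nu_mult]) (auto intro!: mult_mono elim: order_trans[OF nu_nonneg])

lemma nu_triangle_le: "a \<in> C \<Longrightarrow> b \<in> C \<Longrightarrow> \<nu> a \<le> s \<Longrightarrow> \<nu> b \<le> t \<Longrightarrow> \<nu> (a + b) \<le> s + t"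
  using nu_triangle[of a b] by simp

lemma nu_diff_le: "a \<in> C \<Longrightarrow> b \<in> C \<Longrightarrow> \<nu> a \<le> s \<Longrightarrow> \<nu> b \<le> t \<Longrightarrow> \<nu> (a - b) \<le> s + t"
  using nu_diff[of a b] by simp

text \<open>A selfadjoint \<open>h\<close> of norm less than 1 is the mean of the two unitaries
  \<open>h \<plusminus> \<i> (1 - h\<^sup>2)\<^sup>1\<^sup>/\<^sup>2\<close>, and a *-homomorphism maps unitaries to unitaries.\<close>

lemma star_hom_contractive:
  fixes \<phi> :: "'a::cstar_algebra \<Rightarrow> 'm"
  assumes C: "\<And>x. \<phi> x \<in> C"
    and add: "\<And>x y. \<phi> (x + y) = \<phi> x + \<phi> y"
    and scale: "\<And>r x. \<phi> (r *\<^sub>R x) = r *\<^sub>R \<phi> x"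
    and mult: "\<And>x y. \<phi> (x * y) = \<phi> x * \<phi> y"
    and st: "\<And>x. \<phi> (star x) = st (\<phi> x)"
  shows "\<nu> (\<phi> x) \<le> norm x"
proof -
  have diff: "\<phi> (x - y) = \<phi> x - \<phi> y" for x y
    using add[of "x - y" y] by simp
  have *: "\<nu> (\<phi> h) \<le> 1" if h: "norm h < 1" "star h = h" for h
  proof -
    have "norm (h * h) < 1" using cstar_identity[of h] h by (simp add: power_less_one_iff)
    then obtain g where g: "star g = g" "h * g = g * h" "g + g - g * g = h * h"
      by (rule cstar_sqrt_one_minus[of "h * h" h]) (auto simp: h star_mult mult.assoc)
    define H G where "H = \<phi> h" and "G = \<phi> g"
    have HG: "H \<in> C" "G \<in> C" "st H = H" "st G = G" "H * G = G * H" "G + G - G * G = H * H"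
      using g h by (simp_all add: H_def G_def C flip: st mult add diff)
    have HH: "H * (H * z) = G * z + G * z - G * (G * z)" for z
    proof -
      have "H * (H * z) = (G + G - G * G) * z" by (simp add: HG mult.assoc)
      then show ?thesis by (simp add: algebra_simps)
    qed
    have GH: "G * (H * z) = H * (G * z)" for z by (metis HG(5) mult.assoc)
    \<comment> \<open>\<open>C\<close> need not contain a unit, so the two unitaries appear only
      applied to some \<open>y\<close>: \<open>U\<close> and \<open>V\<close> are \<open>H y\<close>
      plus and minus \<open>i (1 - G) y\<close>, with \<open>1 - G\<close> as the square root of
      \<open>1 - H\<^sup>2\<close>.\<close>
    have le: "\<nu> (H * y) \<le> \<nu> y" if y: "y \<in> C" for y
    proof -
      define U where "U = H * y + im (y - G * y)"
      define V where "V = H * y - im (y - G * y)"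
      have UV: "U \<in> C" "V \<in> C" using HG y by (auto simp: U_def V_def)
      define P K where "P = H * y" and "K = y - G * y"
      have U_eq: "U = P + im K" and V_eq: "V = P - im K" by (simp_all add: U_def V_def P_def K_def)
      have stPK: "st P = st y * H" "st K = st y - st y * G"
        by (simp_all add: P_def K_def st_mult st_diff HG)
      have "st P * K = st K * P"
        unfolding stPK by (simp add: P_def K_def right_diff_distrib left_diff_distrib mult.assoc GH)
      moreover have "st P * P + st K * K = st y * y"
      proof -
        have "st P * P = st y * (G * y + G * y - G * (G * y))"
          unfolding stPK by (simp add: P_def mult.assoc HH)
        moreover have "st K * K = st y * (y - G * y - (G * y - G * (G * y)))"
          unfolding stPK by (simp add: K_def right_diff_distrib left_diff_distrib mult.assoc)
        ultimately show ?thesis by (simp add: distrib_left right_diff_distrib)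
      qed
      ultimately have UU: "st U * U = st y * y" and VV: "st V * V = st y * y"
        unfolding U_eq V_eq st_add st_diff st_im
        by (simp_all add: distrib_left distrib_right left_diff_distrib right_diff_distrib
            im_mult_left im_mult_right im_im im_add im_diff)
      have "(\<nu> U)\<^sup>2 = (\<nu> y)\<^sup>2" using UU nu_cstar UV y by metis
      then have U: "\<nu> U = \<nu> y" using UV y by simp
      have "(\<nu> V)\<^sup>2 = (\<nu> y)\<^sup>2" using VV nu_cstar UV y by metis
      then have V: "\<nu> V = \<nu> y" using UV y by simp
      have "U + V = 2 *\<^sub>R (H * y)" by (simp add: U_def V_def scaleR_2)
      then have "2 * \<nu> (H * y) = \<nu> (U + V)" using HG y by (simp add: nu_scaleR)
      also have "\<dots> \<le> 2 * \<nu> y" using nu_triangle[of U V] UV U V by simp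
      finally show ?thesis by simp
    qed
    \<comment> \<open>Taking \<open>y = H\<close> bounds \<open>\<nu> (H * H)\<close> by
      \<open>\<nu> H\<close>, and \<open>H\<close> is selfadjoint.\<close>
    have "\<nu> H * \<nu> H \<le> \<nu> H" using le[OF HG(1)] nu_cstar[OF HG(1)] HG by (simp add: power2_eq_square)
    then show ?thesis unfolding H_def[symmetric]
      using mult_strict_left_mono[of 1 "\<nu> H" "\<nu> H"] by linarith
  qed
  have sa: "\<nu> (\<phi> h) \<le> norm h" if h: "star h = h" for h
  proof (rule field_le_epsilon)
    fix e :: real assume e: "0 < e"
    define r where "r = norm h + e"
    have r: "0 < r" using e by (simp add: r_def add_nonneg_pos)
    have "norm ((1/r) *\<^sub>R h) < 1" using e r by (simp add: r_def divide_simps)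
    then have "\<nu> (\<phi> ((1/r) *\<^sub>R h)) \<le> 1" by (rule *) (simp add: star_scaleR h)
    then show "\<nu> (\<phi> h) \<le> norm h + e" using r by (simp add: scale nu_scaleR C divide_simps flip: r_def)
  qed
  have "(\<nu> (\<phi> x))\<^sup>2 = \<nu> (\<phi> (star x * x))" by (simp add: mult st nu_cstar C)
  also have "\<dots> \<le> norm (star x * x)" by (rule sa) (simp add: star_mult star_star)
  also have "\<dots> = (norm x)\<^sup>2" by (rule cstar_identity)
  finally show ?thesis using norm_ge_zero power2_le_imp_le by blast
qed

text \<open>A self-improving estimate: squaring turns \<open>h + g\<close> into
  \<open>h\<^sup>2 + g\<^sup>2\<close> plus cross terms of norm at most \<open>2 \<eta>\<close>, and
  \<open>h\<^sup>2\<close>, \<open>g\<^sup>2\<close> satisfy the same hypotheses with the same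
  \<open>\<eta>\<close>. Hence the supremum \<open>d\<close> over all such pairs, finite because it
  is at most 2, obeys \<open>d\<^sup>2 \<le> d + 2 \<eta>\<close>.\<close>

lemma orth_sa:
  assumes h: "h \<in> C" "g \<in> C" "st h = h" "st g = g" "\<nu> h \<le> 1" "\<nu> g \<le> 1" "\<nu> (h * g) \<le> \<eta>"
  shows "\<nu> (h + g) \<le> 1 + 2 * \<eta>"
proof -
  define P where "P h g \<longleftrightarrow> h \<in> C \<and> g \<in> C \<and> st h = h \<and> st g = g \<and> \<nu> h \<le> 1 \<and> \<nu> g \<le> 1 \<and> \<nu> (h * g) \<le> \<eta>"
    for h g
  define D where "D = {\<nu> (h + g) | h g. P h g}"
  have bdd: "bdd_above D"
    by (rule bdd_aboveI[of _ 2]) (auto simp: D_def P_def intro: nu_triangle_le[where s = 1 and t = 1, simplified])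
  define d where "d = Sup D"
  have ub: "\<nu> (h + g) \<le> d" if "P h g" for h g
    unfolding d_def by (rule cSup_upper[OF _ bdd]) (use that in \<open>auto simp: D_def\<close>)
  have ne: "D \<noteq> {}" using h by (auto simp: D_def P_def)
  have eta: "0 \<le> \<eta>" using h nu_nonneg[of "h * g"] by (meson C_mult order_trans)
  have sq: "(\<nu> (h + g))\<^sup>2 \<le> d + 2 * \<eta>" if P: "P h g" for h g
  proof -
    have hg: "h \<in> C" "g \<in> C" "st h = h" "st g = g" "\<nu> h \<le> 1" "\<nu> g \<le> 1" "\<nu> (h * g) \<le> \<eta>"
      using P by (auto simp: P_def)
    have gh: "\<nu> (g * h) \<le> \<eta>" using nu_st[of "h * g"] hg by (simp add: st_mult)
    have "\<nu> (h * h) \<le> 1" "\<nu> (g * g) \<le> 1"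
      using nu_mult_le[of h h 1 1] nu_mult_le[of g g 1 1] hg by auto
    moreover have "\<nu> (h * (h * g) * g) \<le> 1 * \<eta> * 1" using hg by (intro nu_mult_le) auto
    ultimately have "P (h * h) (g * g)" using hg by (simp add: P_def st_mult mult.assoc)
    then have "\<nu> (h * h + g * g) \<le> d" by (rule ub)
    moreover have "(\<nu> (h + g))\<^sup>2 = \<nu> ((h * h + g * g) + (h * g + g * h))"
      using nu_cstar[of "h + g"] hg by (simp add: st_add algebra_simps)
    moreover have "\<dots> \<le> \<nu> (h * h + g * g) + (\<eta> + \<eta>)"
      using hg gh by (intro nu_triangle_le) auto
    ultimately show ?thesis by simp
  qed
  have "P h g" using h by (simp add: P_def)
  then have d0: "0 \<le> d" using ub[of h g] h nu_nonneg[of "h + g"] by (meson C_add order_trans)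
  have "d \<le> sqrt (d + 2 * \<eta>)" unfolding d_def
  proof (rule cSup_least[OF ne])
    fix y assume "y \<in> D"
    then obtain h g where "y = \<nu> (h + g)" "P h g" by (auto simp: D_def)
    then show "y \<le> sqrt (Sup D + 2 * \<eta>)" using sq real_le_rsqrt by (simp flip: d_def)
  qed
  then have "d\<^sup>2 \<le> (sqrt (d + 2 * \<eta>))\<^sup>2" using d0 by (intro power_mono)
  then have dd: "d\<^sup>2 \<le> d + 2 * \<eta>" using d0 eta by simp
  have "d \<le> 1 + 2 * \<eta>"
  proof (rule ccontr)
    assume "\<not> ?thesis"
    then have "1 + 2 * \<eta> < d" by simp
    then have "d * (1 + 2 * \<eta>) < d * d" using eta by (intro mult_strict_left_mono) auto
    moreover have "1 * (2 * \<eta>) \<le> d * (2 * \<eta>)" using \<open>1 + 2 * \<eta> < d\<close> eta by (intro mult_right_mono) auto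
    ultimately show False using dd by (simp add: algebra_simps power2_eq_square)
  qed
  then show ?thesis using ub[of h g] h by (simp add: P_def)
qed

text \<open>Expand \<open>st (s + t) * (s + t)\<close>. The terms \<open>st s * s\<close> and
  \<open>st t * t\<close> fall under \<open>orth_sa\<close>, as \<open>s * st t\<close> stands in
  the middle of their product; the cross terms are bounded by the other hypothesis. Since
  \<open>1 \<le> R\<close>, normalizing by \<open>R\<close> does not enlarge
  \<open>\<eta>\<close>.\<close>

lemma nu_orthogonal_sum:
  assumes s: "s \<in> C" "t \<in> C" "\<nu> s \<le> R" "\<nu> t \<le> R" "1 \<le> R"
    and "\<nu> (st s * t) \<le> \<eta>" "\<nu> (s * st t) \<le> \<eta>"
  shows "\<nu> (s + t) \<le> R * (1 + 2 * \<eta>)"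
proof -
  have eta: "0 \<le> \<eta>" using assms nu_nonneg[of "s * st t"] by (meson C_mult C_st order_trans)
  have *: "\<nu> (s + t) \<le> 1 + 2 * \<eta>"
    if s: "s \<in> C" "t \<in> C" "\<nu> s \<le> 1" "\<nu> t \<le> 1" "\<nu> (st s * t) \<le> \<eta>" "\<nu> (s * st t) \<le> \<eta>" for s t
  proof -
    have "\<nu> (st s * (s * st t) * t) \<le> 1 * \<eta> * 1" using s by (intro nu_mult_le) auto
    then have "\<nu> (st s * s + st t * t) \<le> 1 + 2 * \<eta>"
      using s by (intro orth_sa) (auto simp: st_mult nu_cstar power_le_one_iff mult.assoc)
    moreover have "\<nu> (st t * s) \<le> \<eta>" using nu_st[of "st s * t"] s by (simp add: st_mult)
    then have "\<nu> ((st s * s + st t * t) + (st s * t + st t * s)) \<le> \<nu> (st s * s + st t * t) + (\<eta> + \<eta>)"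
      using s by (intro nu_triangle_le) auto
    moreover have "(\<nu> (s + t))\<^sup>2 = \<nu> ((st s * s + st t * t) + (st s * t + st t * s))"
      using nu_cstar[of "s + t"] s by (simp add: st_add algebra_simps)
    ultimately have "(\<nu> (s + t))\<^sup>2 \<le> 1 + 4 * \<eta>" by linarith
    also have "\<dots> \<le> 1 + 4 * \<eta> + (2 * \<eta>)\<^sup>2" by simp
    also have "\<dots> = (1 + 2 * \<eta>)\<^sup>2" by (simp add: power2_sum)
    finally have "(\<nu> (s + t))\<^sup>2 \<le> (1 + 2 * \<eta>)\<^sup>2" .
    then show ?thesis using eta by (auto intro: power2_le_imp_le[of _ "1 + 2 * \<eta>"])
  qed
  have le: "\<bar>1/R\<bar> * (\<bar>1/R\<bar> * y) \<le> \<eta>" if "y \<le> \<eta>" "0 \<le> y" for y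
  proof -
    have "\<bar>1/R\<bar> \<le> 1" using s(5) by simp
    then have "\<bar>1/R\<bar> * (\<bar>1/R\<bar> * y) \<le> 1 * (1 * y)" using that by (intro mult_mono) auto
    then show ?thesis using that by linarith
  qed
  have "\<nu> ((1/R) *\<^sub>R s + (1/R) *\<^sub>R t) \<le> 1 + 2 * \<eta>"
  proof (rule *)
    show "\<nu> (st ((1/R) *\<^sub>R s) * (1/R) *\<^sub>R t) \<le> \<eta>" "\<nu> ((1/R) *\<^sub>R s * st ((1/R) *\<^sub>R t)) \<le> \<eta>"
      using le[of "\<nu> (st s * t)"] le[of "\<nu> (s * st t)"] assms
      by (simp_all only: st_scaleR mult_scaleR_left mult_scaleR_right nu_scaleR C_scaleR C_mult C_st nu_nonneg)
  qed (use s in \<open>auto simp: nu_scaleR divide_simps\<close>)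
  then have "\<nu> ((1/R) *\<^sub>R (s + t)) \<le> 1 + 2 * \<eta>" by (simp add: scaleR_add_right)
  then show ?thesis using s by (simp add: nu_scaleR divide_simps mult.commute)
qed

end

section \<open>Approximate units of an ideal\<close>

text \<open>Here \<open>d\<close> embeds the C*-algebra \<open>'a\<close> as the scalar matrices of \<open>C\<close>, and the elements of
  \<open>Y \<eta>\<close> are the candidates for approximate units of \<open>J\<close> which are \<open>\<eta>\<close>-close to the subalgebra
  under consideration.\<close>

locale cstar_units = cstar_normed C \<nu> st im
  for C :: "'m::real_algebra set" and \<nu> st im +
  fixes d :: "'a::cstar_algebra \<Rightarrow> 'm" and E J :: "'m set" and Y :: "real \<Rightarrow> 'a set"
  assumes d_C [simp, intro]: "d x \<in> C"
    and d_add: "d (x + y) = d x + d y"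
    and d_scaleR: "d (r *\<^sub>R x) = r *\<^sub>R d x"
    and d_mult: "d (x * y) = d x * d y"
    and d_star: "d (star x) = st (d x)"
    and E_C: "a \<in> E \<Longrightarrow> a \<in> C"
    and E_add: "a \<in> E \<Longrightarrow> b \<in> E \<Longrightarrow> a + b \<in> E"
    and E_scaleR: "a \<in> E \<Longrightarrow> r *\<^sub>R a \<in> E"
    and J_E: "a \<in> J \<Longrightarrow> a \<in> E"
    and J_add: "a \<in> J \<Longrightarrow> b \<in> J \<Longrightarrow> a + b \<in> J"
    and J_scaleR: "a \<in> J \<Longrightarrow> r *\<^sub>R a \<in> J"
    and J_left: "a \<in> E \<Longrightarrow> b \<in> J \<Longrightarrow> a * b \<in> J"
    and J_right: "a \<in> J \<Longrightarrow> b \<in> E \<Longrightarrow> a * b \<in> J"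
    and Y_J: "x \<in> Y \<eta> \<Longrightarrow> d x \<in> J"
    and Y_midpoint: "x \<in> Y \<eta> \<Longrightarrow> y \<in> Y \<eta> \<Longrightarrow> (1/2) *\<^sub>R (x + y) \<in> Y \<eta>"
    and Y_mono: "\<eta> \<le> \<eta>' \<Longrightarrow> x \<in> Y \<eta> \<Longrightarrow> x \<in> Y \<eta>'"
    and Y_units: "finite S \<Longrightarrow> S \<subseteq> J \<Longrightarrow> 0 < \<eta> \<Longrightarrow>
      \<exists>x\<in>Y \<eta>. norm x \<le> 1 \<and> (\<forall>s\<in>S. \<nu> (d x * s - s) \<le> \<eta> \<and> \<nu> (s * d x - s) \<le> \<eta>)"
begin

lemma E_diff: "a \<in> E \<Longrightarrow> b \<in> E \<Longrightarrow> a - b \<in> E"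
  using E_add[of a "- b"] E_scaleR[of b "-1"] by simp

lemma J_diff: "a \<in> J \<Longrightarrow> b \<in> J \<Longrightarrow> a - b \<in> J"
  using J_add[of a "- b"] J_scaleR[of b "-1"] by simp

lemma J_C: "a \<in> J \<Longrightarrow> a \<in> C"
  by (simp add: J_E E_C)

lemma nu_d: "\<nu> (d x) \<le> norm x"
  by (rule star_hom_contractive) (simp_all add: d_add d_scaleR d_mult d_star)

text \<open>Since \<open>1 - e\<^sup>* e = (1 - g)\<^sup>2\<close> is positive, \<open>w\<^sup>* (1 - e\<^sup>* e) w\<close> controls \<open>(1 - g) w\<close>.\<close>

lemma contraction_almost_isometric:
  assumes e: "norm e \<le> 1" and w: "w \<in> C"
  shows "(\<nu> (w - st (d e) * (d e * w)))\<^sup>2 \<le> 2 * \<nu> (st w * w - st (d e * w) * (d e * w))"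
proof -
  define X where "X = \<nu> (st w * w - st (d e * w) * (d e * w))"
  define n where "n = \<nu> w"
  have n: "0 \<le> n" using w by (simp add: n_def)
  have de: "\<nu> (d e) \<le> 1" using nu_d[of e] e by simp
  have ew: "\<nu> (d e * w) \<le> n" using nu_mult_le[of "d e" w 1 n] de w by (simp add: n_def)
  \<comment> \<open>Square roots are available for norms below 1 only, so \<open>star e * e\<close>
    is first shrunk by \<open>r\<close>; the limit \<open>r \<rightarrow> 1\<close> comes at the
    end.\<close>
  have bound: "\<nu> (w - st (d e) * (d e * w)) \<le> sqrt (2 * (X + (1 - r) * n\<^sup>2)) + (1 - r) * n"
    if r: "0 < r" "r < 1" for r
  proof -
    have "norm (r *\<^sub>R (star e * e)) < 1"
      using e r mult_le_one[of "norm e" "norm e"] mult_strict_mono[of r 1 "norm e * norm e" 1]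
      by (auto simp: cstar_identity power2_eq_square intro: le_less_trans[OF mult_left_le])
    then obtain g where g: "star g = g" "g + g - g * g = r *\<^sub>R (star e * e)"
      by (rule cstar_sqrt_one_minus[where k = 0])
        (auto simp: star_scaleR star_mult star_star)
    define G H where "G = d g" and "H = r *\<^sub>R (st (d e) * d e)"
    have G: "G \<in> C" "st G = G" and H: "H \<in> C" using g by (auto simp: G_def H_def simp flip: d_star)
    have "G + G - G * G = d (g + g - g * g)"
      using d_add[of "g + g - g * g" "g * g"] by (simp add: G_def d_add d_mult)
    then have "G + G - G * G = H" by (simp add: g H_def d_scaleR d_mult d_star)
    then have GG: "G * z + G * z - G * (G * z) = H * z" for z
      by (metis distrib_right left_diff_distrib mult.assoc)
    have sq: "st (z - G * z) * (z - G * z) = st z * z - st z * (H * z)"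
      and two: "(z - G * z) - G * (z - G * z) = z - H * z" for z
      by (simp_all add: st_diff st_mult G GG[symmetric] algebra_simps)
    \<comment> \<open>As \<open>1 - H = (1 - G)\<^sup>2\<close>, the norm of
      \<open>b = (1 - G) w\<close> is governed by \<open>st w * (1 - H) w\<close> and thereby by
      \<open>X\<close>. Applying \<open>1 - G\<close> once more gives \<open>w - H * w\<close> at
      the cost of a factor \<open>sqrt 2\<close>.\<close>
    define b where "b = w - G * w"
    have b: "b \<in> C" using w G by (simp add: b_def)
    have "st b * b = (st w * w - st (d e * w) * (d e * w)) + (1 - r) *\<^sub>R (st (d e * w) * (d e * w))"
      unfolding b_def sq H_def by (simp add: st_mult algebra_simps)
    then have "(\<nu> b)\<^sup>2 \<le> X + (1 - r) * \<nu> (st (d e * w) * (d e * w))"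
      using nu_triangle[of "st w * w - st (d e * w) * (d e * w)" "(1 - r) *\<^sub>R (st (d e * w) * (d e * w))"] w b r
      by (simp add: X_def nu_scaleR flip: nu_cstar)
    also have "\<dots> \<le> X + (1 - r) * n\<^sup>2"
      using r w ew by (simp add: nu_cstar power_mono)
    finally have b1: "(\<nu> b)\<^sup>2 \<le> X + (1 - r) * n\<^sup>2" .
    have "\<nu> H \<le> 1 * 1" unfolding H_def using r de
      by (subst nu_scaleR) (auto simp: nu_cstar intro!: mult_le_one power_le_one)
    then have "\<nu> (H * b) \<le> \<nu> b" using nu_mult_le[of H b 1 "\<nu> b"] H b by simp
    then have "\<nu> (st b * b - st b * (H * b)) \<le> (\<nu> b)\<^sup>2 + \<nu> b * \<nu> b"
      using b H by (intro nu_diff_le nu_mult_le) (auto simp: nu_cstar)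
    moreover have "(\<nu> (w - H * w))\<^sup>2 = \<nu> (st b * b - st b * (H * b))"
      using nu_cstar[of "b - G * b"] b G w H sq[of b] two[of w] by (simp add: b_def)
    ultimately have "(\<nu> (w - H * w))\<^sup>2 \<le> 2 * (X + (1 - r) * n\<^sup>2)"
      using b1 by (simp add: power2_eq_square)
    then have wH: "\<nu> (w - H * w) \<le> sqrt (2 * (X + (1 - r) * n\<^sup>2))" by (rule real_le_rsqrt)
    have "\<nu> (st (d e) * (d e * w)) \<le> n" using nu_mult_le[of "st (d e)" "d e * w" 1 n] de ew w by simp
    then have "\<nu> ((1 - r) *\<^sub>R (st (d e) * (d e * w))) \<le> (1 - r) * n"
      using r w by (simp add: nu_scaleR)
    then have "\<nu> ((w - H * w) - (1 - r) *\<^sub>R (st (d e) * (d e * w))) \<le>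
        sqrt (2 * (X + (1 - r) * n\<^sup>2)) + (1 - r) * n"
      using wH w H by (intro nu_diff_le) auto
    moreover have "(w - H * w) - (1 - r) *\<^sub>R (st (d e) * (d e * w)) = w - st (d e) * (d e * w)"
      by (simp add: H_def algebra_simps)
    ultimately show ?thesis by simp
  qed
  have "((\<lambda>r. sqrt (2 * (X + (1 - r) * n\<^sup>2)) + (1 - r) * n) \<longlongrightarrow> sqrt (2 * (X + (1 - 1) * n\<^sup>2)) + (1 - 1) * n)
      (at_left 1)"
    by (intro tendsto_intros)
  moreover have "\<forall>\<^sub>F r in at_left (1::real). \<nu> (w - st (d e) * (d e * w)) \<le>
      sqrt (2 * (X + (1 - r) * n\<^sup>2)) + (1 - r) * n"
    by (rule eventually_mono[OF eventually_at_left_real[of 0 1]]) (use bound in auto)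
  ultimately have "\<nu> (w - st (d e) * (d e * w)) \<le> sqrt (2 * (X + (1 - 1) * n\<^sup>2)) + (1 - 1) * n"
    by (intro tendsto_lowerbound) auto
  then have "\<nu> (w - st (d e) * (d e * w)) \<le> sqrt (2 * X)" by simp
  then have "(\<nu> (w - st (d e) * (d e * w)))\<^sup>2 \<le> (sqrt (2 * X))\<^sup>2" using w by (intro power_mono) auto
  moreover have "0 \<le> X" using w by (simp add: X_def)
  ultimately show ?thesis by (simp add: X_def)
qed

text \<open>The quantitative form of the Hilbert space fact that a vector fixed by a contraction is
  fixed by its adjoint. If \<open>e w\<close> is close to \<open>w\<close>, then \<open>w\<close>
  loses little length under \<open>e\<close>, so \<open>st e * e * w\<close> is close to
  \<open>w\<close> by the previous lemma, and \<open>st e * w\<close> is close to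
  \<open>st e * e * w\<close>. The square root arises because that lemma bounds a square.\<close>

lemma contraction_adjoint_fixes:
  assumes e: "norm e \<le> 1" and w: "w \<in> C" and \<eta>: "\<nu> (d e * w - w) \<le> \<eta>"
  shows "\<nu> (st (d e) * w - w) \<le> \<eta> + 2 * sqrt (\<nu> w * \<eta>)"
proof -
  have \<eta>': "\<nu> (w - d e * w) \<le> \<eta>" using \<eta> w by (simp add: nu_minus_commute)
  have de: "\<nu> (d e) \<le> 1" using nu_d[of e] e by simp
  have ew: "\<nu> (d e * w) \<le> \<nu> w" using nu_mult_le[of "d e" w 1 "\<nu> w"] de w by simp
  have "0 \<le> \<nu> (d e * w - w)" using w by simp
  then have \<eta>0: "0 \<le> \<eta>" using \<eta> by simp
  have "st w * w - st (d e * w) * (d e * w) = st (w - d e * w) * w + st (d e * w) * (w - d e * w)"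
    by (simp add: st_diff algebra_simps)
  moreover have "\<nu> \<dots> \<le> \<eta> * \<nu> w + \<nu> w * \<eta>"
    using w \<eta>' ew by (intro nu_triangle_le nu_mult_le) auto
  ultimately have "(\<nu> (w - st (d e) * (d e * w)))\<^sup>2 \<le> (2 * sqrt (\<nu> w * \<eta>))\<^sup>2"
    using contraction_almost_isometric[OF e w] w \<eta>0 by (simp add: power_mult_distrib mult.commute[of \<eta>])
  then have 1: "\<nu> (w - st (d e) * (d e * w)) \<le> 2 * sqrt (\<nu> w * \<eta>)"
    by (rule power2_le_imp_le) (use w \<eta>0 in auto)
  have "\<nu> (st (d e) * (w - d e * w)) \<le> 1 * \<eta>"
    using w \<eta>' de by (intro nu_mult_le) auto
  then have "\<nu> (st (d e) * (w - d e * w) - (w - st (d e) * (d e * w))) \<le> \<eta> + 2 * sqrt (\<nu> w * \<eta>)"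
    using 1 w by (intro nu_diff_le) auto
  then show ?thesis by (simp add: algebra_simps)
qed

text \<open>Adjoints are included because the orthogonality estimates form \<open>st s * t\<close>
  and \<open>s * st t\<close>, where adjoints of units meet elements of \<open>J\<close>. The
  adjoint of a unit need not lie in \<open>J\<close> itself.\<close>

definition Z :: "'m set \<Rightarrow> real \<Rightarrow> 'a set" where
  "Z S \<eta> = {x \<in> Y \<eta>. norm x \<le> 1 \<and> (\<forall>s\<in>S. \<nu> (d x * s - s) \<le> \<eta> \<and> \<nu> (s * d x - s) \<le> \<eta> \<and>
     \<nu> (st (d x) * s - s) \<le> \<eta> \<and> \<nu> (s * st (d x) - s) \<le> \<eta>)}"

lemma Z_mono: "S \<subseteq> T \<Longrightarrow> \<eta> \<le> \<eta>' \<Longrightarrow> x \<in> Z T \<eta> \<Longrightarrow> x \<in> Z S \<eta>'"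
  using Y_mono by (fastforce simp: Z_def)

lemma Z_J: "x \<in> Z S \<eta> \<Longrightarrow> d x \<in> J"
  by (auto simp: Z_def Y_J)

lemma Z_nu: "x \<in> Z S \<eta> \<Longrightarrow> \<nu> (d x) \<le> 1"
  using nu_d[of x] by (auto simp: Z_def)

lemma ZD:
  assumes "x \<in> Z S \<eta>" "s \<in> S" "s \<in> C"
  shows "\<nu> (s - d x * s) \<le> \<eta>" "\<nu> (s - s * d x) \<le> \<eta>"
    "\<nu> (s - st (d x) * s) \<le> \<eta>" "\<nu> (s - s * st (d x)) \<le> \<eta>"
  using assms by (auto simp: Z_def nu_minus_commute[of s])

lemma nu_bounded_finite:
  assumes "finite S" obtains W where "1 \<le> W" "\<And>s. s \<in> S \<Longrightarrow> \<nu> s \<le> W"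
  using assms by (intro that[of "Max (insert 1 (\<nu> ` S))"]) auto

text \<open>The adjoint conditions follow from those on \<open>x\<close> itself by
  \<open>contraction_adjoint_fixes\<close>, at the price of a smaller tolerance.\<close>

lemma Z_nonempty:
  assumes S: "finite S" "S \<subseteq> J" and \<eta>: "0 < \<eta>"
  obtains x where "x \<in> Z S \<eta>"
proof -
  obtain W where W: "1 \<le> W" "\<And>s. s \<in> S \<Longrightarrow> \<nu> s \<le> W" using nu_bounded_finite[OF S(1)] by blast
  \<comment> \<open>Solves \<open>\<epsilon> + 2 * sqrt (W * \<epsilon>) \<le> \<eta>\<close>, each
    summand taking at most half of \<open>\<eta>\<close>.\<close>
  define \<epsilon> where "\<epsilon> = min (\<eta> / 2) (\<eta>\<^sup>2 / (16 * W))"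
  have \<epsilon>: "0 < \<epsilon>" "\<epsilon> \<le> \<eta> / 2" "\<epsilon> \<le> \<eta>" using \<eta> W by (auto simp: \<epsilon>_def)
  have "\<epsilon> \<le> \<eta>\<^sup>2 / (16 * W)" by (simp add: \<epsilon>_def)
  then have We: "W * \<epsilon> \<le> (\<eta> / 4)\<^sup>2" using W by (simp add: field_simps)
  have err: "\<epsilon> + 2 * sqrt (\<nu> s * \<epsilon>) \<le> \<eta>" if s: "s \<in> S" for s
  proof -
    have "\<nu> s * \<epsilon> \<le> (\<eta> / 4)\<^sup>2" using mult_right_mono[OF W(2)[OF s], of \<epsilon>] We \<epsilon> by linarith
    then have "sqrt (\<nu> s * \<epsilon>) \<le> \<eta> / 4" using \<eta> by (intro real_le_lsqrt) auto
    then show ?thesis using \<epsilon> by simp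
  qed
  obtain x where x: "x \<in> Y \<epsilon>" "norm x \<le> 1"
      "\<And>s. s \<in> S \<Longrightarrow> \<nu> (d x * s - s) \<le> \<epsilon>" "\<And>s. s \<in> S \<Longrightarrow> \<nu> (s * d x - s) \<le> \<epsilon>"
    using Y_units[OF S \<epsilon>(1)] by blast
  have "x \<in> Z S \<eta>" unfolding Z_def
  proof (intro CollectI conjI ballI)
    fix s assume s: "s \<in> S"
    have sC: "s \<in> C" using S s J_C by blast
    show "\<nu> (st (d x) * s - s) \<le> \<eta>"
      using contraction_adjoint_fixes[OF x(2) sC x(3)[OF s]] err[OF s] by simp
    have *: "\<nu> (a * b - b) = \<nu> (st b * st a - st b)" if "a \<in> C" "b \<in> C" for a b
      using nu_st[of "a * b - b"] that by (simp add: st_diff st_mult)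
    \<comment> \<open>Taking adjoints turns right multiplication by \<open>x\<close> into left
      multiplication of \<open>st s\<close> by \<open>star x\<close>, a contraction as well;
      \<open>st s\<close> lies in \<open>C\<close>, though perhaps not in \<open>J\<close>.\<close>
    have "\<nu> (d (star x) * st s - st s) \<le> \<epsilon>"
      using x(4)[OF s] sC by (simp add: * d_star)
    then have "\<nu> (st (d (star x)) * st s - st s) \<le> \<epsilon> + 2 * sqrt (\<nu> (st s) * \<epsilon>)"
      using sC x(2) by (intro contraction_adjoint_fixes) auto
    then show "\<nu> (s * st (d x) - s) \<le> \<eta>" using err[OF s] sC by (simp add: * d_star)
    show "\<nu> (d x * s - s) \<le> \<eta>" "\<nu> (s * d x - s) \<le> \<eta>"
      using x(3,4)[OF s] \<epsilon>(3) by auto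
  qed (use x \<epsilon>(3) Y_mono in auto)
  then show thesis by (rule that)
qed

lemma d_midpoint: "d ((1/2) *\<^sub>R (x + y)) = (1/2) *\<^sub>R (d x + d y)"
  by (simp add: d_add d_scaleR)

lemma Z_midpoint:
  assumes x: "x \<in> Z S \<eta>" and y: "y \<in> Z S \<eta>" and S: "S \<subseteq> J"
  shows "(1/2) *\<^sub>R (x + y) \<in> Z S \<eta>"
proof -
  have half: "\<nu> ((1/2) *\<^sub>R (a + b)) \<le> \<eta>" if "\<nu> a \<le> \<eta>" "\<nu> b \<le> \<eta>" "a \<in> C" "b \<in> C" for a b
    using that nu_triangle[of a b] by (simp add: nu_scaleR)
  have ne: "norm (x + y) \<le> 2" using x y norm_triangle_ineq[of x y] by (simp add: Z_def)
  show ?thesis unfolding Z_def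
  proof (intro CollectI conjI ballI)
    fix s assume s: "s \<in> S"
    have sC: "s \<in> C" using S s J_C by blast
    have two: "s = (1/2) *\<^sub>R (s + s)" by simp
    have "(1/2) *\<^sub>R (d x + d y) * s - s = (1/2) *\<^sub>R ((d x * s - s) + (d y * s - s))"
      "s * (1/2) *\<^sub>R (d x + d y) - s = (1/2) *\<^sub>R ((s * d x - s) + (s * d y - s))"
      "st ((1/2) *\<^sub>R (d x + d y)) * s - s = (1/2) *\<^sub>R ((st (d x) * s - s) + (st (d y) * s - s))"
      "s * st ((1/2) *\<^sub>R (d x + d y)) - s = (1/2) *\<^sub>R ((s * st (d x) - s) + (s * st (d y) - s))"
      by (subst (3) two, simp add: st_scaleR st_add algebra_simps)+
    then show "\<nu> (d ((1/2) *\<^sub>R (x + y)) * s - s) \<le> \<eta>" "\<nu> (s * d ((1/2) *\<^sub>R (x + y)) - s) \<le> \<eta>"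
      "\<nu> (st (d ((1/2) *\<^sub>R (x + y))) * s - s) \<le> \<eta>" "\<nu> (s * st (d ((1/2) *\<^sub>R (x + y))) - s) \<le> \<eta>"
      using x y s sC unfolding d_midpoint by (auto intro!: half simp: Z_def)
  qed (use x y ne Y_midpoint in \<open>auto simp: Z_def\<close>)
qed

end

section \<open>Averaging of approximate units by midpoints\<close>

context cstar_units
begin

lemma nu_midpoint:
  assumes "a \<in> C" "b \<in> C" "\<nu> a \<le> K" "\<nu> b \<le> K"
  shows "\<nu> ((1/2) *\<^sub>R (a + b)) \<le> K"
  using assms nu_triangle[of a b] by (simp add: nu_scaleR)

text \<open>The engine of both averaging arguments: the two cross terms are adjoint to each other,
  and any bound \<open>L\<close> for them below \<open>K\<^sup>2\<close> makes the midpoint shorter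
  than \<open>K\<close>.\<close>

lemma nu_midpoint_square:
  assumes "a \<in> C" "b \<in> C" "\<nu> a \<le> K" "\<nu> b \<le> K" "\<nu> (st a * b) \<le> L"
  shows "(\<nu> ((1/2) *\<^sub>R (a + b)))\<^sup>2 \<le> (K\<^sup>2 + L) / 2"
proof -
  have K: "\<nu> (st a * a) \<le> K\<^sup>2" "\<nu> (st b * b) \<le> K\<^sup>2"
    using assms by (simp_all add: nu_cstar power_mono)
  have "\<nu> (st b * a) \<le> L" using nu_st[of "st a * b"] assms by (simp add: st_mult)
  then have "\<nu> ((st a * a + st b * b) + (st a * b + st b * a)) \<le> (K\<^sup>2 + K\<^sup>2) + (L + L)"
    using assms K by (intro nu_triangle_le) auto
  moreover have "st (a + b) * (a + b) = (st a * a + st b * b) + (st a * b + st b * a)"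
    by (simp add: st_add algebra_simps)
  ultimately have "(\<nu> (a + b))\<^sup>2 \<le> 2 * K\<^sup>2 + 2 * L" using assms by (simp flip: nu_cstar)
  then show ?thesis using assms by (simp add: nu_scaleR power_divide)
qed

text \<open>For contractions \<open>x\<^sub>2\<close> acting as identity on \<open>x\<^sub>1\<close> one has
  \<open>(1 - x\<^sub>1)\<^sup>* (1 - x\<^sub>2) \<approx> 1 - x\<^sub>2\<close>, so a midpoint improves a bound \<open>D > 1\<close> for the
  norm of \<open>1 - x\<close>.\<close>

lemma Z_norm_one_minus:
  assumes S: "finite S" "S \<subseteq> J" and \<eta>: "0 < \<eta>" and \<delta>: "0 < \<delta>"
  obtains x where "x \<in> Z S \<eta>" "\<And>y. y \<in> C \<Longrightarrow> \<nu> (y - d x * y) \<le> (1 + \<delta>) * \<nu> y"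
proof -
  \<comment> \<open>\<open>S\<close> and \<open>\<eta>\<close> are quantified inside
    \<open>P\<close>, so that the second unit can be required to fix the first.\<close>
  define P where "P t \<longleftrightarrow> (\<forall>S \<eta>. finite S \<and> S \<subseteq> J \<and> 0 < \<eta> \<longrightarrow>
    (\<exists>x\<in>Z S \<eta>. \<forall>y\<in>C. \<nu> (y - d x * y) \<le> (1 + t) * \<nu> y))" for t
  have "P 1" unfolding P_def
  proof (intro allI impI)
    fix S \<eta> assume "finite S \<and> S \<subseteq> J \<and> 0 < (\<eta>::real)"
    then obtain x where x: "x \<in> Z S \<eta>" using Z_nonempty by blast
    have "\<nu> (y - d x * y) \<le> (1 + 1) * \<nu> y" if y: "y \<in> C" for y
      using nu_diff_le[of y "d x * y" "\<nu> y" "1 * \<nu> y"] nu_mult_le[of "d x" y 1 "\<nu> y"] Z_nu[OF x] y by simp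
    with x show "\<exists>x\<in>Z S \<eta>. \<forall>y\<in>C. \<nu> (y - d x * y) \<le> (1 + 1) * \<nu> y" by blast
  qed
  have step: "P (7/8 * t)" if P: "P t" and t: "0 < t" for t
    unfolding P_def
  proof (intro allI impI)
    note P = P[unfolded P_def, rule_format]
    fix S \<eta> assume S: "finite S \<and> S \<subseteq> J \<and> 0 < (\<eta>::real)"
    obtain x1 where x1: "x1 \<in> Z S \<eta>" "\<And>y. y \<in> C \<Longrightarrow> \<nu> (y - d x1 * y) \<le> (1 + t) * \<nu> y"
      using P[OF S] by auto
    define \<eta>' where "\<eta>' = min \<eta> (t/4)"
    have "0 < \<eta>'" using S t by (simp add: \<eta>'_def)
    moreover have "insert (d x1) S \<subseteq> J" using S Z_J[OF x1(1)] by simp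
    ultimately obtain x2 where x2: "x2 \<in> Z (insert (d x1) S) \<eta>'"
        "\<And>y. y \<in> C \<Longrightarrow> \<nu> (y - d x2 * y) \<le> (1 + t) * \<nu> y"
      using P[of "insert (d x1) S" \<eta>'] S by auto
    have "x2 \<in> Z S \<eta>" using x2(1) by (rule Z_mono[rotated 2]) (auto simp: \<eta>'_def)
    then have mid: "(1/2) *\<^sub>R (x1 + x2) \<in> Z S \<eta>" using x1 S by (intro Z_midpoint) auto
    have "\<nu> (y - d ((1/2) *\<^sub>R (x1 + x2)) * y) \<le> (1 + 7/8 * t) * \<nu> y" if y: "y \<in> C" for y
    proof -
      define n where "n = \<nu> y"
      have n: "0 \<le> n" using y by (simp add: n_def)
      define a b where "a = y - d x1 * y" and "b = y - d x2 * y"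
      have ab: "a \<in> C" "b \<in> C" "\<nu> a \<le> (1 + t) * n" "\<nu> b \<le> (1 + t) * n"
        using y x1(2) x2(2) by (auto simp: a_def b_def n_def)
      have "\<nu> (d x1 - st (d x2) * d x1) \<le> t/4" using ZD(3)[OF x2(1), of "d x1"] by (simp add: \<eta>'_def)
      then have "\<nu> (st y * b - st y * st (d x1 - st (d x2) * d x1) * y) \<le> n * ((1 + t) * n) + n * (t/4) * n"
        using ab y by (intro nu_diff_le nu_mult_le) (auto simp: n_def)
      moreover have "st a * b = st y * b - st y * st (d x1 - st (d x2) * d x1) * y"
        by (simp add: a_def b_def st_diff st_mult algebra_simps)
      ultimately have "\<nu> (st a * b) \<le> n * ((1 + t) * n) + n * (t/4) * n" by simp
      then have "\<nu> (st a * b) \<le> (1 + t + t/4) * n\<^sup>2" by (simp add: algebra_simps power2_eq_square)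
      then have "(\<nu> ((1/2) *\<^sub>R (a + b)))\<^sup>2 \<le> (((1 + t) * n)\<^sup>2 + (1 + t + t/4) * n\<^sup>2) / 2"
        by (rule nu_midpoint_square[OF ab])
      also have "\<dots> = ((1 + t)\<^sup>2 + (1 + t + t/4)) / 2 * n\<^sup>2"
        by (simp only: power_mult_distrib) (simp add: field_simps)
      also have "\<dots> \<le> (1 + 7/8 * t)\<^sup>2 * n\<^sup>2"
      proof (rule mult_right_mono)
        \<comment> \<open>The midpoint estimate is \<open>1 + 13/8 t + t\<^sup>2/2\<close>, where
          the unit error \<open>t/4\<close> contributes \<open>t/8\<close>. Its root is below
          \<open>1 + 7/8 t\<close>; what matters is a factor below 1, which drives \<open>t\<close>
          to 0.\<close>
        have "((1 + t)\<^sup>2 + (1 + t + t/4)) / 2 + (t/8 + 17/64 * (t * t)) = (1 + 7/8 * t)\<^sup>2"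
          by (simp add: power2_eq_square field_simps)
        moreover have "0 \<le> t/8 + 17/64 * (t * t)" using t by simp
        ultimately show "((1 + t)\<^sup>2 + (1 + t + t/4)) / 2 \<le> (1 + 7/8 * t)\<^sup>2" by linarith
      qed simp
      finally have "(\<nu> ((1/2) *\<^sub>R (a + b)))\<^sup>2 \<le> ((1 + 7/8 * t) * n)\<^sup>2" by (simp add: power_mult_distrib)
      then have "\<nu> ((1/2) *\<^sub>R (a + b)) \<le> (1 + 7/8 * t) * n"
        by (rule power2_le_imp_le) (use n t in auto)
      moreover have "(1/2) *\<^sub>R (a + b) = y - d ((1/2) *\<^sub>R (x1 + x2)) * y"
      proof -
        have "(1/2) *\<^sub>R (a + b) = (1/2) *\<^sub>R (y + y) - d ((1/2) *\<^sub>R (x1 + x2)) * y"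
          unfolding d_midpoint a_def b_def by (simp only: algebra_simps mult_scaleR_left mult_scaleR_right)
        then show ?thesis by simp
      qed
      ultimately show ?thesis by (simp add: n_def)
    qed
    with mid show "\<exists>x\<in>Z S \<eta>. \<forall>y\<in>C. \<nu> (y - d x * y) \<le> (1 + 7/8 * t) * \<nu> y" by blast
  qed
  have "P ((7/8) ^ k)" for k
    by (induction k) (use \<open>P 1\<close> step in auto)
  moreover obtain k where "(7/8::real) ^ k < \<delta>" using real_arch_pow_inv[OF \<delta>, of "7/8"] by auto
  ultimately obtain x where x: "x \<in> Z S \<eta>" "\<And>y. y \<in> C \<Longrightarrow> \<nu> (y - d x * y) \<le> (1 + (7/8)^k) * \<nu> y"
    using S \<eta> unfolding P_def by meson
  have "\<nu> (y - d x * y) \<le> (1 + \<delta>) * \<nu> y" if "y \<in> C" for y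
    using order_trans[OF x(2)[OF that] mult_right_mono[of "1 + (7/8)^k" "1 + \<delta>" "\<nu> y"]]
      \<open>(7/8::real) ^ k < \<delta>\<close> that by simp
  with x show thesis by (intro that)
qed

text \<open>Without a unit the norm of \<open>1 - x\<close> is expressed through its left action,
  which must be transferred to the right. For \<open>a = y (1 - x)\<close> the product
  \<open>a * st a\<close> is the adjoint of \<open>y (1 - x) * st a\<close>, of norm at most
  \<open>\<nu> y * K * \<nu> a\<close>, and one factor \<open>\<nu> a\<close> cancels.\<close>

lemma nu_one_minus_right:
  assumes x: "\<And>y. y \<in> C \<Longrightarrow> \<nu> (y - d x * y) \<le> K * \<nu> y" and y: "y \<in> C" and K: "0 \<le> K"
  shows "\<nu> (y - y * d x) \<le> K * \<nu> y"
proof -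
  define a where "a = y - y * d x"
  have a: "a \<in> C" using y by (simp add: a_def)
  have "a * st a = (a - a * st (d x)) * st y"
    by (simp add: a_def st_diff st_mult algebra_simps)
  then have "a * st a = st (y * st (a - a * st (d x)))" by (simp add: st_mult)
  moreover have "st (a - a * st (d x)) = st a - d x * st a" by (simp add: st_diff st_mult)
  ultimately have "(\<nu> a)\<^sup>2 = \<nu> (y * (st a - d x * st a))" using a y by (metis nu_cstar' nu_st C_mult C_diff C_st d_C)
  also have "\<dots> \<le> \<nu> y * (K * \<nu> a)" using x[of "st a"] a y by (intro nu_mult_le) auto
  finally have le: "\<nu> a * \<nu> a \<le> (K * \<nu> y) * \<nu> a" by (simp add: power2_eq_square mult_ac)
  show ?thesis
  proof (cases "\<nu> a = 0")
    case True
    then show ?thesis using K y by (simp add: a_def)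
  next
    case False
    then have "0 < \<nu> a" using nu_nonneg[OF a] by simp
    then show ?thesis using le by (simp add: a_def)
  qed
qed

text \<open>The corner terms \<open>x u x\<close> and \<open>(1 - x') v (1 - x')\<close> are almost orthogonal when \<open>x'\<close> is a
  unit for \<open>x\<close>; \<open>\<rho>\<close> collects what lies between them, and it is almost left orthogonal to
  any finite set fixed beforehand.\<close>

lemma corner_decomposition:
  assumes S: "finite S" "S \<subseteq> J" and \<eta>: "0 < \<eta>" and \<delta>: "0 < \<delta>"
    and u: "u \<in> E" "\<nu> u \<le> 1" and v: "v \<in> E" "\<nu> v \<le> 1"
  obtains x \<rho> where "x \<in> Z S \<eta>" "\<rho> \<in> J" "\<nu> \<rho> \<le> 6" "\<And>w. w \<in> S \<Longrightarrow> \<nu> (st w * \<rho>) \<le> \<eta>"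
    "\<nu> (d x * u + v - d x * v - \<rho>) \<le> 1 + \<delta>"
proof -
  obtain W where W: "1 \<le> W" "\<And>s. s \<in> S \<Longrightarrow> \<nu> s \<le> W" using nu_bounded_finite[OF S(1)] by blast
  \<comment> \<open>\<open>\<gamma>\<close> pays for the orthogonal sum through \<open>(1 +
    \<gamma>)\<^sup>2 * (1 + 2 * \<gamma>) \<le> 1 + 12 * \<gamma>\<close>. The 10 in
    \<open>\<epsilon>\<close> covers the errors in the orthogonality to \<open>S\<close>, at most
    eight times \<open>W * \<epsilon>\<close> in total.\<close>
  define \<gamma> where "\<gamma> = min 1 (\<delta> / 12)"
  have \<gamma>: "0 < \<gamma>" "\<gamma> \<le> 1" "\<gamma> \<le> \<delta> / 12" using \<delta> by (auto simp: \<gamma>_def)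
  define \<epsilon> where "\<epsilon> = min (\<gamma> / 2) (\<eta> / (10 * W))"
  have \<epsilon>: "0 < \<epsilon>" "\<epsilon> \<le> \<gamma> / 2" using \<eta> \<gamma> W by (auto simp: \<epsilon>_def)
  have "\<epsilon> \<le> \<eta> / (10 * W)" by (simp add: \<epsilon>_def)
  then have W\<epsilon>: "10 * (W * \<epsilon>) \<le> \<eta>" using W by (simp add: field_simps)
  have \<epsilon>W: "\<epsilon> \<le> W * \<epsilon>" using W \<epsilon> by simp
  have \<epsilon>\<eta>: "\<epsilon> \<le> \<eta>" using W\<epsilon> \<epsilon>W \<epsilon> by linarith
  have uv: "u \<in> C" "v \<in> C" using u v by (auto simp: E_C)
  \<comment> \<open>Three units in a row: \<open>x0\<close> for \<open>S\<close>, then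
    \<open>x\<close> for \<open>x0 u\<close>, then \<open>x'\<close> for \<open>x\<close>. The
    detour through \<open>x0\<close> makes \<open>st w * u (1 - x)\<close> small for
    \<open>w\<close> in \<open>S\<close>: it is close to \<open>st w * x0 u (1 - x)\<close>, and
    \<open>x0 u\<close> lies in \<open>J\<close> while \<open>u\<close> need not.\<close>
  obtain x0 where x0: "x0 \<in> Z S \<epsilon>" using Z_nonempty[OF S \<epsilon>(1)] .
  have 1: "insert (d x0) (insert (d x0 * u) S) \<subseteq> J" using S Z_J[OF x0] u J_right by auto
  obtain x where x: "x \<in> Z (insert (d x0) (insert (d x0 * u) S)) \<epsilon>"
    using Z_nonempty[OF _ 1 \<epsilon>(1)] S(1) by (metis finite.insertI)
  have 2: "insert (d x) S \<subseteq> J" using S Z_J[OF x] by auto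
  obtain x' where x': "x' \<in> Z (insert (d x) S) \<epsilon>" and x'1: "\<And>y. y \<in> C \<Longrightarrow> \<nu> (y - d x' * y) \<le> (1 + \<gamma>) * \<nu> y"
    using Z_norm_one_minus[OF _ 2 \<epsilon>(1) \<gamma>(1)] S(1) by (metis finite.insertI)
  define X X' where "X = d x" and "X' = d x'"
  have XC: "X \<in> C" "X' \<in> C" "X \<in> J" "X' \<in> J" and Xn: "\<nu> X \<le> 1" "\<nu> X' \<le> 1"
    using Z_J[OF x] Z_J[OF x'] Z_nu[OF x] Z_nu[OF x'] by (simp_all add: X_def X'_def)
  have XE: "X \<in> E" "X' \<in> E" using XC by (auto simp: J_E)
  define s where "s = X * u * X"
  define t where "t = v - X' * v - (v - X' * v) * X'"
  define \<rho> where "\<rho> = X * u + v - X * v - (s + t)"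
  have st_C: "s \<in> C" "t \<in> C" using uv XC by (auto simp: s_def t_def)
  \<comment> \<open>Each of the six products now has a factor \<open>X\<close> or \<open>X'\<close>,
    hence lies in the ideal, and has norm at most 1.\<close>
  have \<rho>_eq: "\<rho> = (X * u - X * u * X) - X * v + X' * v + (v * X' - X' * v * X')"
    by (simp add: \<rho>_def s_def t_def algebra_simps)
  have \<rho>J: "\<rho> \<in> J" unfolding \<rho>_eq
    using XC XE u v by (intro J_add J_diff) (auto simp: J_left J_right E_diff J_E)
  have "\<nu> \<rho> \<le> (1 * 1 + 1 * 1 * 1) + 1 * 1 + 1 * 1 + (1 * 1 + 1 * 1 * 1)" unfolding \<rho>_eq
    using XC Xn u v uv by (intro nu_diff_le nu_triangle_le nu_mult_le) auto
  then have \<rho>6: "\<nu> \<rho> \<le> 6" by simp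
  have "(1 + \<gamma>) * \<nu> v \<le> (1 + \<gamma>) * 1" using v \<gamma> by (intro mult_left_mono) auto
  then have v1: "\<nu> (v - X' * v) \<le> 1 + \<gamma>" and v1r: "\<nu> (v - v * X') \<le> 1 + \<gamma>"
    using x'1[OF uv(2)] nu_one_minus_right[OF x'1 uv(2)] \<gamma> by (auto simp: X'_def intro: order_trans)
  have "\<nu> t \<le> (1 + \<gamma>) * \<nu> (v - X' * v)" unfolding t_def X'_def
    by (rule nu_one_minus_right[OF x'1]) (use uv \<gamma> in auto)
  also have "\<dots> \<le> (1 + \<gamma>) * (1 + \<gamma>)" using v1 \<gamma> by (intro mult_left_mono) auto
  finally have t: "\<nu> t \<le> (1 + \<gamma>)\<^sup>2" by (simp add: power2_eq_square)
  have "\<nu> s \<le> 1 * 1 * 1" unfolding s_def using XC Xn u uv by (intro nu_mult_le) auto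
  then have s: "\<nu> s \<le> (1 + \<gamma>)\<^sup>2" using \<gamma> one_le_power[of "1 + \<gamma>" 2] by linarith
  have Xx': "\<nu> (X - st X' * X) \<le> \<epsilon>" "\<nu> (X - X * st X') \<le> \<epsilon>"
    using ZD(3,4)[OF x', of X] XC by (auto simp: X_def X'_def)
  \<comment> \<open>The product \<open>st s * t\<close> contains \<open>st X * (1 - X')\<close>, the
    adjoint of \<open>X - st X' * X\<close>; this is where the adjoint conditions in
    \<open>Z\<close> enter.\<close>
  have "\<nu> (st (u * X) * st (X - st X' * X) * (v - v * X')) \<le> 1 * 1 * \<epsilon> * (1 + \<gamma>)"
    using XC Xn uv u Xx' v1r by (intro nu_mult_le) (auto intro: nu_mult_le[of u X 1 1, simplified])
  moreover have "st s * t = st (u * X) * st (X - st X' * X) * (v - v * X')"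
    by (simp add: s_def t_def st_mult st_diff algebra_simps)
  ultimately have o1: "\<nu> (st s * t) \<le> \<epsilon> * (1 + \<gamma>)" by simp
  have "\<nu> (X * u * (X - X * st X') * st (v - X' * v)) \<le> 1 * 1 * \<epsilon> * (1 + \<gamma>)"
    using XC Xn uv u Xx' v1 by (intro nu_mult_le) auto
  moreover have "s * st t = X * u * (X - X * st X') * st (v - X' * v)"
    by (simp add: s_def t_def st_mult st_diff st_add algebra_simps)
  ultimately have o2: "\<nu> (s * st t) \<le> \<epsilon> * (1 + \<gamma>)" by simp
  have "\<epsilon> * (1 + \<gamma>) \<le> (\<gamma> / 2) * 2" using \<epsilon> \<gamma> by (intro mult_mono) auto
  then have "\<nu> (s + t) \<le> (1 + \<gamma>)\<^sup>2 * (1 + 2 * \<gamma>)"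
    using o1 o2 \<gamma> by (intro nu_orthogonal_sum st_C s t) auto
  also have "\<dots> \<le> 1 + 12 * \<gamma>"
  proof -
    have "\<gamma> * \<gamma> \<le> \<gamma>" "\<gamma> * (\<gamma> * \<gamma>) \<le> \<gamma>"
      using \<gamma> mult_mono[of \<gamma> 1 \<gamma> 1] by (auto simp: mult_left_le_one_le mult_le_one intro!: mult_left_le)
    moreover have "(1 + \<gamma>)\<^sup>2 * (1 + 2 * \<gamma>) = 1 + 4 * \<gamma> + 5 * (\<gamma> * \<gamma>) + 2 * (\<gamma> * (\<gamma> * \<gamma>))"
      by (simp add: power2_eq_square algebra_simps)
    ultimately show ?thesis using \<gamma> by linarith
  qed
  also have "\<dots> \<le> 1 + \<delta>" using \<gamma> by simp
  finally have "\<nu> (s + t) \<le> 1 + \<delta>" .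
  moreover have "d x * u + v - d x * v - \<rho> = s + t" by (simp add: \<rho>_def X_def)
  ultimately have main: "\<nu> (d x * u + v - d x * v - \<rho>) \<le> 1 + \<delta>" by simp
  have orth: "\<nu> (st w * \<rho>) \<le> \<eta>" if w: "w \<in> S" for w
  proof -
    have wC: "w \<in> C" using w S J_C by blast
    define X0 where "X0 = d x0"
    have X0: "X0 \<in> C" "\<nu> X0 \<le> 1" using Z_nu[OF x0] by (auto simp: X0_def)
    have w1: "\<nu> (w - st X0 * w) \<le> \<epsilon>" "\<nu> (w - st X * w) \<le> \<epsilon>" "\<nu> (w - st X' * w) \<le> \<epsilon>"
      using ZD(3)[OF x0 w wC] ZD(3)[OF x _ wC] ZD(3)[OF x' _ wC] w by (auto simp: X0_def X_def X'_def)
    have xx: "\<nu> (X0 * u - X0 * u * X) \<le> \<epsilon>"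
      using ZD(2)[OF x, of "X0 * u"] X0 uv by (simp add: X0_def X_def)
    have uX: "\<nu> (u - u * X) \<le> 1 + 1 * 1" using u uv XC Xn by (intro nu_diff_le nu_mult_le) auto
    have "\<nu> (st (w - st X0 * w) * (u - u * X) + st w * (X0 * u - X0 * u * X)
        - st (w - st X * w) * (u - u * X) + st (w - st X * w) * v - st (w - st X' * w) * (v - v * X'))
      \<le> \<epsilon> * (1 + 1 * 1) + W * \<epsilon> + \<epsilon> * (1 + 1 * 1) + \<epsilon> * 1 + \<epsilon> * (1 + \<gamma>)"
      using wC X0 uv XC w1 xx v v1r uX W(2)[OF w]
      by (intro nu_diff_le[of _ "st (w - st X' * w) * (v - v * X')"] nu_triangle_le nu_diff_le[of _ "_ * (u - u * X)"] nu_mult_le) auto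
    moreover have "st w * \<rho> = st (w - st X0 * w) * (u - u * X) + st w * (X0 * u - X0 * u * X)
        - st (w - st X * w) * (u - u * X) + st (w - st X * w) * v - st (w - st X' * w) * (v - v * X')"
      by (simp add: \<rho>_def s_def t_def st_mult st_diff algebra_simps)
    ultimately have "\<nu> (st w * \<rho>) \<le> 2 * \<epsilon> + W * \<epsilon> + 2 * \<epsilon> + \<epsilon> + \<epsilon> * (1 + \<gamma>)"
      by simp
    moreover have "\<epsilon> * (1 + \<gamma>) \<le> \<epsilon> * 2" using \<epsilon> \<gamma> by (intro mult_left_mono) auto
    ultimately show ?thesis using W\<epsilon> \<epsilon>W \<epsilon>(1) by linarith
  qed
  have "x \<in> Z S \<eta>" using x by (rule Z_mono[rotated 2]) (use \<epsilon>\<eta> in auto)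
  then show thesis using \<rho>J \<rho>6 orth main by (rule that)
qed

text \<open>The midpoint of two remainders \<open>\<rho>\<close> that are almost left orthogonal is shorter than the longer
  of them by a factor close to \<open>1 / sqrt 2\<close>, so remainders are averaged away.\<close>

lemma unit_combination:
  assumes S: "finite S" "S \<subseteq> J" and \<eta>: "0 < \<eta>" and \<delta>: "0 < \<delta>"
    and u: "u \<in> E" "\<nu> u \<le> 1" and v: "v \<in> E" "\<nu> v \<le> 1"
  obtains x where "x \<in> Z S \<eta>" "\<nu> (d x * u + v - d x * v) \<le> 1 + \<delta>"
proof -
  have uv: "u \<in> C" "v \<in> C" using u v by (auto simp: E_C)
  \<comment> \<open>Orthogonality to an arbitrary finite \<open>S\<close> belongs to the invariant:
    it lets the next remainder be chosen almost orthogonal to the present one.\<close>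
  define Q where "Q D \<longleftrightarrow> (\<forall>S \<eta>. finite S \<and> S \<subseteq> J \<and> 0 < \<eta> \<longrightarrow>
    (\<exists>x\<in>Z S \<eta>. \<exists>\<rho>\<in>J. \<nu> \<rho> \<le> D \<and> (\<forall>w\<in>S. \<nu> (st w * \<rho>) \<le> \<eta>) \<and>
       \<nu> (d x * u + v - d x * v - \<rho>) \<le> 1 + \<delta> / 2))" for D
  have "Q 6" unfolding Q_def
  proof (intro allI impI)
    fix S \<eta> assume "finite S \<and> S \<subseteq> J \<and> 0 < (\<eta>::real)"
    then obtain x \<rho> where "x \<in> Z S \<eta>" "\<rho> \<in> J" "\<nu> \<rho> \<le> 6" "\<And>w. w \<in> S \<Longrightarrow> \<nu> (st w * \<rho>) \<le> \<eta>"
      "\<nu> (d x * u + v - d x * v - \<rho>) \<le> 1 + \<delta> / 2"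
      using corner_decomposition[of S \<eta> "\<delta>/2" u v] u v \<delta> by (metis half_gt_zero)
    then show "\<exists>x\<in>Z S \<eta>. \<exists>\<rho>\<in>J. \<nu> \<rho> \<le> 6 \<and> (\<forall>w\<in>S. \<nu> (st w * \<rho>) \<le> \<eta>) \<and>
       \<nu> (d x * u + v - d x * v - \<rho>) \<le> 1 + \<delta> / 2" by blast
  qed
  have step: "Q (9/10 * D)" if Q: "Q D" and D: "0 < D" for D
    unfolding Q_def
  proof (intro allI impI)
    note Q = Q[unfolded Q_def, rule_format]
    fix S \<eta> assume S: "finite S \<and> S \<subseteq> J \<and> 0 < (\<eta>::real)"
    obtain x1 \<rho>1 where 1: "x1 \<in> Z S \<eta>" "\<rho>1 \<in> J" "\<nu> \<rho>1 \<le> D" "\<And>w. w \<in> S \<Longrightarrow> \<nu> (st w * \<rho>1) \<le> \<eta>"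
      "\<nu> (d x1 * u + v - d x1 * v - \<rho>1) \<le> 1 + \<delta> / 2"
      using Q[OF S] by auto
    define \<eta>' where "\<eta>' = min \<eta> (D\<^sup>2 / 2)"
    have "0 < \<eta>'" using S D by (simp add: \<eta>'_def)
    moreover have "insert \<rho>1 S \<subseteq> J" using S 1 by simp
    ultimately obtain x2 \<rho>2 where 2: "x2 \<in> Z (insert \<rho>1 S) \<eta>'" "\<rho>2 \<in> J" "\<nu> \<rho>2 \<le> D"
      "\<And>w. w \<in> insert \<rho>1 S \<Longrightarrow> \<nu> (st w * \<rho>2) \<le> \<eta>'"
      "\<nu> (d x2 * u + v - d x2 * v - \<rho>2) \<le> 1 + \<delta> / 2"
      using Q[of "insert \<rho>1 S" \<eta>'] S by auto
    have C: "\<rho>1 \<in> C" "\<rho>2 \<in> C" using 1 2 by (auto simp: J_C)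
    have "x2 \<in> Z S \<eta>" using 2(1) by (rule Z_mono[rotated 2]) (auto simp: \<eta>'_def)
    then have mid: "(1/2) *\<^sub>R (x1 + x2) \<in> Z S \<eta>" using 1 S by (intro Z_midpoint) auto
    define \<rho> where "\<rho> = (1/2) *\<^sub>R (\<rho>1 + \<rho>2)"
    have "\<rho> \<in> J" using 1 2 by (simp add: \<rho>_def J_scaleR J_add)
    moreover have "\<nu> \<rho> \<le> 9/10 * D"
    proof -
      have "\<nu> (st \<rho>1 * \<rho>2) \<le> D\<^sup>2 / 2" using 2(4)[of \<rho>1] by (simp add: \<eta>'_def)
      then have "(\<nu> \<rho>)\<^sup>2 \<le> (D\<^sup>2 + D\<^sup>2 / 2) / 2"
        unfolding \<rho>_def using C 1 2 by (intro nu_midpoint_square) auto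
      \<comment> \<open>The left side is \<open>3/4 * D\<^sup>2\<close>, and 9/10 is a round number
        above \<open>sqrt (3/4)\<close>.\<close>
      also have "\<dots> \<le> (9/10 * D)\<^sup>2" by (simp add: power_mult_distrib power_divide)
      finally show ?thesis by (rule power2_le_imp_le) (use D in simp)
    qed
    moreover have "\<nu> (st w * \<rho>) \<le> \<eta>" if w: "w \<in> S" for w
    proof -
      have "w \<in> C" using w S J_C by blast
      moreover have "st w * \<rho> = (1/2) *\<^sub>R (st w * \<rho>1 + st w * \<rho>2)"
        by (simp add: \<rho>_def algebra_simps)
      ultimately show ?thesis using 1(4)[OF w] 2(4)[of w] w C
        by (auto intro!: nu_midpoint simp: \<eta>'_def)
    qed
    moreover have "\<nu> (d ((1/2) *\<^sub>R (x1 + x2)) * u + v - d ((1/2) *\<^sub>R (x1 + x2)) * v - \<rho>) \<le> 1 + \<delta> / 2"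
    proof -
      have "d ((1/2) *\<^sub>R (x1 + x2)) * u + (1/2) *\<^sub>R (v + v) - d ((1/2) *\<^sub>R (x1 + x2)) * v - \<rho> =
        (1/2) *\<^sub>R ((d x1 * u + v - d x1 * v - \<rho>1) + (d x2 * u + v - d x2 * v - \<rho>2))"
        unfolding d_midpoint \<rho>_def by (simp only: algebra_simps mult_scaleR_left mult_scaleR_right)
      moreover have "\<nu> \<dots> \<le> 1 + \<delta> / 2" using C uv 1(5) 2(5) by (intro nu_midpoint) auto
      ultimately show ?thesis by simp
    qed
    ultimately show "\<exists>x\<in>Z S \<eta>. \<exists>\<rho>\<in>J. \<nu> \<rho> \<le> 9/10 * D \<and> (\<forall>w\<in>S. \<nu> (st w * \<rho>) \<le> \<eta>) \<and>
       \<nu> (d x * u + v - d x * v - \<rho>) \<le> 1 + \<delta> / 2" using mid by blast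
  qed
  have "Q (6 * (9/10) ^ k)" for k
  proof (induction k)
    case (Suc k)
    then have "Q (9/10 * (6 * (9/10) ^ k))" by (rule step) simp
    then show ?case by (simp add: mult_ac)
  qed (use \<open>Q 6\<close> in simp)
  moreover obtain k where k: "(9/10::real) ^ k < \<delta> / 12" using real_arch_pow_inv[of "\<delta>/12" "9/10"] \<delta> by auto
  ultimately obtain x \<rho> where x: "x \<in> Z S \<eta>" and \<rho>: "\<rho> \<in> J" "\<nu> \<rho> \<le> 6 * (9/10) ^ k"
    "\<nu> (d x * u + v - d x * v - \<rho>) \<le> 1 + \<delta> / 2"
    using S \<eta> unfolding Q_def by meson
  have "\<nu> ((d x * u + v - d x * v - \<rho>) + \<rho>) \<le> (1 + \<delta> / 2) + \<delta> / 2"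
    using \<rho> k uv by (intro nu_triangle_le) (auto simp: J_C)
  then show thesis by (intro that[OF x]) simp
qed

text \<open>Here \<open>x u + (1 - x) v\<close> with \<open>u = b / (R + \<epsilon>)\<close> and \<open>v = (b - j) / R\<close> is, up to \<open>(1 - x) j \<approx> 0\<close> and
  the factor \<open>R\<close>, a small perturbation of \<open>b\<close>.\<close>

lemma unit_perturbation:
  assumes b: "b \<in> E" "\<nu> b \<le> R + \<epsilon>" and j: "j \<in> J" "\<nu> (b - j) \<le> R"
    and pos: "0 < R" "0 \<le> \<epsilon>" "0 < \<delta>" "0 < \<eta>"
  obtains x where "x \<in> Y \<eta>" "norm x \<le> 1" "\<nu> (b - (\<epsilon> / (R + \<epsilon>)) *\<^sub>R (d x * b)) \<le> R + \<delta>"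
proof -
  define u v where "u = (1 / (R + \<epsilon>)) *\<^sub>R b" and "v = (1 / R) *\<^sub>R (b - j)"
  have C: "b \<in> C" "j \<in> C" "u \<in> C" "v \<in> C" using b j by (auto simp: u_def v_def E_C J_C)
  have u: "u \<in> E" "\<nu> u \<le> 1" and v: "v \<in> E" "\<nu> v \<le> 1"
    using b j pos C by (auto simp: u_def v_def E_scaleR E_diff J_E nu_scaleR divide_simps)
  have "0 < \<delta> / (2 * R)" "0 < min \<eta> (\<delta> / 2)" using pos by auto
  then obtain x where x: "x \<in> Z {j} (min \<eta> (\<delta> / 2))" "\<nu> (d x * u + v - d x * v) \<le> 1 + \<delta> / (2 * R)"
    using unit_combination[of "{j}" "min \<eta> (\<delta> / 2)" "\<delta> / (2 * R)" u v] u v j(1) by blast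
  have "\<nu> (R *\<^sub>R (d x * u + v - d x * v)) \<le> R + \<delta> / 2"
  proof -
    have "R * (1 + \<delta> / (2 * R)) = R + \<delta> / 2" using pos by (simp add: field_simps)
    then have "R * \<nu> (d x * u + v - d x * v) \<le> R + \<delta> / 2"
      using mult_left_mono[OF x(2), of R] pos by simp
    then show ?thesis using pos C by (simp add: nu_scaleR)
  qed
  moreover have "\<nu> (j - d x * j) \<le> \<delta> / 2" using ZD(1)[OF x(1)] C by simp
  ultimately have "\<nu> (R *\<^sub>R (d x * u + v - d x * v) + (j - d x * j)) \<le> (R + \<delta> / 2) + \<delta> / 2"
    using C by (intro nu_triangle_le) auto
  moreover have "R *\<^sub>R (d x * u + v - d x * v) + (j - d x * j) = b - (\<epsilon> / (R + \<epsilon>)) *\<^sub>R (d x * b)"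
  proof -
    have "R / (R + \<epsilon>) = 1 - \<epsilon> / (R + \<epsilon>)" using pos by (simp add: field_simps)
    then have u': "R *\<^sub>R u = b - (\<epsilon> / (R + \<epsilon>)) *\<^sub>R b" by (simp add: u_def scaleR_left_diff_distrib)
    have v': "R *\<^sub>R v = b - j" using pos by (simp add: v_def)
    have "R *\<^sub>R (d x * u + v - d x * v) = d x * (R *\<^sub>R u) + R *\<^sub>R v - d x * (R *\<^sub>R v)"
      by (simp add: scaleR_add_right scaleR_diff_right)
    then show ?thesis unfolding u' v' by (simp add: right_diff_distrib)
  qed
  ultimately have "\<nu> (b - (\<epsilon> / (R + \<epsilon>)) *\<^sub>R (d x * b)) \<le> R + \<delta>" by simp
  moreover have "x \<in> Y \<eta>" "norm x \<le> 1"
    using x(1) Y_mono[of "min \<eta> (\<delta> / 2)" \<eta> x] by (auto simp: Z_def)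
  ultimately show thesis by (intro that)
qed

end

section \<open>Separation of a limit point from a subalgebra\<close>

text \<open>Homogeneity is demanded as an inequality for positive factors, the form that is easily
  checked for infima; rescaling by \<open>1/t\<close> gives equality.\<close>

definition sublinear :: "('v::real_vector \<Rightarrow> real) \<Rightarrow> bool" where
  "sublinear p \<longleftrightarrow> (\<forall>x y. p (x + y) \<le> p x + p y) \<and> (\<forall>t>0. \<forall>x. p (t *\<^sub>R x) \<le> t * p x)"

lemma sublinear_add: "sublinear p \<Longrightarrow> p (x + y) \<le> p x + p y"
  by (simp add: sublinear_def)

lemma sublinear_scaleR_le: "sublinear p \<Longrightarrow> 0 < t \<Longrightarrow> p (t *\<^sub>R x) \<le> t * p x"
  by (simp add: sublinear_def)

lemma sublinear_zero: assumes "sublinear p" shows "p 0 = 0"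
  using sublinear_scaleR_le[OF assms, of 2 0] sublinear_scaleR_le[OF assms, of "1/2" 0] by simp

lemma sublinear_scaleR:
  assumes p: "sublinear p" and t: "0 \<le> t" shows "p (t *\<^sub>R x) = t * p x"
proof (cases "t = 0")
  case False
  then have t: "0 < t" using t by simp
  have "p ((1/t) *\<^sub>R (t *\<^sub>R x)) \<le> (1/t) * p (t *\<^sub>R x)" using t by (intro sublinear_scaleR_le[OF p]) simp
  then have "t * p x \<le> p (t *\<^sub>R x)" using t by (simp add: field_simps)
  with sublinear_scaleR_le[OF p t, of x] show ?thesis by simp
qed (simp add: sublinear_zero[OF p])

lemma sublinear_minus: assumes "sublinear p" shows "- p (- x) \<le> p x"
  using sublinear_add[OF assms, of x "- x"] sublinear_zero[OF assms] by simp

text \<open>A minimal sublinear functional \<open>m\<close> is linear, since \<open>x \<mapsto> inf {m (x + t y) - t m y | t \<ge> 0}\<close>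
  is sublinear and below \<open>m\<close>.\<close>

lemma sublinear_dominates_linear:
  fixes p :: "'v::real_vector \<Rightarrow> real"
  assumes p: "sublinear p"
  obtains f where "linear f" "\<And>x. f x \<le> p x"
proof -
  define A where "A = {q. sublinear q \<and> q \<le> p}"
  \<comment> \<open>The order is reversed, since Zorn's lemma is to yield a minimal element.\<close>
  have po: "partial_order_on A (relation_of (\<lambda>q r. r \<le> q) A)"
    by (rule partial_order_on_relation_ofI) auto
  have ch: "\<exists>u\<in>A. \<forall>q\<in>C. u \<le> q" if C: "C \<in> Chains (relation_of (\<lambda>q r. r \<le> q) A)" for C
  proof (cases "C = {}")
    case True
    with p show ?thesis by (auto simp: A_def)
  next
    case False
    have CA: "q \<in> A" if "q \<in> C" for q using C that by (auto simp: Chains_def relation_of_def)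
    have tot: "q \<le> r \<or> r \<le> q" if "q \<in> C" "r \<in> C" for q r
      using C that by (auto simp: Chains_def relation_of_def)
    define u where "u x = (INF q\<in>C. q x)" for x
    have bdd: "bdd_below ((\<lambda>q. q x) ` C)" for x
    proof (rule bdd_belowI2)
      fix q assume "q \<in> C"
      then have "sublinear q" "q \<le> p" using CA by (auto simp: A_def)
      then show "- p (- x) \<le> q x" using sublinear_minus[of q x] le_funD[of q p "- x"] by simp
    qed
    have ule: "u x \<le> q x" if "q \<in> C" for q x unfolding u_def by (rule cINF_lower[OF bdd that])
    have uge: "K \<le> u x" if "\<And>q. q \<in> C \<Longrightarrow> K \<le> q x" for K x
      unfolding u_def by (rule cINF_greatest[OF False that])
    have "sublinear u" unfolding sublinear_def
    proof (intro conjI allI impI)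
      fix x y
      have "u (x + y) - q x \<le> u y" if q: "q \<in> C" for q
      proof (rule uge)
        fix r assume r: "r \<in> C"
        \<comment> \<open>Subadditivity of the infimum needs one functional below both
          \<open>q\<close> and \<open>r\<close>; the chain provides it.\<close>
        have "\<exists>s\<in>C. s \<le> q \<and> s \<le> r" using tot[OF q r] q r by auto
        then obtain s where s: "s \<in> C" "s \<le> q" "s \<le> r" by blast
        have "u (x + y) \<le> s (x + y)" using ule s by blast
        also have "\<dots> \<le> s x + s y" using CA[OF s(1)] sublinear_add by (auto simp: A_def)
        also have "\<dots> \<le> q x + r y" using s by (auto simp: le_fun_def intro: add_mono)
        finally show "u (x + y) - q x \<le> r y" by simp
      qed
      then have "u (x + y) - u y \<le> u x" by (intro uge) (simp add: algebra_simps)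
      then show "u (x + y) \<le> u x + u y" by simp
    next
      fix t :: real and x assume t: "0 < t"
      have "u (t *\<^sub>R x) / t \<le> u x"
      proof (rule uge)
        fix q assume q: "q \<in> C"
        then have "q (t *\<^sub>R x) \<le> t * q x" using CA t by (auto simp: A_def intro: sublinear_scaleR_le)
        then show "u (t *\<^sub>R x) / t \<le> q x" using ule[OF q, of "t *\<^sub>R x"] t by (simp add: field_simps)
      qed
      then show "u (t *\<^sub>R x) \<le> t * u x" using t by (simp add: field_simps)
    qed
    moreover have "u \<le> p"
    proof -
      obtain q where "q \<in> C" using False by blast
      then show ?thesis using ule CA by (fastforce simp: A_def le_fun_def intro: order_trans)
    qed
    ultimately show ?thesis using ule by (auto simp: A_def le_fun_def)
  qed
  obtain m where m: "m \<in> A" and min: "\<And>q. q \<in> A \<Longrightarrow> q \<le> m \<Longrightarrow> q = m"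
    using predicate_Zorn[OF po] ch by blast
  have ms: "sublinear m" and mp: "m \<le> p" using m by (auto simp: A_def)
  have super: "m x + m y \<le> m (x + y)" for x y
  proof -
    define q where "q x = (INF t\<in>{0..}. m (x + t *\<^sub>R y) - t * m y)" for x
    have bdd: "bdd_below ((\<lambda>t. m (x + t *\<^sub>R y) - t * m y) ` {0..})" for x
    proof (rule bdd_belowI2)
      fix t :: real assume "t \<in> {0..}"
      then show "- m (- x) \<le> m (x + t *\<^sub>R y) - t * m y"
        using sublinear_add[OF ms, of "x + t *\<^sub>R y" "- x"] sublinear_scaleR[OF ms, of t y] by simp
    qed
    have qle: "q x \<le> m (x + t *\<^sub>R y) - t * m y" if "0 \<le> t" for t x
      unfolding q_def by (rule cINF_lower[OF bdd]) (use that in simp)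
    have qge: "K \<le> q x" if "\<And>t. 0 \<le> t \<Longrightarrow> K \<le> m (x + t *\<^sub>R y) - t * m y" for K x
      unfolding q_def by (rule cINF_greatest) (use that in auto)
    have "sublinear q" unfolding sublinear_def
    proof (intro conjI allI impI)
      fix x z
      have "q (x + z) - (m (x + t *\<^sub>R y) - t * m y) \<le> q z" if t: "0 \<le> t" for t
      proof (rule qge)
        fix s :: real assume s: "0 \<le> s"
        have "q (x + z) \<le> m ((x + z) + (t + s) *\<^sub>R y) - (t + s) * m y" using s t by (intro qle) simp
        also have "(x + z) + (t + s) *\<^sub>R y = (x + t *\<^sub>R y) + (z + s *\<^sub>R y)" by (simp add: algebra_simps)
        also have "m \<dots> \<le> m (x + t *\<^sub>R y) + m (z + s *\<^sub>R y)" by (rule sublinear_add[OF ms])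
        finally show "q (x + z) - (m (x + t *\<^sub>R y) - t * m y) \<le> m (z + s *\<^sub>R y) - s * m y"
          by (simp add: algebra_simps)
      qed
      then have "q (x + z) - q z \<le> q x" by (intro qge) (simp add: algebra_simps)
      then show "q (x + z) \<le> q x + q z" by simp
    next
      fix r :: real and x assume r: "0 < r"
      have "q (r *\<^sub>R x) / r \<le> q x"
      proof (rule qge)
        fix t :: real assume t: "0 \<le> t"
        have "q (r *\<^sub>R x) \<le> m (r *\<^sub>R x + (r * t) *\<^sub>R y) - (r * t) * m y" using r t by (intro qle) simp
        also have "r *\<^sub>R x + (r * t) *\<^sub>R y = r *\<^sub>R (x + t *\<^sub>R y)" by (simp add: algebra_simps)
        also have "m (r *\<^sub>R (x + t *\<^sub>R y)) = r * m (x + t *\<^sub>R y)"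
          using r by (intro sublinear_scaleR[OF ms]) simp
        finally show "q (r *\<^sub>R x) / r \<le> m (x + t *\<^sub>R y) - t * m y"
          using r by (simp add: field_simps)
      qed
      then show "q (r *\<^sub>R x) \<le> r * q x" using r by (simp add: field_simps)
    qed
    moreover have qm: "q \<le> m" using qle[of 0] by (simp add: le_fun_def)
    ultimately have "q = m" using mp by (intro min) (auto simp: A_def)
    \<comment> \<open>The choice \<open>t = 1\<close> in the infimum reads
      \<open>m x = q x \<le> m (x + y) - m y\<close>.\<close>
    then show ?thesis using qle[of 1 x] by simp
  qed
  have add: "m (x + y) = m x + m y" for x y using super[of x y] sublinear_add[OF ms, of x y] by simp
  have neg: "m (- x) = - m x" for x using add[of x "- x"] sublinear_zero[OF ms] by simp
  have "m (t *\<^sub>R x) = t * m x" for t x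
  proof (cases "0 \<le> t")
    case False
    then have "m ((- t) *\<^sub>R x) = (- t) * m x" by (intro sublinear_scaleR[OF ms]) simp
    then show ?thesis using neg[of "t *\<^sub>R x"] by simp
  qed (rule sublinear_scaleR[OF ms])
  then have "linear m" by (intro linearI) (simp_all add: add)
  with mp show thesis by (intro that[of m]) (auto simp: le_fun_def)
qed

text \<open>Hahn-Banach for the infimum \<open>p x\<close> of
  \<open>norm (x - b + t c) - t \<delta>\<close>. The gap \<open>\<delta>\<close> keeps it above
  \<open>- norm x\<close>. Taking \<open>t = 0\<close> gives \<open>p \<le> norm\<close> everywhere
  and \<open>p \<le> 0\<close> on \<open>B\<close>, and \<open>t = 1\<close> gives
  \<open>p (- c) \<le> - \<delta>\<close>, so every linear functional below \<open>p\<close>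
  separates.\<close>

lemma subspace_convex_separation:
  fixes B C :: "'v::real_normed_vector set"
  assumes B: "subspace B" and C: "convex C" "C \<noteq> {}" and \<delta>: "0 < \<delta>"
    and far: "\<And>b c. b \<in> B \<Longrightarrow> c \<in> C \<Longrightarrow> \<delta> \<le> norm (c - b)"
  obtains f where "linear f" "\<And>b. b \<in> B \<Longrightarrow> f b = 0" "\<And>c. c \<in> C \<Longrightarrow> \<delta> \<le> f c"
    "\<And>x. \<bar>f x\<bar> \<le> norm x"
proof -
  define T where "T = B \<times> {0::real..} \<times> C"
  define \<phi> where "\<phi> x = (\<lambda>(b, t, c). norm (x - b + t *\<^sub>R c) - t * \<delta>)" for x :: 'v
  define p where "p x = (INF k\<in>T. \<phi> x k)" for x
  have T: "T \<noteq> {}" using C subspace_0[OF B] by (auto simp: T_def)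
  have low: "- norm x \<le> \<phi> x k" if k: "k \<in> T" for x k
  proof -
    obtain b t c where k': "k = (b, t, c)" "b \<in> B" "0 \<le> t" "c \<in> C" using k by (auto simp: T_def)
    have "t * \<delta> \<le> norm (t *\<^sub>R c - b)"
    proof (cases "t = 0")
      case False
      have "\<delta> \<le> norm (c - (1/t) *\<^sub>R b)" using k' B by (intro far) (simp_all add: subspace_scale)
      then have "t * \<delta> \<le> norm (t *\<^sub>R (c - (1/t) *\<^sub>R b))" using k' by (simp add: mult_left_mono)
      then show ?thesis using False by (simp add: scaleR_diff_right)
    qed simp
    moreover have "norm (t *\<^sub>R c - b) \<le> norm (x - b + t *\<^sub>R c) + norm x"
      using norm_triangle_ineq4[of "x - b + t *\<^sub>R c" x] by (simp add: algebra_simps)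
    ultimately show ?thesis by (simp add: \<phi>_def k')
  qed
  have bdd: "bdd_below (\<phi> x ` T)" for x using low by (rule bdd_belowI2)
  have ple: "p x \<le> norm (x - b + t *\<^sub>R c) - t * \<delta>" if "b \<in> B" "0 \<le> t" "c \<in> C" for x b t c
    using cINF_lower[OF bdd[of x], of "(b, t, c)"] that by (simp add: p_def T_def \<phi>_def)
  have pge: "K \<le> p x" if "\<And>b t c. b \<in> B \<Longrightarrow> 0 \<le> t \<Longrightarrow> c \<in> C \<Longrightarrow> K \<le> norm (x - b + t *\<^sub>R c) - t * \<delta>" for K x
    unfolding p_def by (rule cINF_greatest[OF T]) (use that in \<open>auto simp: T_def \<phi>_def\<close>)
  have "sublinear p" unfolding sublinear_def
  proof (intro conjI allI impI)
    fix x y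
    have "p (x + y) - (norm (x - b + t *\<^sub>R c) - t * \<delta>) \<le> p y" if 1: "b \<in> B" "0 \<le> t" "c \<in> C" for b t c
    proof (rule pge)
      fix b' t' c' assume 2: "b' \<in> B" "0 \<le> (t'::real)" "c' \<in> C"
      \<comment> \<open>\<open>C\<close> is convex but not a cone, so the weight is carried along
        with the point; \<open>c''\<close> is the weighted mean, or just \<open>c\<close> if both
        weights vanish.\<close>
      obtain c'' where c'': "c'' \<in> C" "(t + t') *\<^sub>R c'' = t *\<^sub>R c + t' *\<^sub>R c'"
      proof (cases "t + t' = 0")
        case True
        then have "t = 0" "t' = 0" using 1 2 by auto
        then show thesis using 1 by (intro that[of c]) auto
      next
        case False
        then have pos: "0 < t + t'" using 1 2 by auto
        have "(t / (t + t')) *\<^sub>R c + (t' / (t + t')) *\<^sub>R c' \<in> C"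
          using 1 2 pos by (intro convexD[OF C(1)]) (auto simp: simp flip: add_divide_distrib)
        then show thesis by (rule that) (use pos in \<open>simp add: scaleR_add_right\<close>)
      qed
      have "p (x + y) \<le> norm ((x + y) - (b + b') + (t + t') *\<^sub>R c'') - (t + t') * \<delta>"
        using 1 2 c'' B by (intro ple) (auto simp: subspace_add)
      also have "(x + y) - (b + b') + (t + t') *\<^sub>R c'' = (x - b + t *\<^sub>R c) + (y - b' + t' *\<^sub>R c')"
        by (simp add: c'')
      also have "norm \<dots> \<le> norm (x - b + t *\<^sub>R c) + norm (y - b' + t' *\<^sub>R c')" by (rule norm_triangle_ineq)
      finally show "p (x + y) - (norm (x - b + t *\<^sub>R c) - t * \<delta>) \<le> norm (y - b' + t' *\<^sub>R c') - t' * \<delta>"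
        by (simp add: algebra_simps)
    qed
    then have "p (x + y) - p y \<le> p x" by (intro pge) (simp add: algebra_simps)
    then show "p (x + y) \<le> p x + p y" by simp
  next
    fix r :: real and x :: 'v assume r: "0 < r"
    have "p (r *\<^sub>R x) / r \<le> p x"
    proof (rule pge)
      fix b t c assume 1: "b \<in> B" "0 \<le> (t::real)" "c \<in> C"
      have "p (r *\<^sub>R x) \<le> norm (r *\<^sub>R x - r *\<^sub>R b + (r * t) *\<^sub>R c) - (r * t) * \<delta>"
        using 1 r B by (intro ple) (auto simp: subspace_scale)
      also have "r *\<^sub>R x - r *\<^sub>R b + (r * t) *\<^sub>R c = r *\<^sub>R (x - b + t *\<^sub>R c)" by (simp add: algebra_simps)
      also have "norm (r *\<^sub>R (x - b + t *\<^sub>R c)) = r * norm (x - b + t *\<^sub>R c)" using r by simp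
      finally show "p (r *\<^sub>R x) / r \<le> norm (x - b + t *\<^sub>R c) - t * \<delta>" using r by (simp add: field_simps)
    qed
    then show "p (r *\<^sub>R x) \<le> r * p x" using r by (simp add: field_simps)
  qed
  then obtain f where f: "linear f" "\<And>x. f x \<le> p x" using sublinear_dominates_linear by blast
  obtain c0 where c0: "c0 \<in> C" using C by blast
  have fn: "f x \<le> norm x" for x
    using f(2)[of x] ple[of 0 0 c0 x] c0 subspace_0[OF B] by simp
  have fb: "f b \<le> 0" if "b \<in> B" for b
    using f(2)[of b] ple[of b 0 c0 b] c0 that by simp
  have fneg: "f (- x) = - f x" for x using f(1) by (rule linear_neg)
  show thesis
  proof (rule that[OF f(1)])
    show "f b = 0" if "b \<in> B" for b
      using fb[OF that] fb[of "- b"] subspace_neg[OF B that] fneg[of b] by simp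
    show "\<delta> \<le> f c" if "c \<in> C" for c
      using f(2)[of "- c"] ple[of 0 1 c "- c"] that subspace_0[OF B] fneg[of c] by simp
    show "\<bar>f x\<bar> \<le> norm x" for x using fn[of x] fn[of "- x"] fneg[of x] by simp
  qed
qed

lemma operator_algebra_scaleR: "operator_algebra X \<Longrightarrow> x \<in> X \<Longrightarrow> r *\<^sub>R x \<in> X"
  by (metis operator_algebra_def scaleC_of_real)

lemma operator_algebra_diff:
  assumes "operator_algebra X" "x \<in> X" "y \<in> X" shows "x - y \<in> X"
proof -
  have "x + (-1) *\<^sub>R y \<in> X" using assms operator_algebra_scaleR unfolding operator_algebra_def by blast
  then show ?thesis by simp
qed

lemma operator_algebra_subspace: "operator_algebra X \<Longrightarrow> subspace X"
  unfolding subspace_def by (meson operator_algebra_def operator_algebra_scaleR)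

text \<open>A bounded functional which vanishes on \<open>B\<close> is annihilated by the points of
  \<open>B\<^sup>\<bottom>\<^sup>\<bottom>\<close>, so it cannot separate a limit point in \<open>B\<^sup>\<bottom>\<^sup>\<bottom>\<close> from \<open>B\<close>.\<close>

lemma near_subalgebra_of_limit_point:
  fixes E B C :: "'a::cstar_algebra set"
  assumes E: "operator_algebra E" and B: "operator_algebra B" "B \<subseteq> E"
    and C: "convex C" "C \<subseteq> E" and ev: "\<forall>\<^sub>F i in \<F>. e i \<in> C"
    and p: "p \<in> perp_perp E B"
    and lim: "net_limit_point (weak_star_topology E) \<F> (\<lambda>i. bidual_embedding E (e i)) p"
    and \<delta>: "0 < \<delta>"
  shows "\<exists>c\<in>C. \<exists>b\<in>B. norm (c - b) < \<delta>"
proof (rule ccontr)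
  assume neg: "\<not> ?thesis"
  define W where "W = weak_star_topology E"
  \<comment> \<open>The whole space is a neighbourhood of \<open>p\<close>, so the net visits it
    frequently, which excludes an empty \<open>C\<close>.\<close>
  have "openin W (topspace W)" by simp
  then have "\<exists>\<^sub>F i in \<F>. bidual_embedding E (e i) \<in> topspace W"
    using lim by (auto simp: net_limit_point_def W_def)
  then have "\<exists>\<^sub>F i in \<F>. e i \<in> C" 
    by (rule frequently_rev_mp) (use ev in \<open>auto elim: eventually_mono\<close>)
  then have "C \<noteq> {}" using frequently_ex by blast
  moreover have "\<delta> \<le> norm (c - b)" if "b \<in> B" "c \<in> C" for b c
    using neg that by (auto simp: not_less)
  ultimately obtain f where f: "linear f" "\<And>b. b \<in> B \<Longrightarrow> f b = 0" "\<And>c. c \<in> C \<Longrightarrow> \<delta> \<le> f c"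
      "\<And>x. \<bar>f x\<bar> \<le> norm x"
    using subspace_convex_separation[OF operator_algebra_subspace[OF B(1)] C(1) _ \<delta>] by metis
  \<comment> \<open>\<open>f\<close> is only real linear, whereas the dual consists of complex
    functionals: \<open>f x - i f (i x)\<close> is the standard complex functional with real part
    \<open>f\<close>. It still vanishes on \<open>B\<close>, which is closed under multiplication by
    \<open>i\<close>.\<close>
  define F where "F = (\<lambda>x\<in>E. Complex (f x) (- f (scaleC \<i> x)))"
  have sc: "scaleC c x = Re c *\<^sub>R x + Im c *\<^sub>R scaleC \<i> x" for c and x :: 'a
  proof -
    have "c = complex_of_real (Re c) + complex_of_real (Im c) * \<i>" by (simp add: complex_eq_iff)
    then have "scaleC c x = scaleC (complex_of_real (Re c) + complex_of_real (Im c) * \<i>) x" by simp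
    also have "\<dots> = Re c *\<^sub>R x + Im c *\<^sub>R scaleC \<i> x"
      by (simp only: scaleC_add_left scaleC_of_real flip: scaleC_scaleC)
    finally show ?thesis .
  qed
  have ii: "scaleC \<i> (scaleC \<i> x) = - x" for x :: 'a
    using scaleC_of_real[of "-1" x] by (simp add: scaleC_scaleC)
  have fa: "f (x + y) = f x + f y" "f (r *\<^sub>R x) = r * f x" "f (- x) = - f x" "f (x - y) = f x - f y" for x y r
    using f(1) by (simp_all add: linear_add linear_scale linear_neg linear_diff)
  have F: "F \<in> dual_space E"
    unfolding dual_space_def
  proof (intro CollectI conjI ballI allI exI[of _ 2])
    show "F \<in> extensional E" by (simp add: F_def)
    show "F (x + y) = F x + F y" if "x \<in> E" "y \<in> E" for x y
      using that E by (simp add: F_def operator_algebra_def scaleC_add_right fa complex_eq_iff)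
    show "F (scaleC c x) = c * F x" if "x \<in> E" for c x
    proof -
      have "scaleC \<i> (scaleC c x) = scaleC c (scaleC \<i> x)" by (simp add: scaleC_scaleC mult.commute)
      then have "f (scaleC \<i> (scaleC c x)) = Re c * f (scaleC \<i> x) - Im c * f x"
        by (simp add: sc[of c "scaleC \<i> x"] ii fa)
      moreover have "f (scaleC c x) = Re c * f x + Im c * f (scaleC \<i> x)" by (subst sc) (simp add: fa)
      ultimately show ?thesis using that E by (simp add: F_def operator_algebra_def complex_eq_iff)
    qed
    show "cmod (F x) \<le> 2 * norm x" if "x \<in> E" for x
      using cmod_le[of "F x"] f(4)[of x] f(4)[of "scaleC \<i> x"] that by (simp add: F_def norm_scaleC)
  qed
  have FB: "F b = 0" if "b \<in> B" for b
    using that B f(2) by (auto simp: F_def operator_algebra_def complex_eq_iff)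
  have cont: "continuous_map W euclidean (\<lambda>\<Phi>. \<Phi> F)" unfolding W_def weak_star_topology_def
    by (intro continuous_map_from_subtopology continuous_map_product_projection F)
  have cl: "closedin W {\<Phi> \<in> topspace W. \<Phi> F \<in> {0}}"
    by (intro closedin_continuous_map_preimage[OF cont]) simp
  have "p \<in> W closure_of (bidual_embedding E ` B)"
    using p by (simp add: perp_perp_def W_def)
  then have pc: "p \<in> W closure_of (topspace W \<inter> bidual_embedding E ` B)"
    by (simp flip: closure_of_restrict)
  have sub: "topspace W \<inter> bidual_embedding E ` B \<subseteq> {\<Phi> \<in> topspace W. \<Phi> F \<in> {0}}"
    using F FB by (auto simp: bidual_embedding_def)
  have pF: "p F = 0" using subsetD[OF closure_of_minimal[OF sub cl] pc] by simp
  have "openin W {\<Phi> \<in> topspace W. \<Phi> F \<in> ball 0 \<delta>}"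
    by (intro openin_continuous_map_preimage[OF cont]) simp
  moreover have "p \<in> {\<Phi> \<in> topspace W. \<Phi> F \<in> ball 0 \<delta>}"
    using lim pF \<delta> by (simp add: net_limit_point_def W_def)
  ultimately have "\<exists>\<^sub>F i in \<F>. bidual_embedding E (e i) \<in> {\<Phi> \<in> topspace W. \<Phi> F \<in> ball 0 \<delta>}"
    using lim unfolding net_limit_point_def W_def by blast
  then have "\<exists>\<^sub>F i in \<F>. bidual_embedding E (e i) F \<in> ball 0 \<delta> \<and> e i \<in> C"
    by (rule frequently_rev_mp) (use ev in \<open>auto elim: eventually_mono\<close>)
  then obtain i where i: "bidual_embedding E (e i) F \<in> ball 0 \<delta>" "e i \<in> C"
    using frequently_ex by blast
  then have "cmod (F (e i)) < \<delta>" using F by (simp add: bidual_embedding_def)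
  moreover have "Re (F (e i)) = f (e i)" using i C by (auto simp: F_def)
  ultimately show False using f(3)[OF i(2)] abs_Re_le_cmod[of "F (e i)"] by simp
qed

section \<open>Matrices of all sizes\<close>

text \<open>Square matrices of all sizes are embedded in one ring type as its corners.\<close>

typedef (overloaded) 'a fmat = "{f :: nat \<Rightarrow> nat \<Rightarrow> 'a::zero. \<exists>n. \<forall>i j. n \<le> i \<or> n \<le> j \<longrightarrow> f i j = 0}"
  morphisms entry Fmat
  by (rule exI[of _ "\<lambda>i j. 0"]) simp

setup_lifting type_definition_fmat

lemma fmat_eqI: "(\<And>i j. entry a i j = entry b i j) \<Longrightarrow> a = b"
  by (simp add: entry_inject[symmetric] fun_eq_iff)

definition corner :: "nat \<Rightarrow> 'a::zero fmat set" where
  "corner n = {a. \<forall>i j. n \<le> i \<or> n \<le> j \<longrightarrow> entry a i j = 0}"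

lemma corner_mono: "m \<le> n \<Longrightarrow> a \<in> corner m \<Longrightarrow> a \<in> corner n"
  by (auto simp: corner_def)

lemma corner_exhausts: obtains n where "a \<in> corner n"
  using entry[of a] by (auto simp: corner_def)

text \<open>The product of \<open>fmat\<close> has no size to sum up to and runs over the support of
  a row; inside a corner this is the usual matrix product.\<close>

lemma sum_support_eq:
  fixes f g :: "nat \<Rightarrow> 'a::ring"
  assumes "\<And>j. n \<le> j \<Longrightarrow> f j = 0"
  shows "(\<Sum>j | f j \<noteq> 0. f j * g j) = (\<Sum>j<n. f j * g j)"
proof (rule sum.mono_neutral_left)
  show "{j. f j \<noteq> 0} \<subseteq> {..<n}" using assms not_less by blast
qed auto

instantiation fmat :: (real_algebra) real_algebra
begin

lift_definition zero_fmat :: "'a fmat" is "\<lambda>i j. 0" by simp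

lift_definition plus_fmat :: "'a fmat \<Rightarrow> 'a fmat \<Rightarrow> 'a fmat" is "\<lambda>f g i j. f i j + g i j"
  by (metis (no_types, lifting) add.right_neutral le_trans linorder_linear)

lift_definition uminus_fmat :: "'a fmat \<Rightarrow> 'a fmat" is "\<lambda>f i j. - f i j"
  by auto

lift_definition minus_fmat :: "'a fmat \<Rightarrow> 'a fmat \<Rightarrow> 'a fmat" is "\<lambda>f g i j. f i j - g i j"
  by (metis (no_types, lifting) diff_self le_trans linorder_linear)

lift_definition scaleR_fmat :: "real \<Rightarrow> 'a fmat \<Rightarrow> 'a fmat" is "\<lambda>r f i j. r *\<^sub>R f i j"
  by auto

lift_definition times_fmat :: "'a fmat \<Rightarrow> 'a fmat \<Rightarrow> 'a fmat" is
  "\<lambda>f g i k. \<Sum>j | f i j \<noteq> 0. f i j * g j k"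
proof -
  fix f g :: "nat \<Rightarrow> nat \<Rightarrow> 'a"
  assume "\<exists>n. \<forall>i j. n \<le> i \<or> n \<le> j \<longrightarrow> f i j = 0" "\<exists>n. \<forall>i j. n \<le> i \<or> n \<le> j \<longrightarrow> g i j = 0"
  then obtain m n where "\<forall>i j. m \<le> i \<or> m \<le> j \<longrightarrow> f i j = 0" "\<forall>i j. n \<le> i \<or> n \<le> j \<longrightarrow> g i j = 0" by blast
  then show "\<exists>n. \<forall>i k. n \<le> i \<or> n \<le> k \<longrightarrow> (\<Sum>j | f i j \<noteq> 0. f i j * g j k) = 0"
    by (intro exI[of _ "max m n"]) auto
qed

lemma entry_times:
  assumes "a \<in> corner n" shows "entry (a * b) i k = (\<Sum>j<n. entry a i j * entry b j k)"
  unfolding times_fmat.rep_eq by (rule sum_support_eq) (use assms in \<open>auto simp: corner_def\<close>)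

lemma times_fmat_corner:
  assumes "a \<in> corner n" "b \<in> corner n" shows "a * b \<in> corner n"
  using assms by (auto simp: corner_def[of n, where 'a = 'a] entry_times[OF assms(1)])

instance
proof
  fix a b c :: "'a fmat" and r s :: real
  show "a + b + c = a + (b + c)" "a + b = b + a" "0 + a = a" "- a + a = 0" "a - b = a + - b"
    "r *\<^sub>R (a + b) = r *\<^sub>R a + r *\<^sub>R b" "(r + s) *\<^sub>R a = r *\<^sub>R a + s *\<^sub>R a"
    "r *\<^sub>R (s *\<^sub>R a) = (r * s) *\<^sub>R a" "1 *\<^sub>R a = a"
    by (transfer, simp add: algebra_simps fun_eq_iff)+
  obtain k l m where "a \<in> corner k" "b \<in> corner l" "c \<in> corner m" by (metis corner_exhausts)
  then obtain n where n: "a \<in> corner n" "b \<in> corner n" "c \<in> corner n"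
    using corner_mono[of _ "max k (max l m)"] by (metis max.cobounded1 max.cobounded2 max.coboundedI2)
  have nn: "a * b \<in> corner n" using n(1,2) by (rule times_fmat_corner)
  have add: "a + b \<in> corner n" and sc: "r *\<^sub>R a \<in> corner n"
    using n by (auto simp: corner_def plus_fmat.rep_eq scaleR_fmat.rep_eq)
  show "a * b * c = a * (b * c)"
    by (rule fmat_eqI)
      (simp add: entry_times[OF n(1)] entry_times[OF n(2)] entry_times[OF nn] sum_distrib_left
        sum_distrib_right mult.assoc, subst sum.swap, simp)
  show "(a + b) * c = a * c + b * c"
    by (rule fmat_eqI) (simp add: entry_times[OF n(1)] entry_times[OF n(2)] entry_times[OF add]
        plus_fmat.rep_eq distrib_right sum.distrib)
  show "a * (b + c) = a * b + a * c"
    by (rule fmat_eqI) (simp add: entry_times[OF n(1)] plus_fmat.rep_eq distrib_left sum.distrib)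
  show "r *\<^sub>R a * b = r *\<^sub>R (a * b)"
    by (rule fmat_eqI) (simp add: entry_times[OF n(1)] entry_times[OF sc] scaleR_fmat.rep_eq scaleR_sum_right)
  show "a * r *\<^sub>R b = r *\<^sub>R (a * b)"
    by (rule fmat_eqI) (simp add: entry_times[OF n(1)] scaleR_fmat.rep_eq scaleR_sum_right)
qed

end

lemmas entry_simps = zero_fmat.rep_eq plus_fmat.rep_eq uminus_fmat.rep_eq minus_fmat.rep_eq scaleR_fmat.rep_eq

lemma scaleC_zero [simp]: "scaleC c (0::'a::cstar_algebra) = 0"
  using scaleC_add_right[of c 0 "0::'a"] by simp

lemma scaleC_one: "scaleC 1 x = (x::'a::cstar_algebra)"
  using scaleC_of_real[of 1 x] by simp

lemma scaleC_minus_left: "scaleC (- c) x = - scaleC c (x::'a::cstar_algebra)"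
proof -
  have "scaleC (- c) x + scaleC c x = scaleC 0 x" by (simp flip: scaleC_add_left)
  also have "\<dots> = 0" using scaleC_of_real[of 0 x] by simp
  finally show ?thesis by (simp add: eq_neg_iff_add_eq_0)
qed

lemma scaleC_sum: "scaleC c (sum f A) = (\<Sum>x\<in>A. scaleC c (f x :: 'a::cstar_algebra))"
  by (induction A rule: infinite_finite_induct) (simp_all add: scaleC_add_right)

lemma star_sum: "star (sum f A) = (\<Sum>x\<in>A. star (f x :: 'a::cstar_algebra))"
  by (induction A rule: infinite_finite_induct) (simp_all add: star_add)

lift_definition fstar :: "'a::cstar_algebra fmat \<Rightarrow> 'a fmat" is "\<lambda>f i j. star (f j i)"
  by (metis star_zero)

lift_definition fim :: "'a::cstar_algebra fmat \<Rightarrow> 'a fmat" is "\<lambda>f i j. scaleC \<i> (f i j)"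
  by (metis scaleC_zero)

lift_definition fdiag :: "nat \<Rightarrow> 'a::zero \<Rightarrow> 'a fmat" is "\<lambda>n x i j. if i = j \<and> i < n then x else 0"
  subgoal for n x by (rule exI[of _ n]) auto
  done

lift_definition funit :: "nat \<Rightarrow> nat \<Rightarrow> 'a::zero \<Rightarrow> 'a fmat" is "\<lambda>k l x i j. if i = k \<and> j = l then x else 0"
  subgoal for k l x by (rule exI[of _ "Suc (max k l)"]) auto
  done

lemma fdiag_corner: "fdiag n x \<in> corner n"
  by (auto simp: corner_def fdiag.rep_eq)

lemma funit_corner: "k < n \<Longrightarrow> l < n \<Longrightarrow> funit k l x \<in> corner n"
  by (auto simp: corner_def funit.rep_eq)

lemma entry_fdiag_times:
  "a \<in> corner n \<Longrightarrow> entry (fdiag n x * a) i j = x * entry (a :: 'a::real_algebra fmat) i j"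
  by (cases "i < n")
    (auto simp: entry_times[OF fdiag_corner] fdiag.rep_eq corner_def if_distrib[of "\<lambda>y. y * _"] cong: if_cong)

lemma entry_times_fdiag:
  "a \<in> corner n \<Longrightarrow> entry (a * fdiag n x) i j = entry (a :: 'a::real_algebra fmat) i j * x"
  by (auto simp: entry_times[of a n] fdiag.rep_eq corner_def if_distrib[of "\<lambda>y. _ * y"] cong: if_cong)

lemma funit_times:
  "funit k l x * funit l m (y :: 'a::real_algebra) = funit k m (x * y)"
proof (rule fmat_eqI)
  fix i j
  have "funit k l x \<in> corner (Suc (max k l))" by (rule funit_corner) auto
  then show "entry (funit k l x * funit l m y) i j = entry (funit k m (x * y)) i j"
    by (simp add: entry_times funit.rep_eq if_distrib[of "\<lambda>y. _ * y"] cong: if_cong)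
qed

definition to_mat :: "nat \<Rightarrow> 'a::zero fmat \<Rightarrow> 'a mat" where
  "to_mat n a = mat n n (\<lambda>(i, j). entry a i j)"

lift_definition of_mat :: "nat \<Rightarrow> 'a::zero mat \<Rightarrow> 'a fmat" is
  "\<lambda>n A i j. if i < n \<and> j < n then A $$ (i, j) else 0"
  subgoal for n A by (rule exI[of _ n]) auto
  done

lemma to_mat_carrier [simp]: "to_mat n a \<in> carrier_mat n n"
  by (simp add: to_mat_def)

lemma of_mat_corner: "of_mat n A \<in> corner n"
  by (auto simp: corner_def of_mat.rep_eq)

lemma to_mat_of_mat: "A \<in> carrier_mat n n \<Longrightarrow> to_mat n (of_mat n A) = A"
  by (rule eq_matI) (auto simp: to_mat_def of_mat.rep_eq)

lemma to_mat_plus: "to_mat n (a + b) = to_mat n a + to_mat n (b :: 'a::real_algebra fmat)"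
  by (rule eq_matI) (auto simp: to_mat_def entry_simps)

lemma to_mat_scaleR: "to_mat n (r *\<^sub>R a) = map_mat (scaleC (complex_of_real r)) (to_mat n a)"
  by (rule eq_matI) (auto simp: to_mat_def entry_simps scaleC_of_real)

lemma to_mat_times: "a \<in> corner n \<Longrightarrow> to_mat n (a * b) = to_mat n a * to_mat n (b :: 'a::real_algebra fmat)"
  by (rule eq_matI) (auto simp: to_mat_def entry_times scalar_prod_def lessThan_atLeast0)

lemma to_mat_fstar: "to_mat n (fstar a) = mat_star (to_mat n a)"
  by (rule eq_matI) (auto simp: to_mat_def mat_star_def fstar.rep_eq)

definition fnorm :: "(nat \<Rightarrow> 'a::zero mat \<Rightarrow> real) \<Rightarrow> nat \<Rightarrow> 'a fmat \<Rightarrow> real" where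
  "fnorm N n a = N n (to_mat n a)"

lemma fstar_corner: "a \<in> corner n \<Longrightarrow> fstar a \<in> corner n"
  by (auto simp: corner_def fstar.rep_eq)

lemma cstar_normed_corner:
  fixes N :: "nat \<Rightarrow> 'a::cstar_algebra mat \<Rightarrow> real"
  assumes "cstar_matrix_norms N"
  shows "cstar_normed (corner n) (fnorm N n) fstar fim"
proof -
  have N: "cstar_norm_on_mats n (N n)" using assms by (simp add: cstar_matrix_norms_def)
  note N' = N[unfolded cstar_norm_on_mats_def]
  have tri: "N n (A + B) \<le> N n A + N n B" and mul: "N n (A * B) \<le> N n A * N n B"
    if "A \<in> carrier_mat n n" "B \<in> carrier_mat n n" for A B
    using N' that by blast+
  have scl: "N n (map_mat (scaleC c) A) = cmod c * N n A" and nonneg: "0 \<le> N n A"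
    and cst: "N n (mat_star A * A) = (N n A)\<^sup>2" if "A \<in> carrier_mat n n" for A c
    using N' that by blast+
  show ?thesis
  proof
    fix a b :: "'a fmat" and r :: real
    show "fstar (fstar a) = a" "fstar (a + b) = fstar a + fstar b" "fstar (r *\<^sub>R a) = r *\<^sub>R fstar a"
      "fim (a + b) = fim a + fim b" "fim (fim a) = - a" "fstar (fim a) = - fim (fstar a)"
      by (auto intro!: fmat_eqI simp: fstar.rep_eq fim.rep_eq entry_simps star_star star_add star_scaleR
          scaleC_add_right scaleC_scaleC star_scaleC scaleC_minus_left scaleC_one)
    \<comment> \<open>The algebraic laws are required on the whole type, also outside
      \<open>corner n\<close>, so they are checked in a corner common to \<open>a\<close> and
      \<open>b\<close>.\<close>
    obtain k l where "a \<in> corner k" "b \<in> corner l" by (metis corner_exhausts)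
    then have m: "a \<in> corner (max k l)" "b \<in> corner (max k l)" by (auto intro: corner_mono[rotated])
    have fim_m: "fim a \<in> corner (max k l)" using m by (auto simp: corner_def fim.rep_eq)
    show "fstar (a * b) = fstar b * fstar a"
      by (rule fmat_eqI) (simp add: fstar.rep_eq entry_times[OF m(1)] entry_times[OF fstar_corner[OF m(2)]]
          star_sum star_mult)
    show "fim a * b = fim (a * b)"
      by (rule fmat_eqI) (simp add: fim.rep_eq entry_times[OF m(1)] entry_times[OF fim_m] scaleC_sum mult_scaleC_left)
    show "a * fim b = fim (a * b)"
      by (rule fmat_eqI) (simp add: fim.rep_eq entry_times[OF m(1)] scaleC_sum mult_scaleC_right)
    assume a: "a \<in> corner n"
    then show "r *\<^sub>R a \<in> corner n" "fstar a \<in> corner n" "fim a \<in> corner n"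
      by (auto simp: corner_def fstar.rep_eq fim.rep_eq entry_simps)
    show "fnorm N n (r *\<^sub>R a) = \<bar>r\<bar> * fnorm N n a"
      by (simp add: fnorm_def to_mat_scaleR scl)
    show "0 \<le> fnorm N n a" by (simp add: fnorm_def nonneg)
    show "fnorm N n (fstar a * a) = (fnorm N n a)\<^sup>2"
      by (simp add: fnorm_def to_mat_times[OF fstar_corner[OF a]] to_mat_fstar cst)
    assume b: "b \<in> corner n"
    with a show "a + b \<in> corner n" by (auto simp: corner_def entry_simps)
    from a b show "a * b \<in> corner n" by (rule times_fmat_corner)
    show "fnorm N n (a + b) \<le> fnorm N n a + fnorm N n b" by (simp add: fnorm_def to_mat_plus tri)
    show "fnorm N n (a * b) \<le> fnorm N n a * fnorm N n b" by (simp add: fnorm_def to_mat_times[OF a] mul)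
  qed
qed

text \<open>For \<open>k = l\<close> the embedding is a *-homomorphism and hence contractive; the
  C*-identity reduces the other positions to this case.\<close>

lemma fnorm_funit_le:
  assumes N: "cstar_matrix_norms N" and kl: "k < n" "l < n"
  shows "fnorm N n (funit k l x) \<le> norm x"
proof -
  interpret cstar_normed "corner n" "fnorm N n" fstar fim by (rule cstar_normed_corner[OF N])
  have diag: "fnorm N n (funit l l y) \<le> norm y" for y
    by (rule star_hom_contractive)
      (auto intro!: fmat_eqI simp: funit_corner kl funit_times funit.rep_eq fstar.rep_eq entry_simps)
  have "fstar (funit k l x) * funit k l x = funit l l (star x * x)"
  proof -
    have "fstar (funit k l x) = funit l k (star x)"
      by (auto intro!: fmat_eqI simp: funit.rep_eq fstar.rep_eq)
    then show ?thesis by (simp add: funit_times)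
  qed
  then have "(fnorm N n (funit k l x))\<^sup>2 \<le> (norm x)\<^sup>2"
    using diag[of "star x * x"] nu_cstar[of "funit k l x"] kl by (simp add: funit_corner cstar_identity)
  then show ?thesis by (rule power2_le_imp_le) simp
qed

text \<open>A matrix is the sum of its \<open>n\<^sup>2\<close> entries at their positions. This
  crude bound is the only passage from entrywise smallness to the given norm.\<close>

lemma fnorm_le_entries:
  assumes N: "cstar_matrix_norms N" and a: "a \<in> corner n" and K: "\<And>i j. norm (entry a i j) \<le> K"
  shows "fnorm N n a \<le> (real n)\<^sup>2 * K"
proof -
  interpret cstar_normed "corner n" "fnorm N n" fstar fim by (rule cstar_normed_corner[OF N])
  define I where "I = {..<n} \<times> {..<n}"
  define S where "S T = (\<Sum>(k, l)\<in>T. funit k l (entry a k l))" for T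
  have ent: "entry (S T) i j = (if (i, j) \<in> T then entry a i j else 0)" if "finite T" for T i j
    using that by (induction T) (auto simp: S_def entry_simps funit.rep_eq split: if_splits)
  have zero: "fnorm N n 0 = 0" "(0::'a fmat) \<in> corner n"
    using nu_scaleR[OF a, of 0] C_scaleR[OF a, of 0] by simp_all
  have "S T \<in> corner n \<and> fnorm N n (S T) \<le> card T * K" if "finite T" "T \<subseteq> I" for T
    using that
  proof (induction T)
    case empty
    then show ?case by (simp add: S_def zero)
  next
    case (insert t T)
    obtain k l where t: "t = (k, l)" "k < n" "l < n" using insert.prems by (auto simp: I_def)
    have "fnorm N n (funit k l (entry a k l)) \<le> K" using fnorm_funit_le[OF N t(2,3)] K order_trans by blast
    moreover have "S (insert t T) = funit k l (entry a k l) + S T" using insert t by (simp add: S_def)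
    moreover have "S T \<in> corner n" "fnorm N n (S T) \<le> card T * K" using insert by auto
    ultimately have "S (insert t T) \<in> corner n" "fnorm N n (S (insert t T)) \<le> K + card T * K"
      using funit_corner[OF t(2,3), of "entry a k l"] by (auto intro: nu_triangle_le)
    then show ?case using insert by (simp add: algebra_simps)
  qed
  from this[of I] have "fnorm N n (S I) \<le> (real n)\<^sup>2 * K" by (simp add: I_def power2_eq_square)
  moreover have "S I = a"
    using a by (intro fmat_eqI) (auto simp: ent I_def corner_def)
  ultimately show ?thesis by simp
qed

section \<open>Lifting along the quotient map\<close>

definition fcorner :: "nat \<Rightarrow> 'a::zero set \<Rightarrow> 'a fmat set" where
  "fcorner n X = {a \<in> corner n. \<forall>i j. entry a i j \<in> X}"

text \<open>The hypotheses in working form: \<open>quot\<close> unfolds the quotient norm into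
  almost optimal representatives, and \<open>units\<close> merges both cases of the assumption on
  the cai, with units that are only close to \<open>B\<close>.\<close>

locale cai_quotient =
  fixes E B :: "'a::cstar_algebra set"
    and N :: "nat \<Rightarrow> 'a mat \<Rightarrow> real" and M :: "nat \<Rightarrow> 'b::cstar_algebra mat \<Rightarrow> real"
    and \<theta> :: "'a \<Rightarrow> 'b"
  assumes N: "cstar_matrix_norms N" and M: "cstar_matrix_norms M"
    and E: "operator_algebra E" and B: "operator_algebra B" and BE: "B \<subseteq> E"
    and theta_add: "x \<in> E \<Longrightarrow> y \<in> E \<Longrightarrow> \<theta> (x + y) = \<theta> x + \<theta> y"
    and theta_scaleC: "x \<in> E \<Longrightarrow> \<theta> (scaleC c x) = scaleC c (\<theta> x)"
    and theta_mult: "x \<in> E \<Longrightarrow> y \<in> E \<Longrightarrow> \<theta> (x * y) = \<theta> x * \<theta> y"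
    and contr: "A \<in> mats n E \<Longrightarrow> M n (map_mat \<theta> A) \<le> N n A"
    and quot: "A \<in> mats n E \<Longrightarrow> M n (map_mat \<theta> A) < r \<Longrightarrow>
      \<exists>A'\<in>carrier_mat n n. (\<forall>i<n. \<forall>j<n. A' $$ (i, j) - A $$ (i, j) \<in> ker_on E \<theta>) \<and> N n A' < r"
    and units: "finite S \<Longrightarrow> S \<subseteq> ker_on E \<theta> \<Longrightarrow> 0 < \<eta> \<Longrightarrow>
      \<exists>x\<in>ker_on E \<theta>. norm x \<le> 1 \<and> (\<exists>b\<in>B. norm (x - b) \<le> \<eta>) \<and>
        (\<forall>s\<in>S. norm (x * s - s) \<le> \<eta> \<and> norm (s * x - s) \<le> \<eta>)"
begin

abbreviation J where "J \<equiv> ker_on E \<theta>"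

lemma E0 [simp]: "0 \<in> E" and E_add: "x \<in> E \<Longrightarrow> y \<in> E \<Longrightarrow> x + y \<in> E"
  and E_mult: "x \<in> E \<Longrightarrow> y \<in> E \<Longrightarrow> x * y \<in> E"
  and E_scaleR: "x \<in> E \<Longrightarrow> r *\<^sub>R x \<in> E" and E_diff: "x \<in> E \<Longrightarrow> y \<in> E \<Longrightarrow> x - y \<in> E"
  using E operator_algebra_scaleR[OF E] operator_algebra_diff[OF E] by (auto simp: operator_algebra_def)

lemma B0 [simp]: "0 \<in> B" and B_add: "x \<in> B \<Longrightarrow> y \<in> B \<Longrightarrow> x + y \<in> B"
  and B_mult: "x \<in> B \<Longrightarrow> y \<in> B \<Longrightarrow> x * y \<in> B" and B_scaleC: "x \<in> B \<Longrightarrow> scaleC c x \<in> B"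
  and B_scaleR: "x \<in> B \<Longrightarrow> r *\<^sub>R x \<in> B" and B_diff: "x \<in> B \<Longrightarrow> y \<in> B \<Longrightarrow> x - y \<in> B"
  and B_closed: "closed B"
  using B operator_algebra_scaleR[OF B] operator_algebra_diff[OF B] by (auto simp: operator_algebra_def)

lemma B_E: "x \<in> B \<Longrightarrow> x \<in> E"
  using BE by blast

lemma theta_scaleR: "x \<in> E \<Longrightarrow> \<theta> (r *\<^sub>R x) = r *\<^sub>R \<theta> x"
  using theta_scaleC[of x "complex_of_real r"] by (simp add: scaleC_of_real)

lemma theta_zero [simp]: "\<theta> 0 = 0"
  using theta_scaleR[of 0 0] by simp

lemma theta_diff: "x \<in> E \<Longrightarrow> y \<in> E \<Longrightarrow> \<theta> (x - y) = \<theta> x - \<theta> y"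
  using theta_add[of x "(-1) *\<^sub>R y"] theta_scaleR[of y "-1"] E_scaleR[of y "-1"] by simp

lemma JI: "x \<in> E \<Longrightarrow> \<theta> x = 0 \<Longrightarrow> x \<in> J"
  by (simp add: ker_on_def)

lemma J0 [simp]: "0 \<in> J"
  by (rule JI) auto

text \<open>For \<open>a\<close> over \<open>E\<close> this is the distance of \<open>a\<close> from
  the matrices over the kernel, because \<open>\<theta>\<close> is a complete quotient map.\<close>

definition qnorm :: "nat \<Rightarrow> 'a fmat \<Rightarrow> real" where
  "qnorm n a = M n (map_mat \<theta> (to_mat n a))"

lemma to_mat_mats: "a \<in> fcorner n X \<Longrightarrow> to_mat n a \<in> mats n X"
  by (auto simp: mats_def fcorner_def to_mat_def elements_mat_def)

lemma of_mat_fcorner: "A \<in> mats n X \<Longrightarrow> 0 \<in> X \<Longrightarrow> of_mat n A \<in> fcorner n X"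
  unfolding mats_def fcorner_def
proof (intro CollectI conjI allI)
  fix i j assume A: "A \<in> {a \<in> carrier_mat n n. elements_mat a \<subseteq> X}" "0 \<in> X"
  show "entry (of_mat n A) i j \<in> X"
    using A elements_matI[of A n n i j, OF _ _ _ refl] by (auto simp: of_mat.rep_eq)
qed (rule of_mat_corner)

lemma fcorner_mono: "X \<subseteq> X' \<Longrightarrow> a \<in> fcorner n X \<Longrightarrow> a \<in> fcorner n X'"
  by (auto simp: fcorner_def)

lemma qnorm_less:
  assumes a: "a \<in> fcorner n E" and r: "qnorm n a < r"
  shows "\<exists>j\<in>fcorner n J. fnorm N n (a - j) < r"
proof -
  obtain A where A: "A \<in> carrier_mat n n" "N n A < r"
    "\<forall>i<n. \<forall>j<n. A $$ (i, j) - to_mat n a $$ (i, j) \<in> J"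
    using quot[OF to_mat_mats[OF a] r[unfolded qnorm_def]] by blast
  have neg: "- x \<in> J" if "x \<in> J" for x
    using that E_scaleR[of x "-1"] theta_scaleR[of x "-1"] by (auto simp: ker_on_def)
  have "entry (a - of_mat n A) i j \<in> J" for i j
    using a A(3) neg[of "A $$ (i, j) - to_mat n a $$ (i, j)"]
    by (auto simp: fcorner_def corner_def entry_simps of_mat.rep_eq to_mat_def)
  then have "a - of_mat n A \<in> fcorner n J"
    using a of_mat_corner[of n A] by (auto simp: fcorner_def corner_def entry_simps)
  moreover have "fnorm N n (a - (a - of_mat n A)) < r"
    using A by (simp add: fnorm_def to_mat_of_mat)
  ultimately show ?thesis by blast
qed

lemma qnorm_cong:
  "(\<And>i j. \<theta> (entry a i j) = \<theta> (entry b i j)) \<Longrightarrow> qnorm n a = qnorm n b"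
  unfolding qnorm_def by (rule arg_cong[where f = "M n"]) (auto intro!: eq_matI simp: to_mat_def)

text \<open>Instantiates the abstract units with scalar diagonal matrices: one element
  \<open>x\<close> near \<open>B\<close> then serves for matrices of size \<open>n\<close>, and it
  is an approximate unit for a finite set of matrices as soon as it is one for all their
  entries.\<close>

lemma unit_perturbation_corner:
  assumes b: "b \<in> fcorner n E" "fnorm N n b \<le> R + \<epsilon>" "qnorm n b < R"
    and pos: "0 < R" "0 \<le> \<epsilon>" "0 < \<delta>" "0 < \<eta>"
  obtains x where "x \<in> J" "norm x \<le> 1" "\<exists>c\<in>B. norm (x - c) \<le> \<eta>"
    "fnorm N n (b - (\<epsilon> / (R + \<epsilon>)) *\<^sub>R (fdiag n x * b)) \<le> R + \<delta>"
proof -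
  interpret cstar_normed "corner n" "fnorm N n" fstar fim by (rule cstar_normed_corner[OF N])
  define Y where "Y \<eta> = {x \<in> J. \<exists>c\<in>B. norm (x - c) \<le> \<eta>}" for \<eta>
  have mult_entries: "a * b \<in> fcorner n X"
    if a: "a \<in> fcorner n X'" and b: "b \<in> fcorner n X''"
      and X: "\<And>x y. x \<in> X' \<Longrightarrow> y \<in> X'' \<Longrightarrow> x * y \<in> X"
        "0 \<in> X" "\<And>x y. x \<in> X \<Longrightarrow> y \<in> X \<Longrightarrow> x + y \<in> X" for a b :: "'a fmat" and X X' X''
  proof -
    have "entry (a * b) i k \<in> X" for i k
    proof -
      have "(\<Sum>j<m. entry a i j * entry b j k) \<in> X" for m
        by (induction m) (use a b X in \<open>auto simp: fcorner_def\<close>)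
      then show ?thesis using a by (simp add: fcorner_def entry_times[of a n])
    qed
    then show ?thesis using a b by (auto simp: fcorner_def)
  qed
  interpret cstar_units "corner n" "fnorm N n" fstar fim "fdiag n" "fcorner n E" "fcorner n J" Y
  proof
    fix x y :: 'a and r :: real
    show "fdiag n x \<in> corner n" by (rule fdiag_corner)
    show "fdiag n (x + y) = fdiag n x + fdiag n y" "fdiag n (r *\<^sub>R x) = r *\<^sub>R fdiag n x"
      "fdiag n (star x) = fstar (fdiag n x)"
      by (auto intro!: fmat_eqI simp: fdiag.rep_eq entry_simps fstar.rep_eq)
    show "fdiag n (x * y) = fdiag n x * fdiag n y"
      by (rule fmat_eqI) (simp add: entry_fdiag_times[OF fdiag_corner], simp add: fdiag.rep_eq)
    fix a b :: "'a fmat" and \<eta> \<eta>' :: real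
    show "a \<in> fcorner n E \<Longrightarrow> a \<in> corner n" by (simp add: fcorner_def)
    show "a \<in> fcorner n E \<Longrightarrow> b \<in> fcorner n E \<Longrightarrow> a + b \<in> fcorner n E"
      "a \<in> fcorner n E \<Longrightarrow> r *\<^sub>R a \<in> fcorner n E"
      by (auto simp: fcorner_def entry_simps E_add E_scaleR)
    show "a \<in> fcorner n J \<Longrightarrow> a \<in> fcorner n E" by (rule fcorner_mono) (auto simp: ker_on_def)
    show "a \<in> fcorner n J \<Longrightarrow> b \<in> fcorner n J \<Longrightarrow> a + b \<in> fcorner n J"
      "a \<in> fcorner n J \<Longrightarrow> r *\<^sub>R a \<in> fcorner n J"
      by (auto simp: fcorner_def entry_simps ker_on_def E_add E_scaleR theta_add theta_scaleR)
    show "a * b \<in> fcorner n J" if "a \<in> fcorner n E" "b \<in> fcorner n J"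
      by (rule mult_entries[OF that]) (auto simp: ker_on_def E_mult E_add theta_mult theta_add)
    show "a * b \<in> fcorner n J" if "a \<in> fcorner n J" "b \<in> fcorner n E"
      by (rule mult_entries[OF that]) (auto simp: ker_on_def E_mult E_add theta_mult theta_add)
    show "x \<in> Y \<eta> \<Longrightarrow> fdiag n x \<in> fcorner n J"
      by (auto simp: Y_def fcorner_def fdiag_corner fdiag.rep_eq)
    show "x \<in> Y \<eta> \<Longrightarrow> y \<in> Y \<eta> \<Longrightarrow> (1/2) *\<^sub>R (x + y) \<in> Y \<eta>"
    proof -
      assume "x \<in> Y \<eta>" "y \<in> Y \<eta>"
      then obtain c c' where c: "x \<in> J" "y \<in> J" "c \<in> B" "c' \<in> B" "norm (x - c) \<le> \<eta>" "norm (y - c') \<le> \<eta>"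
        by (auto simp: Y_def)
      have "(1/2) *\<^sub>R (x + y) - (1/2) *\<^sub>R (c + c') = (1/2) *\<^sub>R ((x - c) + (y - c'))" by (simp add: algebra_simps)
      then have "norm ((1/2) *\<^sub>R (x + y) - (1/2) *\<^sub>R (c + c')) \<le> \<eta>"
        using norm_triangle_ineq[of "x - c" "y - c'"] c by simp
      moreover have "(1/2) *\<^sub>R (c + c') \<in> B" using c by (intro B_scaleR B_add)
      moreover have "(1/2) *\<^sub>R (x + y) \<in> J" using c by (auto simp: ker_on_def E_add E_scaleR theta_add theta_scaleR)
      ultimately show ?thesis by (auto simp: Y_def)
    qed
    show "\<eta> \<le> \<eta>' \<Longrightarrow> x \<in> Y \<eta> \<Longrightarrow> x \<in> Y \<eta>'" by (force simp: Y_def)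
    fix S :: "'a fmat set"
    assume S: "finite S" "S \<subseteq> fcorner n J" and \<eta>: "0 < \<eta>"
    define S' where "S' = insert 0 ((\<lambda>(s, i, j). entry s i j) ` (S \<times> {..<n} \<times> {..<n}))"
    \<comment> \<open>Passing from entries to the matrix norm costs \<open>n\<^sup>2\<close>; the
      summand 1 covers \<open>n = 0\<close>.\<close>
    define \<epsilon> where "\<epsilon> = \<eta> / ((real n)\<^sup>2 + 1)"
    have "0 < (real n)\<^sup>2 + 1" by (simp add: add_nonneg_pos)
    then have \<epsilon>: "0 < \<epsilon>" "\<epsilon> \<le> \<eta>" "(real n)\<^sup>2 * \<epsilon> \<le> \<eta>" using \<eta> by (auto simp: \<epsilon>_def field_simps)
    have "finite S'" using S by (simp add: S'_def)
    moreover have "S' \<subseteq> J" using S by (auto simp: S'_def fcorner_def)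
    ultimately obtain x where x: "x \<in> J" "norm x \<le> 1" "\<exists>b\<in>B. norm (x - b) \<le> \<epsilon>"
      "\<And>s. s \<in> S' \<Longrightarrow> norm (x * s - s) \<le> \<epsilon>" "\<And>s. s \<in> S' \<Longrightarrow> norm (s * x - s) \<le> \<epsilon>"
      using units[OF _ _ \<epsilon>(1), of S'] by blast
    have "fnorm N n (fdiag n x * s - s) \<le> \<eta> \<and> fnorm N n (s * fdiag n x - s) \<le> \<eta>" if s: "s \<in> S" for s
    proof -
      have sC: "s \<in> corner n" using s S by (auto simp: fcorner_def)
      have ent: "entry s i j \<in> S'" for i j
      proof (cases "i < n \<and> j < n")
        case True
        then show ?thesis unfolding S'_def
          by (intro insertI2 image_eqI[of _ _ "(s, i, j)"]) (use s in auto)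
      next
        case False
        then have "entry s i j = 0" using sC unfolding corner_def by (auto simp: not_less)
        then show ?thesis by (simp add: S'_def)
      qed
      have "fdiag n x * s - s \<in> corner n" "s * fdiag n x - s \<in> corner n"
        using sC by (intro C_diff times_fmat_corner fdiag_corner; assumption)+
      moreover have "norm (entry (fdiag n x * s - s) i j) \<le> \<epsilon>" "norm (entry (s * fdiag n x - s) i j) \<le> \<epsilon>" for i j
        using x(4,5)[OF ent[of i j]] by (simp_all add: entry_simps entry_fdiag_times[OF sC] entry_times_fdiag[OF sC])
      ultimately have "fnorm N n (fdiag n x * s - s) \<le> (real n)\<^sup>2 * \<epsilon>" "fnorm N n (s * fdiag n x - s) \<le> (real n)\<^sup>2 * \<epsilon>"
        using fnorm_le_entries[OF N] by blast+
      then show ?thesis using \<epsilon> by simp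
    qed
    then show "\<exists>x\<in>Y \<eta>. norm x \<le> 1 \<and>
      (\<forall>s\<in>S. fnorm N n (fdiag n x * s - s) \<le> \<eta> \<and> fnorm N n (s * fdiag n x - s) \<le> \<eta>)"
      using x \<epsilon> by (intro bexI[of _ x]) (auto simp: Y_def intro: order_trans)
  qed
  obtain j where "j \<in> fcorner n J" "fnorm N n (b - j) < R" using qnorm_less[OF b(1,3)] by blast
  then obtain x where "x \<in> Y \<eta>" "norm x \<le> 1"
      "fnorm N n (b - (\<epsilon> / (R + \<epsilon>)) *\<^sub>R (fdiag n x * b)) \<le> R + \<delta>"
    using unit_perturbation[OF b(1,2) _ less_imp_le pos] by blast
  then show thesis by (intro that[of x]) (auto simp: Y_def)
qed

section \<open>Lifts of single elements and closedness of the image\<close>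

lemma norm_theta_le:
  assumes x: "x \<in> E" shows "norm (\<theta> x) \<le> norm x"
proof -
  have "mat 1 1 (\<lambda>_. x) \<in> mats 1 E" using x by (auto simp: mats_def elements_mat_def)
  then have "M 1 (map_mat \<theta> (mat 1 1 (\<lambda>_. x))) \<le> N 1 (mat 1 1 (\<lambda>_. x))" by (rule contr)
  moreover have "map_mat \<theta> (mat 1 1 (\<lambda>_. x)) = mat 1 1 (\<lambda>_. \<theta> x)" by (rule eq_matI) auto
  ultimately show ?thesis using N M by (simp add: cstar_matrix_norms_def)
qed

lemma fnorm_one: "fnorm N 1 (funit 0 0 x) = norm x"
proof -
  have "to_mat 1 (funit 0 0 x) = mat 1 1 (\<lambda>_. x)" by (rule eq_matI) (auto simp: to_mat_def funit.rep_eq)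
  then show ?thesis using N by (simp add: fnorm_def cstar_matrix_norms_def)
qed

lemma qnorm_one: "qnorm 1 (funit 0 0 x) = norm (\<theta> x)"
proof -
  have "map_mat \<theta> (to_mat 1 (funit 0 0 x)) = mat 1 1 (\<lambda>_. \<theta> x)"
    by (rule eq_matI) (auto simp: to_mat_def funit.rep_eq)
  then show ?thesis using M by (simp add: qnorm_def cstar_matrix_norms_def)
qed

text \<open>The unit \<open>x\<close> of the perturbation is replaced by a nearby \<open>c\<close>
  in \<open>B\<close>, so the result stays over \<open>B\<close>. Since
  \<open>\<theta> x = 0\<close>, the image changes only by a multiple of
  \<open>\<theta> ((c - x) b)\<close>, which is small but in general not zero.\<close>

lemma approximate_lift:
  assumes b: "b \<in> fcorner n B" "fnorm N n b \<le> R + \<epsilon>" "qnorm n b < R"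
    and pos: "0 < R" "0 \<le> \<epsilon>" "0 < \<delta>" "0 < \<eta>" "\<eta> \<le> 1"
  obtains b' where "b' \<in> fcorner n B" "fnorm N n b' \<le> R + \<delta>"
    "\<And>i j. norm (entry b' i j - entry b i j) \<le> 2 * (\<epsilon> / (R + \<epsilon>)) * norm (entry b i j)"
    "\<And>i j. norm (\<theta> (entry b i j - entry b' i j)) \<le> \<eta> * norm (entry b i j)"
proof -
  interpret cstar_normed "corner n" "fnorm N n" fstar fim by (rule cstar_normed_corner[OF N])
  have bE: "b \<in> fcorner n E" and bC: "b \<in> corner n" using b BE by (auto simp: fcorner_def)
  have dn: "fnorm N n (fdiag n x) \<le> norm x" for x
    by (rule star_hom_contractive)
      (auto intro!: fdiag_corner fmat_eqI simp: fdiag.rep_eq entry_simps fstar.rep_eq entry_fdiag_times[OF fdiag_corner])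
  define \<mu> where "\<mu> = \<epsilon> / (R + \<epsilon>)"
  have \<mu>: "0 \<le> \<mu>" "\<mu> \<le> 1" using pos by (auto simp: \<mu>_def divide_simps)
  \<comment> \<open>Replacing \<open>x\<close> by \<open>c\<close> costs at most
    \<open>\<gamma> * (R + \<epsilon>)\<close> in norm, which is to be at most
    \<open>\<delta> / 2\<close>.\<close>
  define \<gamma> where "\<gamma> = min \<eta> (\<delta> / 2 / (R + \<epsilon>))"
  have \<gamma>: "0 < \<gamma>" "\<gamma> \<le> \<eta>" "\<gamma> \<le> 1" using pos by (auto simp: \<gamma>_def)
  have "\<gamma> \<le> \<delta> / 2 / (R + \<epsilon>)" by (simp add: \<gamma>_def)
  then have \<gamma>R: "\<gamma> * (R + \<epsilon>) \<le> \<delta> / 2" using pos by (simp add: field_simps)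
  have \<delta>2: "0 < \<delta> / 2" using pos by simp
  obtain x where x: "x \<in> J" "norm x \<le> 1" "\<exists>c\<in>B. norm (x - c) \<le> \<gamma>"
    "fnorm N n (b - \<mu> *\<^sub>R (fdiag n x * b)) \<le> R + \<delta> / 2"
    unfolding \<mu>_def using unit_perturbation_corner[OF bE b(2,3) pos(1,2) \<delta>2 \<gamma>(1)] by blast
  then obtain c where c: "c \<in> B" "norm (x - c) \<le> \<gamma>" by blast
  have xE: "x \<in> E" "\<theta> x = 0" using x by (auto simp: ker_on_def)
  define b' where "b' = b - \<mu> *\<^sub>R (fdiag n c * b)"
  have ent: "entry b' i j = entry b i j - \<mu> *\<^sub>R (c * entry b i j)" for i j
    by (simp add: b'_def entry_simps entry_fdiag_times[OF bC])
  have bB: "entry b i j \<in> B" for i j using b by (simp add: fcorner_def)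
  have b'C: "b' \<in> corner n" using bC by (auto simp: b'_def fdiag_corner)
  show thesis
  proof (rule that[of b'])
    show "b' \<in> fcorner n B"
      using b'C bB c by (auto simp: fcorner_def ent intro!: B_diff B_scaleR B_mult)
    have "fnorm N n (fdiag n (x - c) * b) \<le> \<gamma> * (R + \<epsilon>)"
      using dn[of "x - c"] c b bC by (intro nu_mult_le) (auto intro: fdiag_corner)
    then have "\<mu> * fnorm N n (fdiag n (x - c) * b) \<le> 1 * (\<gamma> * (R + \<epsilon>))"
      using \<mu> bC by (intro mult_mono[of \<mu> 1]) (auto simp: fdiag_corner)
    then have "fnorm N n (\<mu> *\<^sub>R (fdiag n (x - c) * b)) \<le> 1 * (\<gamma> * (R + \<epsilon>))"
      using \<mu> bC by (simp add: nu_scaleR fdiag_corner)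
    then have "fnorm N n ((b - \<mu> *\<^sub>R (fdiag n x * b)) + \<mu> *\<^sub>R (fdiag n (x - c) * b)) \<le> (R + \<delta> / 2) + \<delta> / 2"
      using x(4) \<gamma>R bC by (intro nu_triangle_le) (auto simp: fdiag_corner)
    moreover have "b' = (b - \<mu> *\<^sub>R (fdiag n x * b)) + \<mu> *\<^sub>R (fdiag n (x - c) * b)"
      by (rule fmat_eqI) (simp add: ent entry_simps entry_fdiag_times[OF bC] algebra_simps)
    ultimately show "fnorm N n b' \<le> R + \<delta>" by simp
  next
    fix i j
    have "norm c \<le> 2" using norm_triangle_ineq4[of x "x - c"] x c \<gamma> by simp
    then have "norm (c * entry b i j) \<le> 2 * norm (entry b i j)"
      by (intro order_trans[OF norm_mult_ineq] mult_right_mono) auto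
    then have "\<mu> * norm (c * entry b i j) \<le> \<mu> * (2 * norm (entry b i j))"
      using \<mu>(1) by (rule mult_left_mono)
    then show "norm (entry b' i j - entry b i j) \<le> 2 * (\<epsilon> / (R + \<epsilon>)) * norm (entry b i j)"
      using \<mu> by (simp add: ent \<mu>_def[symmetric] mult_ac)
    have bi: "entry b i j \<in> E" using bB B_E by blast
    have "\<theta> (entry b i j - entry b' i j) = \<mu> *\<^sub>R \<theta> (c * entry b i j)"
      using c bi B_E by (simp add: ent theta_scaleR E_mult)
    also have "\<theta> (c * entry b i j) = \<theta> ((c - x) * entry b i j)"
      using c bi xE B_E by (simp add: theta_mult theta_diff E_diff)
    finally have "norm (\<theta> (entry b i j - entry b' i j)) = \<mu> * norm (\<theta> ((c - x) * entry b i j))"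
      using \<mu> by simp
    also have "\<dots> \<le> 1 * norm ((c - x) * entry b i j)"
      using \<mu> c xE bi B_E by (intro mult_mono norm_theta_le E_mult E_diff) auto
    also have "\<dots> \<le> \<eta> * norm (entry b i j)"
      using c \<gamma> norm_mult_ineq[of "c - x" "entry b i j"] mult_right_mono[of "norm (c - x)" \<eta> "norm (entry b i j)"]
      by (simp add: norm_minus_commute)
    finally show "norm (\<theta> (entry b i j - entry b' i j)) \<le> \<eta> * norm (entry b i j)" .
  qed
qed

lemma suminf_in_B:
  assumes g: "\<And>k. g k \<in> B" and s: "summable (\<lambda>k. norm (g k))"
  shows "suminf g \<in> B" "(\<lambda>k. \<theta> (g k)) sums \<theta> (suminf g)"
proof -
  have sg: "g sums suminf g" using summable_norm_cancel[OF s] by (rule summable_sums)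
  have part: "(\<Sum>k<n. g k) \<in> B \<and> \<theta> (\<Sum>k<n. g k) = (\<Sum>k<n. \<theta> (g k))" for n
    by (induction n) (auto simp: g B_add theta_add B_E)
  show SB: "suminf g \<in> B"
    by (rule closed_sequentially[OF B_closed]) (use part sg in \<open>auto simp: sums_def\<close>)
  have lim: "(\<lambda>n. norm ((\<Sum>k<n. g k) - suminf g)) \<longlonglongrightarrow> 0"
    using sg unfolding sums_def by (simp add: LIM_zero tendsto_norm_zero)
  have le: "norm ((\<Sum>k<n. \<theta> (g k)) - \<theta> (suminf g)) \<le> norm ((\<Sum>k<n. g k) - suminf g)" for n
    using norm_theta_le[of "(\<Sum>k<n. g k) - suminf g"] part[of n] SB by (simp add: theta_diff E_diff B_E)
  have "(\<lambda>n. (\<Sum>k<n. \<theta> (g k)) - \<theta> (suminf g)) \<longlonglongrightarrow> 0"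
    by (rule Lim_null_comparison[OF always_eventually[OF allI] lim]) (rule le)
  then show "(\<lambda>k. \<theta> (g k)) sums \<theta> (suminf g)" unfolding sums_def by (rule LIM_zero_cancel)
qed

text \<open>Successive approximation: each round lifts with constant 3/2 up to a quarter of the
  image's norm, so the sum of the partial lifts has constant
  \<open>3/2 / (1 - 1/4) = 2\<close>.\<close>

lemma bounded_lift:
  assumes b: "b \<in> B"
  obtains c where "c \<in> B" "\<theta> c = \<theta> b" "norm c \<le> 2 * norm (\<theta> b)"
proof -
  have "\<exists>c\<in>B. norm c \<le> 3/2 * norm (\<theta> b) \<and> norm (\<theta> (b - c)) \<le> norm (\<theta> b) / 4" if b: "b \<in> B" for b
  proof (cases "\<theta> b = 0")
    case True
    then show ?thesis by (intro bexI[of _ 0]) auto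
  next
    case False
    define r where "r = norm (\<theta> b)"
    have r: "0 < r" "r \<le> norm b" using False norm_theta_le[OF B_E[OF b]] by (auto simp: r_def)
    \<comment> \<open>Chosen so that the error in the image is \<open>r / 4\<close>. The lift is
      then taken with \<open>R = 5/4 * r\<close>, as \<open>R\<close> must exceed the quotient norm
      strictly, with \<open>\<delta> = r / 4\<close>, and with \<open>\<epsilon> = norm b\<close>,
      since the size of the move is irrelevant here.\<close>
    define \<eta> where "\<eta> = r / (4 * norm b)"
    have \<eta>: "0 < \<eta>" "\<eta> \<le> 1" "\<eta> * norm b = r / 4" using r by (auto simp: \<eta>_def divide_simps)
    have 1: "funit 0 0 b \<in> fcorner 1 B" using b by (auto simp: fcorner_def funit_corner funit.rep_eq)
    have 2: "fnorm N 1 (funit 0 0 b) \<le> 5/4 * r + norm b" "qnorm 1 (funit 0 0 b) < 5/4 * r"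
      using r unfolding fnorm_one qnorm_one by (simp_all add: r_def)
    have pos: "0 < 5/4 * r" "0 \<le> norm b" "0 < r / 4" using r by auto
    obtain b' where b': "b' \<in> fcorner 1 B" "fnorm N 1 b' \<le> 5/4 * r + r / 4"
      "\<And>i j. norm (entry b' i j - entry (funit 0 0 b) i j) \<le> 2 * (norm b / (5/4 * r + norm b)) * norm (entry (funit 0 0 b) i j)"
      "\<And>i j. norm (\<theta> (entry (funit 0 0 b) i j - entry b' i j)) \<le> \<eta> * norm (entry (funit 0 0 b) i j)"
      by (fact approximate_lift[OF 1 2 pos \<eta>(1,2)])
    have "b' = funit 0 0 (entry b' 0 0)"
      using b' by (auto intro!: fmat_eqI simp: fcorner_def corner_def funit.rep_eq Suc_le_eq)
    then have "norm (entry b' 0 0) = fnorm N 1 b'" using fnorm_one by metis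
    then have "norm (entry b' 0 0) \<le> 3/2 * r" using b'(2) by simp
    moreover have "norm (\<theta> (b - entry b' 0 0)) \<le> r / 4" using b'(4)[of 0 0] \<eta> by (simp add: funit.rep_eq)
    moreover have "entry b' 0 0 \<in> B" using b' by (simp add: fcorner_def)
    ultimately show ?thesis unfolding r_def by blast
  qed
  then obtain f where f: "\<And>b. b \<in> B \<Longrightarrow> f b \<in> B" "\<And>b. b \<in> B \<Longrightarrow> norm (f b) \<le> 3/2 * norm (\<theta> b)"
    "\<And>b. b \<in> B \<Longrightarrow> norm (\<theta> (b - f b)) \<le> norm (\<theta> b) / 4" by metis
  \<comment> \<open>The part still to be lifted after \<open>k\<close> rounds; the images of the
    summands \<open>g k\<close> telescope to \<open>\<theta> b - \<theta> (c n)\<close>.\<close>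
  define c where "c k = ((\<lambda>x. x - f x) ^^ k) b" for k
  have c: "c 0 = b" "c (Suc k) = c k - f (c k)" for k by (simp_all add: c_def)
  have cB: "c k \<in> B" for k by (induction k) (auto simp: c b f B_diff)
  have ct: "norm (\<theta> (c k)) \<le> norm (\<theta> b) * (1/4) ^ k" for k
  proof (induction k)
    case (Suc k)
    then show ?case using f(3)[OF cB[of k]] by (simp add: c)
  qed (simp add: c)
  define g where "g k = f (c k)" for k
  have gB: "g k \<in> B" for k by (simp add: g_def f cB)
  have gn: "norm (g k) \<le> 3/2 * norm (\<theta> b) * (1/4) ^ k" for k
    using f(2)[OF cB[of k]] ct[of k] by (simp add: g_def)
  have geo: "(\<lambda>k. 3/2 * norm (\<theta> b) * (1/4) ^ k) sums (3/2 * norm (\<theta> b) * (1 / (1 - 1/4)))"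
    by (intro sums_mult geometric_sums) simp
  have sn: "summable (\<lambda>k. norm (g k))"
    by (rule summable_comparison_test[OF _ sums_summable[OF geo]]) (use gn in auto)
  have "norm (suminf g) \<le> (\<Sum>k. norm (g k))" by (rule summable_norm[OF sn])
  also have "\<dots> \<le> (\<Sum>k. 3/2 * norm (\<theta> b) * (1/4) ^ k)"
    by (rule suminf_le[OF gn sn sums_summable[OF geo]])
  also have "\<dots> = 2 * norm (\<theta> b)" using sums_unique[OF geo] by simp
  finally have n2: "norm (suminf g) \<le> 2 * norm (\<theta> b)" .
  have "(\<Sum>k<n. \<theta> (g k)) = \<theta> b - \<theta> (c n)" for n
    by (induction n) (auto simp: c g_def theta_diff B_E cB f)
  moreover have "(\<lambda>n. \<theta> (c n)) \<longlonglongrightarrow> 0"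
  proof (rule Lim_null_comparison)
    show "\<forall>\<^sub>F n in sequentially. norm (\<theta> (c n)) \<le> norm (\<theta> b) * (1/4) ^ n" using ct by simp
    show "(\<lambda>n. norm (\<theta> b) * (1/4) ^ n) \<longlonglongrightarrow> 0"
      by (intro tendsto_mult_right_zero LIMSEQ_power_zero) simp
  qed
  then have "(\<lambda>n. \<theta> b - \<theta> (c n)) \<longlonglongrightarrow> \<theta> b - 0" by (intro tendsto_intros)
  ultimately have "(\<lambda>k. \<theta> (g k)) sums \<theta> b" by (simp add: sums_def)
  then have "\<theta> (suminf g) = \<theta> b" using suminf_in_B(2)[OF gB sn] sums_unique2 by blast
  then show thesis using suminf_in_B(1)[OF gB sn] n2 by (intro that)
qed

text \<open>The usual completeness argument: a sequence in the image converging geometrically fast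
  has differences that \<open>bounded_lift\<close> lifts to an absolutely convergent series in
  \<open>B\<close>.\<close>

lemma closed_image: "closed (\<theta> ` B)"
  unfolding closed_sequential_limits
proof (intro allI impI)
  fix y l assume "(\<forall>n. y n \<in> \<theta> ` B) \<and> y \<longlonglongrightarrow> l"
  then have cl: "l \<in> closure (\<theta> ` B)" by (auto simp: closure_sequential)
  have "\<exists>b\<in>B. norm (\<theta> b - l) < (1/2) ^ k" for k
    using cl[unfolded closure_approachable, rule_format, of "(1/2) ^ k"] by (auto simp: dist_norm)
  then obtain b where b: "\<And>k. b k \<in> B" "\<And>k. norm (\<theta> (b k) - l) < (1/2) ^ k" by metis
  have "\<exists>c\<in>B. \<theta> c = \<theta> (b (Suc k) - b k) \<and> norm c \<le> 4 * (1/2) ^ k" for k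
  proof -
    have "b (Suc k) - b k \<in> B" using b by (simp add: B_diff)
    then obtain c where c: "c \<in> B" "\<theta> c = \<theta> (b (Suc k) - b k)" "norm c \<le> 2 * norm (\<theta> (b (Suc k) - b k))"
      using bounded_lift by blast
    have "norm (\<theta> (b (Suc k) - b k)) = norm ((\<theta> (b (Suc k)) - l) - (\<theta> (b k) - l))"
      using b by (simp add: theta_diff B_E)
    also have "\<dots> \<le> (1/2) ^ Suc k + (1/2) ^ k"
      using b(2)[of k] b(2)[of "Suc k"] by (intro order_trans[OF norm_triangle_ineq4]) simp
    also have "\<dots> \<le> 2 * (1/2) ^ k" by simp
    finally show ?thesis using c by (intro bexI[of _ c]) auto
  qed
  then obtain c where c: "\<And>k. c k \<in> B" "\<And>k. \<theta> (c k) = \<theta> (b (Suc k) - b k)"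
    "\<And>k. norm (c k) \<le> 4 * (1/2) ^ k" by metis
  have sn: "summable (\<lambda>k. norm (c k))"
    by (rule summable_comparison_test[of _ "\<lambda>k. 4 * (1/2) ^ k"]) (use c in \<open>auto intro!: summable_mult\<close>)
  have "(\<Sum>k<n. \<theta> (c k)) = \<theta> (b n) - \<theta> (b 0)" for n
    by (induction n) (auto simp: c b theta_diff B_E)
  then have 1: "(\<lambda>n. \<theta> (b n) - \<theta> (b 0)) \<longlonglongrightarrow> \<theta> (suminf c)"
    using suminf_in_B(2)[OF c(1) sn] by (simp add: sums_def)
  have "(\<lambda>n. \<theta> (b n) - l) \<longlonglongrightarrow> 0"
  proof (rule Lim_null_comparison)
    show "\<forall>\<^sub>F n in sequentially. norm (\<theta> (b n) - l) \<le> (1/2) ^ n" using b by (simp add: less_imp_le)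
  qed (intro LIMSEQ_power_zero, simp)
  then have "(\<lambda>n. \<theta> (b n) - \<theta> (b 0)) \<longlonglongrightarrow> l - \<theta> (b 0)"
    by (intro tendsto_intros) (rule LIM_zero_cancel)
  with 1 have "l - \<theta> (b 0) = \<theta> (suminf c)" by (rule LIMSEQ_unique[rotated])
  then have "l = \<theta> (suminf c + b 0)"
    using suminf_in_B(1)[OF c(1) sn] b by (simp add: theta_add B_E algebra_simps)
  then show "l \<in> \<theta> ` B" using suminf_in_B(1)[OF c(1) sn] b by (auto intro: B_add)
qed

end

section \<open>Lifts of matrices that attain the norm\<close>

lemma mats_mono: "X \<subseteq> X' \<Longrightarrow> A \<in> mats n X \<Longrightarrow> A \<in> mats n X'"
  by (auto simp: mats_def)

lemma map_mat_mats: "A \<in> mats n X \<Longrightarrow> map_mat f A \<in> mats n (f ` X)"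
  by (fastforce simp: mats_def dest!: elements_matD intro!: elements_matI)

lemma mats_image:
  assumes "D \<in> mats n (f ` X)" obtains A where "A \<in> mats n X" "map_mat f A = D"
proof -
  have D: "D \<in> carrier_mat n n" "D $$ (i, j) \<in> f ` X" if "i < n" "j < n" for i j
    using assms elements_matI[of D n n i j, OF _ that refl] by (auto simp: mats_def)
  have DC: "D \<in> carrier_mat n n" using assms by (simp add: mats_def)
  define A where "A = map_mat (inv_into X f) D"
  have "A \<in> mats n X"
    using D DC by (auto simp: mats_def A_def dest!: elements_matD intro!: inv_into_into)
  moreover have "map_mat f A = D"
    using D DC by (intro eq_matI) (auto simp: A_def f_inv_into_f)
  ultimately show thesis by (rule that)
qed

context cai_quotient
begin

text \<open>\<open>approximate_lift\<close> lowers the norm but disturbs the image;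
  \<open>bounded_lift\<close> repairs each entry by an element of \<open>B\<close> as small as the
  disturbance. Of the displacement \<open>3 \<epsilon>\<close>, the perturbation uses
  \<open>2 \<epsilon>\<close> and the repair \<open>\<epsilon>\<close>.\<close>

lemma improve_lift:
  assumes b: "b \<in> fcorner n B" "qnorm n b \<le> 1" "fnorm N n b \<le> 1 + \<epsilon>" and pos: "0 < \<epsilon>" "0 < \<tau>"
  obtains b' where "b' \<in> fcorner n B" "\<forall>i j. \<theta> (entry b' i j) = \<theta> (entry b i j)" "fnorm N n b' \<le> 1 + \<tau>"
    "\<forall>i j. norm (entry b' i j - entry b i j) \<le> 3 * \<epsilon> * norm (entry b i j)"
proof -
  interpret cstar_normed "corner n" "fnorm N n" fstar fim by (rule cstar_normed_corner[OF N])
  have bC: "b \<in> corner n" and bB: "entry b i j \<in> B" for i j using b by (auto simp: fcorner_def)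
  define K where "K = (\<Sum>i<n. \<Sum>j<n. norm (entry b i j))"
  have K0: "0 \<le> K" by (simp add: K_def sum_nonneg)
  have K: "norm (entry b i j) \<le> K" for i j
  proof (cases "i < n \<and> j < n")
    case True
    have "norm (entry b i j) \<le> (\<Sum>j<n. norm (entry b i j))"
      using True by (intro member_le_sum) auto
    also have "\<dots> \<le> K" unfolding K_def
      using True by (intro member_le_sum[of i _ "\<lambda>i. \<Sum>j<n. norm (entry b i j)"]) (auto intro: sum_nonneg)
    finally show ?thesis .
  next
    case False
    then have "entry b i j = 0" using bC by (auto simp: corner_def not_less)
    then show ?thesis using K0 by simp
  qed
  \<comment> \<open>A correction with entries at most \<open>2 * \<eta> * K\<close> has matrix norm
    at most \<open>\<eta> * (P - 1)\<close>; the summand 1 keeps \<open>P\<close> away from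
    0.\<close>
  define P where "P = (real n)\<^sup>2 * (2 * K) + 1"
  have P: "1 \<le> P" using K0 by (simp add: P_def)
  define \<eta> where "\<eta> = min 1 (min (\<epsilon> / 2) (\<tau> / 2 / P))"
  have \<eta>: "0 < \<eta>" "\<eta> \<le> 1" "\<eta> \<le> \<epsilon> / 2" "\<eta> \<le> \<tau> / 2 / P" using pos P by (auto simp: \<eta>_def)
  have \<eta>P: "\<eta> * P \<le> \<tau> / 2" using \<eta>(4) P by (simp add: field_simps)
  \<comment> \<open>The quotient norm must be strictly below \<open>R\<close>, which uses a quarter
    of \<open>\<tau>\<close>; a second quarter is the tolerance of the lift, and half is left for
    the correction \<open>k\<close>.\<close>
  define R where "R = 1 + \<tau> / 4"
  have R: "1 \<le> R" "0 < R" "0 \<le> \<epsilon>" "0 < \<tau> / 4" using pos by (auto simp: R_def)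
  have bR: "fnorm N n b \<le> R + \<epsilon>" "qnorm n b < R" using b pos by (auto simp: R_def)
  obtain b'' where b'': "b'' \<in> fcorner n B" "fnorm N n b'' \<le> R + \<tau> / 4"
    "\<And>i j. norm (entry b'' i j - entry b i j) \<le> 2 * (\<epsilon> / (R + \<epsilon>)) * norm (entry b i j)"
    "\<And>i j. norm (\<theta> (entry b i j - entry b'' i j)) \<le> \<eta> * norm (entry b i j)"
    by (fact approximate_lift[OF b(1) bR R(2-4) \<eta>(1,2)])
  have bB'': "entry b'' i j \<in> B" and bC'': "b'' \<in> corner n" for i j using b'' by (auto simp: fcorner_def)
  have "\<forall>x\<in>B. \<exists>c. c \<in> B \<and> \<theta> c = \<theta> x \<and> norm c \<le> 2 * norm (\<theta> x)"
    using bounded_lift by metis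
  then obtain \<kappa> where \<kappa>: "\<forall>x\<in>B. \<kappa> x \<in> B \<and> \<theta> (\<kappa> x) = \<theta> x \<and> norm (\<kappa> x) \<le> 2 * norm (\<theta> x)"
    by (rule bchoice[THEN exE])
  define k where "k = of_mat n (mat n n (\<lambda>(i, j). \<kappa> (entry b i j - entry b'' i j)))"
  have dB: "entry b i j - entry b'' i j \<in> B" for i j by (intro B_diff bB bB'')
  have kC: "k \<in> corner n" by (simp add: k_def of_mat_corner)
  have k: "entry k i j \<in> B \<and> \<theta> (entry k i j) = \<theta> (entry b i j - entry b'' i j) \<and>
      norm (entry k i j) \<le> 2 * (\<eta> * norm (entry b i j))" for i j
  proof (cases "i < n \<and> j < n")
    case True
    then have "entry k i j = \<kappa> (entry b i j - entry b'' i j)" by (simp add: k_def of_mat.rep_eq)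
    moreover have "2 * norm (\<theta> (entry b i j - entry b'' i j)) \<le> 2 * (\<eta> * norm (entry b i j))"
      using b''(4)[of i j] by simp
    ultimately show ?thesis using \<kappa>[rule_format, OF dB[of i j]] by (metis order_trans)
  next
    case False
    then have "entry k i j = 0" "entry b i j = 0" "entry b'' i j = 0"
      using kC bC bC'' by (auto simp: corner_def not_less)
    then show ?thesis by simp
  qed
  have kn: "fnorm N n k \<le> \<tau> / 2"
  proof -
    have "norm (entry k i j) \<le> 2 * (\<eta> * K)" for i j
      using k[of i j] mult_left_mono[OF K[of i j], of \<eta>] \<eta> by linarith
    then have "fnorm N n k \<le> (real n)\<^sup>2 * (2 * (\<eta> * K))" by (rule fnorm_le_entries[OF N kC])
    also have "\<dots> = \<eta> * P - \<eta>" by (simp add: P_def algebra_simps)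
    finally show ?thesis using \<eta>P \<eta> by linarith
  qed
  show thesis
  proof (rule that[of "b'' + k"])
    show "b'' + k \<in> fcorner n B"
      using bC'' kC bB'' k by (auto simp: fcorner_def entry_simps B_add)
    show "\<forall>i j. \<theta> (entry (b'' + k) i j) = \<theta> (entry b i j)"
      using bB'' bB k by (simp add: entry_simps theta_add theta_diff B_E)
    have "fnorm N n (b'' + k) \<le> (R + \<tau> / 4) + \<tau> / 2"
      using bC'' kC b''(2) kn by (rule nu_triangle_le)
    then show "fnorm N n (b'' + k) \<le> 1 + \<tau>" by (simp add: R_def)
    show "\<forall>i j. norm (entry (b'' + k) i j - entry b i j) \<le> 3 * \<epsilon> * norm (entry b i j)"
    proof (intro allI)
      fix i j
      have "\<epsilon> / (R + \<epsilon>) \<le> \<epsilon> / 1" using R pos by (intro divide_left_mono) auto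
      then have "2 * (\<epsilon> / (R + \<epsilon>)) * norm (entry b i j) \<le> 2 * \<epsilon> * norm (entry b i j)"
        by (intro mult_right_mono) auto
      with b''(3)[of i j] have "norm (entry b'' i j - entry b i j) \<le> 2 * \<epsilon> * norm (entry b i j)" by (rule order_trans)
      moreover have "2 * (\<eta> * norm (entry b i j)) \<le> \<epsilon> * norm (entry b i j)"
        using mult_right_mono[of "2 * \<eta>" \<epsilon> "norm (entry b i j)"] \<eta> by simp
      then have "norm (entry k i j) \<le> \<epsilon> * norm (entry b i j)" using k[of i j] by linarith
      ultimately have "norm ((entry b'' i j - entry b i j) + entry k i j) \<le>
          2 * \<epsilon> * norm (entry b i j) + \<epsilon> * norm (entry b i j)"
        by (intro order_trans[OF norm_triangle_ineq] add_mono)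
      then show "norm (entry (b'' + k) i j - entry b i j) \<le> 3 * \<epsilon> * norm (entry b i j)"
        by (simp add: entry_simps algebra_simps)
    qed
  qed
qed

text \<open>By \<open>fnorm_le_entries\<close> entrywise convergence is convergence in the matrix
  norm.\<close>

lemma fnorm_limit_le:
  assumes a: "\<And>k. a k \<in> corner n" and lim: "\<And>i j. (\<lambda>k. entry (a k) i j) \<longlonglongrightarrow> entry L i j"
    and L: "L \<in> corner n" and le: "\<And>k. fnorm N n (a k) \<le> u k" and u: "u \<longlonglongrightarrow> c"
  shows "fnorm N n L \<le> c"
proof (rule LIMSEQ_le_const)
  interpret cstar_normed "corner n" "fnorm N n" fstar fim by (rule cstar_normed_corner[OF N])
  define e where "e k = (\<Sum>i<n. \<Sum>j<n. norm (entry L i j - entry (a k) i j))" for k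
  have "(\<lambda>k. norm (entry L i j - entry (a k) i j)) \<longlonglongrightarrow> norm (entry L i j - entry L i j)" for i j
    by (intro tendsto_intros lim)
  then have "e \<longlonglongrightarrow> (\<Sum>i<n. \<Sum>j<n. 0)" unfolding e_def by (intro tendsto_sum) simp
  then have "(\<lambda>k. u k + (real n)\<^sup>2 * e k) \<longlonglongrightarrow> c + (real n)\<^sup>2 * 0"
    by (intro tendsto_intros u) simp
  then show "(\<lambda>k. u k + (real n)\<^sup>2 * e k) \<longlonglongrightarrow> c" by simp
  have "fnorm N n L \<le> u k + (real n)\<^sup>2 * e k" for k
  proof -
    have eb: "norm (entry (L - a k) i j) \<le> e k" for i j
    proof (cases "i < n \<and> j < n")
      case True
      have "norm (entry L i j - entry (a k) i j) \<le> (\<Sum>j<n. norm (entry L i j - entry (a k) i j))"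
        using True by (intro member_le_sum[of j _ "\<lambda>j. norm (entry L i j - entry (a k) i j)"]) auto
      also have "\<dots> \<le> e k" unfolding e_def
        using True by (intro member_le_sum[of i _ "\<lambda>i. \<Sum>j<n. norm (entry L i j - entry (a k) i j)"])
          (auto intro: sum_nonneg)
      finally show ?thesis by (simp add: entry_simps)
    next
      case False
      then have "entry L i j = 0" "entry (a k) i j = 0" using L a[of k] by (auto simp: corner_def not_less)
      then show ?thesis by (simp add: entry_simps e_def sum_nonneg)
    qed
    have "L - a k \<in> corner n" using L a by (rule C_diff)
    then have "fnorm N n (L - a k) \<le> (real n)\<^sup>2 * e k" using eb by (rule fnorm_le_entries[OF N])
    then have "fnorm N n (a k + (L - a k)) \<le> u k + (real n)\<^sup>2 * e k"
      using \<open>L - a k \<in> corner n\<close> a le by (intro nu_triangle_le)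
    then show ?thesis by simp
  qed
  then show "\<exists>m. \<forall>k\<ge>m. fnorm N n L \<le> u k + (real n)\<^sup>2 * e k" by blast
qed

text \<open>The image stays exactly the same throughout the iteration of
  \<open>improve_lift\<close>, while the excess over norm 1 tends to 0 along a summable sequence
  that also controls the moves; so the entrywise limit is a lift of norm at most 1.\<close>

lemma attained_lift:
  assumes b: "b \<in> fcorner n B" "qnorm n b \<le> 1"
  obtains b' where "b' \<in> fcorner n B" "\<forall>i j. \<theta> (entry b' i j) = \<theta> (entry b i j)" "fnorm N n b' \<le> 1"
proof -
  interpret cstar_normed "corner n" "fnorm N n" fstar fim by (rule cstar_normed_corner[OF N])
  \<comment> \<open>With the factor 1/12 the relative move \<open>3 * \<epsilon> k\<close> is a
    quarter of \<open>(1/2) ^ k\<close>, small enough for the entries to stay below twice their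
    initial size.\<close>
  define \<epsilon> :: "nat \<Rightarrow> real" where "\<epsilon> k = (1/2) ^ k / 12" for k
  have \<epsilon>: "0 < \<epsilon> k" for k by (simp add: \<epsilon>_def)
  define P where "P k a \<longleftrightarrow> a \<in> fcorner n B \<and> (\<forall>i j. \<theta> (entry a i j) = \<theta> (entry b i j)) \<and> fnorm N n a \<le> 1 + \<epsilon> k"
    for k a
  define Q where "Q k a a' \<longleftrightarrow> (\<forall>i j. norm (entry a' i j - entry a i j) \<le> 3 * \<epsilon> k * norm (entry a i j))"
    for k :: nat and a a' :: "'a fmat"
  have "\<exists>a. \<forall>k. P k (a k) \<and> Q k (a k) (a (Suc k))"
  proof (rule dependent_nat_choice)
    \<comment> \<open>Every matrix meets the norm hypothesis of \<open>improve_lift\<close> for some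
      large \<open>\<epsilon>\<close>, so one application provides the start; the size of this first
      move does not matter.\<close>
    have "0 < fnorm N n b + 1" using b nu_nonneg[of b] by (simp add: fcorner_def add_nonneg_pos)
    moreover have "fnorm N n b \<le> 1 + (fnorm N n b + 1)" by simp
    ultimately show "\<exists>a. P 0 a"
      using improve_lift[OF b _ _ \<epsilon>[of 0], of "fnorm N n b + 1"] unfolding P_def by metis
  next
    fix a k assume a: "P k a"
    then have "qnorm n a = qnorm n b" by (intro qnorm_cong) (simp add: P_def)
    then obtain a' where "a' \<in> fcorner n B" "\<forall>i j. \<theta> (entry a' i j) = \<theta> (entry a i j)"
      "fnorm N n a' \<le> 1 + \<epsilon> (Suc k)"
      "\<forall>i j. norm (entry a' i j - entry a i j) \<le> 3 * \<epsilon> k * norm (entry a i j)"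
      using improve_lift[of a n "\<epsilon> k" "\<epsilon> (Suc k)"] a b \<epsilon> unfolding P_def by metis
    then show "\<exists>a'. P (Suc k) a' \<and> Q k a a'" using a by (auto simp: P_def Q_def)
  qed
  then obtain a where a: "\<And>k. P k (a k)" "\<And>k. Q k (a k) (a (Suc k))" by blast
  have aB: "entry (a k) i j \<in> B" and aC: "a k \<in> corner n"
    and at: "\<theta> (entry (a k) i j) = \<theta> (entry b i j)" and an: "fnorm N n (a k) \<le> 1 + \<epsilon> k" for k i j
    using a(1)[of k] by (auto simp: P_def fcorner_def)
  \<comment> \<open>The factor \<open>2 - (1/2) ^ k\<close> closes the induction: with
    \<open>t = (1/2) ^ k\<close>, \<open>(1 + t/4) * (2 - t)\<close> is below
    \<open>2 - t/2\<close>.\<close>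
  have bound: "norm (entry (a k) i j) \<le> norm (entry (a 0) i j) * (2 - (1/2) ^ k)" for k i j
  proof (induction k)
    case (Suc k)
    define t :: real where "t = (1/2) ^ k"
    have t: "0 < t" "t \<le> 1" by (simp_all add: t_def power_le_one)
    have "norm (entry (a (Suc k)) i j - entry (a k) i j) \<le> 3 * \<epsilon> k * norm (entry (a k) i j)"
      using a(2)[of k] by (simp add: Q_def)
    then have "norm (entry (a (Suc k)) i j) \<le> (1 + t / 4) * norm (entry (a k) i j)"
      using norm_triangle_sub[of "entry (a (Suc k)) i j" "entry (a k) i j"] by (simp add: \<epsilon>_def t_def algebra_simps)
    also have "\<dots> \<le> (1 + t / 4) * (norm (entry (a 0) i j) * (2 - t))"
      using Suc t unfolding t_def by (intro mult_left_mono) auto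
    also have "\<dots> = norm (entry (a 0) i j) * ((1 + t / 4) * (2 - t))" by simp
    also have "\<dots> \<le> norm (entry (a 0) i j) * (2 - (1/2) ^ Suc k)"
    proof (rule mult_left_mono)
      have "(1 + t / 4) * (2 - t) = 2 - t / 2 - t * t / 4" by (simp add: field_simps)
      moreover have "0 \<le> t * t / 4" by simp
      ultimately show "(1 + t / 4) * (2 - t) \<le> 2 - (1/2) ^ Suc k" by (simp add: t_def)
    qed simp
    finally show ?case .
  qed simp
  have conv: "convergent (\<lambda>k. entry (a k) i j)" for i j
  proof -
    define c where "c = norm (entry (a 0) i j)"
    have step: "norm (entry (a (Suc k)) i j - entry (a k) i j) \<le> c / 2 * (1/2) ^ k" for k
    proof -
      have "norm (entry (a k) i j) \<le> c * 2"
        using bound[of k i j] mult_left_mono[of "2 - (1/2) ^ k" 2 c] by (simp add: c_def)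
      then have le: "3 * \<epsilon> k * norm (entry (a k) i j) \<le> 3 * \<epsilon> k * (c * 2)"
        using \<epsilon>[of k] by (intro mult_left_mono) auto
      have "norm (entry (a (Suc k)) i j - entry (a k) i j) \<le> 3 * \<epsilon> k * norm (entry (a k) i j)"
        using a(2)[of k] by (simp add: Q_def)
      also note le
      also have "3 * \<epsilon> k * (c * 2) = c / 2 * (1/2) ^ k" by (simp add: \<epsilon>_def)
      finally show ?thesis .
    qed
    have "summable (\<lambda>k. c / 2 * (1/2) ^ k)" by (intro summable_mult summable_geometric) simp
    then have "summable (\<lambda>k. entry (a (Suc k)) i j - entry (a k) i j)"
      using step by (rule summable_comparison_test')
    then have "convergent (\<lambda>m. \<Sum>k<m. entry (a (Suc k)) i j - entry (a k) i j)"
      by (simp add: summable_iff_convergent)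
    then have "convergent (\<lambda>m. entry (a m) i j - entry (a 0) i j)"
      by (simp only: sum_lessThan_telescope[of "\<lambda>k. entry (a k) i j"])
    then show ?thesis using convergent_add[OF _ convergent_const[of "entry (a 0) i j"]] by fastforce
  qed
  define l where "l i j = lim (\<lambda>k. entry (a k) i j)" for i j
  have l: "(\<lambda>k. entry (a k) i j) \<longlonglongrightarrow> l i j" for i j
    using conv unfolding l_def by (rule convergent_LIMSEQ_iff[THEN iffD1])
  define L where "L = of_mat n (mat n n (\<lambda>(i, j). l i j))"
  have LC: "L \<in> corner n" by (simp add: L_def of_mat_corner)
  have lim: "(\<lambda>k. entry (a k) i j) \<longlonglongrightarrow> entry L i j" for i j
  proof (cases "i < n \<and> j < n")
    case False
    then have "entry L i j = 0" "entry (a k) i j = 0" for k using LC aC[of k] by (auto simp: corner_def not_less)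
    then show ?thesis by simp
  qed (use l in \<open>simp add: L_def of_mat.rep_eq\<close>)
  have LB: "entry L i j \<in> B" for i j
    using B_closed aB lim by (rule closed_sequentially)
  have Lt: "\<theta> (entry L i j) = \<theta> (entry b i j)" for i j
  proof -
    have "norm (\<theta> (entry L i j) - \<theta> (entry b i j)) \<le> norm (entry L i j - entry (a k) i j)" for k
      using norm_theta_le[of "entry L i j - entry (a k) i j"] LB aB at by (simp add: theta_diff E_diff B_E)
    moreover have "(\<lambda>k. norm (entry L i j - entry (a k) i j)) \<longlonglongrightarrow> norm (entry L i j - entry L i j)"
      by (intro tendsto_intros lim)
    ultimately have "norm (\<theta> (entry L i j) - \<theta> (entry b i j)) \<le> norm (entry L i j - entry L i j)"
      by (intro LIMSEQ_le_const) auto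
    then show ?thesis by simp
  qed
  have "(\<lambda>k. 1 + \<epsilon> k) \<longlonglongrightarrow> 1 + 0 / 12" unfolding \<epsilon>_def
    by (intro tendsto_intros LIMSEQ_power_zero) auto
  then have "fnorm N n L \<le> 1" using fnorm_limit_le[OF aC lim LC an] by simp
  then show thesis using LC LB Lt by (intro that[of L]) (auto simp: fcorner_def)
qed

lemma scaled_lift:
  assumes b: "b \<in> fcorner n B" "qnorm n b \<le> r" and r: "0 < r"
  obtains b' where "b' \<in> fcorner n B" "\<forall>i j. \<theta> (entry b' i j) = \<theta> (entry b i j)" "fnorm N n b' \<le> r"
proof -
  interpret cstar_normed "corner n" "fnorm N n" fstar fim by (rule cstar_normed_corner[OF N])
  have bB: "entry b i j \<in> B" for i j using b by (simp add: fcorner_def)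
  have sB: "(1/r) *\<^sub>R b \<in> fcorner n B" using b by (auto simp: fcorner_def entry_simps B_scaleR)
  have "map_mat \<theta> (to_mat n ((1/r) *\<^sub>R b)) = map_mat (scaleC (complex_of_real (1/r))) (map_mat \<theta> (to_mat n b))"
    using bB by (intro eq_matI) (auto simp: to_mat_def entry_simps theta_scaleR B_E scaleC_of_real simp del: of_real_divide)
  moreover have "cstar_norm_on_mats n (M n)" using M by (simp add: cstar_matrix_norms_def)
  then have "M n (map_mat (scaleC (complex_of_real (1/r))) A) = cmod (complex_of_real (1/r)) * M n A"
    if "A \<in> carrier_mat n n" for A using that unfolding cstar_norm_on_mats_def by blast
  ultimately have eq: "qnorm n ((1/r) *\<^sub>R b) = 1/r * qnorm n b"
    using r unfolding qnorm_def by (simp del: of_real_divide)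
  have "qnorm n ((1/r) *\<^sub>R b) \<le> 1" unfolding eq using b r by simp
  then obtain c where c: "c \<in> fcorner n B" "\<forall>i j. \<theta> (entry c i j) = \<theta> (entry ((1/r) *\<^sub>R b) i j)"
      "fnorm N n c \<le> 1"
    using attained_lift[OF sB] by blast
  have cB: "entry c i j \<in> B" for i j using c by (simp add: fcorner_def)
  show thesis
  proof (rule that[of "r *\<^sub>R c"])
    show "r *\<^sub>R c \<in> fcorner n B" using c by (auto simp: fcorner_def entry_simps B_scaleR)
    show "\<forall>i j. \<theta> (entry (r *\<^sub>R c) i j) = \<theta> (entry b i j)"
      using c(2) cB bB r by (simp add: entry_simps theta_scaleR B_E)
    show "fnorm N n (r *\<^sub>R c) \<le> r" using c r by (simp add: nu_scaleR fcorner_def)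
  qed
qed

lemma lift_matrix:
  assumes A: "A \<in> mats n B" and r: "M n (map_mat \<theta> A) \<le> r" "0 < r"
  obtains A' where "A' \<in> mats n B" "map_mat \<theta> A' = map_mat \<theta> A" "N n A' \<le> r"
proof -
  have AC: "A \<in> carrier_mat n n" using A by (simp add: mats_def)
  have a: "of_mat n A \<in> fcorner n B" using A by (rule of_mat_fcorner) simp
  have "qnorm n (of_mat n A) \<le> r" using r by (simp add: qnorm_def to_mat_of_mat[OF AC])
  then obtain b where b: "b \<in> fcorner n B" "\<forall>i j. \<theta> (entry b i j) = \<theta> (entry (of_mat n A) i j)" "fnorm N n b \<le> r"
    using scaled_lift[OF a _ r(2)] by blast
  show thesis
  proof (rule that[of "to_mat n b"])
    show "to_mat n b \<in> mats n B" by (rule to_mat_mats[OF b(1)])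
    show "map_mat \<theta> (to_mat n b) = map_mat \<theta> A"
      using AC b(2) by (intro eq_matI) (auto simp: to_mat_def of_mat.rep_eq)
    show "N n (to_mat n b) \<le> r" using b(3) by (simp add: fnorm_def)
  qed
qed

section \<open>Images of balls and quotient norms\<close>

lemma ball_image: "map_mat \<theta> ` mat_ball N n B = mat_ball M n (\<theta> ` B)"
proof (intro equalityI subsetI)
  fix D assume "D \<in> map_mat \<theta> ` mat_ball N n B"
  then obtain A where A: "A \<in> mats n B" "N n A \<le> 1" "D = map_mat \<theta> A" by (auto simp: mat_ball_def)
  then have "M n D \<le> 1" using contr[OF mats_mono[OF BE A(1)]] by simp
  then show "D \<in> mat_ball M n (\<theta> ` B)" using A map_mat_mats by (auto simp: mat_ball_def)
next
  fix D assume "D \<in> mat_ball M n (\<theta> ` B)"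
  then have D: "D \<in> mats n (\<theta> ` B)" "M n D \<le> 1" by (auto simp: mat_ball_def)
  obtain A where A: "A \<in> mats n B" "map_mat \<theta> A = D" using mats_image[OF D(1)] .
  obtain A' where "A' \<in> mats n B" "map_mat \<theta> A' = map_mat \<theta> A" "N n A' \<le> 1"
    using lift_matrix[OF A(1), of 1] A D by auto
  then show "D \<in> map_mat \<theta> ` mat_ball N n B" using A by (intro image_eqI[of _ _ A']) (auto simp: mat_ball_def)
qed

lemma unit_ball_image: "\<theta> ` (B \<inter> cball 0 1) = \<theta> ` B \<inter> cball 0 1"
proof (intro equalityI subsetI)
  fix y assume "y \<in> \<theta> ` (B \<inter> cball 0 1)"
  then show "y \<in> \<theta> ` B \<inter> cball 0 1" using norm_theta_le B_E by (fastforce simp: intro: order_trans)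
next
  fix y assume "y \<in> \<theta> ` B \<inter> cball 0 1"
  then obtain x where x: "x \<in> B" "y = \<theta> x" "norm (\<theta> x) \<le> 1" by auto
  have 1: "funit 0 0 x \<in> fcorner 1 B" using x by (auto simp: fcorner_def funit_corner funit.rep_eq)
  have "qnorm 1 (funit 0 0 x) \<le> 1" using x(3) unfolding qnorm_one .
  then obtain c where c: "c \<in> fcorner 1 B" "\<forall>i j. \<theta> (entry c i j) = \<theta> (entry (funit 0 0 x) i j)" "fnorm N 1 c \<le> 1"
    using attained_lift[OF 1] by blast
  have "c = funit 0 0 (entry c 0 0)"
  proof (rule fmat_eqI)
    fix i j show "entry c i j = entry (funit 0 0 (entry c 0 0)) i j"
      using c(1) by (cases i; cases j) (auto simp: fcorner_def corner_def funit.rep_eq)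
  qed
  then have "norm (entry c 0 0) \<le> 1" using c(3) fnorm_one by metis
  moreover have "\<theta> (entry c 0 0) = y" "entry c 0 0 \<in> B" using c x by (auto simp: funit.rep_eq fcorner_def)
  ultimately show "y \<in> \<theta> ` (B \<inter> cball 0 1)" by (intro image_eqI[of _ _ "entry c 0 0"]) auto
qed

text \<open>All representatives have the same image, so \<open>contr\<close> bounds their norms from
  below, and \<open>lift\<close> supplies representatives near that bound. \<open>X\<close> is
  general because over \<open>B\<close> the statement expresses the lifting result and over
  \<open>E\<close> the hypothesis on \<open>\<theta>\<close>; every \<open>r\<close> above the norm
  is allowed since over \<open>E\<close> the infimum need not be attained.\<close>

lemma quotient_norm_eq:
  assumes A: "A \<in> mats n X" and X: "X \<subseteq> E"
    "\<And>x y. x \<in> X \<Longrightarrow> y \<in> X \<Longrightarrow> x - y \<in> X" "\<And>x y. x \<in> X \<Longrightarrow> y \<in> X \<Longrightarrow> x + y \<in> X"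
    and lift: "\<And>r. M n (map_mat \<theta> A) < r \<Longrightarrow>
      \<exists>A'\<in>mats n X. map_mat \<theta> A' = map_mat \<theta> A \<and> N n A' \<le> r"
  shows "quotient_norm N n (map_mat (coset (ker_on X \<theta>)) A) = M n (map_mat \<theta> A)"
proof -
  define T where "T = {N n a | a. a \<in> carrier_mat n n \<and>
    (\<forall>i<n. \<forall>j<n. a $$ (i, j) \<in> map_mat (coset (ker_on X \<theta>)) A $$ (i, j))}"
  have AC: "A \<in> carrier_mat n n" using A by (simp add: mats_def)
  have AX: "A $$ (i, j) \<in> X" if "i < n" "j < n" for i j
    using A elements_matI[OF AC that refl] by (auto simp: mats_def)
  have low: "M n (map_mat \<theta> A) \<le> t" if tT: "t \<in> T" for t
  proof -
    obtain a where a: "t = N n a" "a \<in> carrier_mat n n"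
      "\<forall>i<n. \<forall>j<n. a $$ (i, j) \<in> map_mat (coset (ker_on X \<theta>)) A $$ (i, j)"
      using tT unfolding T_def by blast
    have aX: "a $$ (i, j) \<in> X \<and> \<theta> (a $$ (i, j)) = \<theta> (A $$ (i, j))" if ij: "i < n" "j < n" for i j
    proof -
      obtain k where "a $$ (i, j) = A $$ (i, j) + k" "k \<in> X" "\<theta> k = 0"
        using a(3) ij AC by (auto simp: coset_def ker_on_def)
      then show ?thesis using AX[OF ij] X theta_add[of "A $$ (i, j)" k] by auto
    qed
    then have "a \<in> mats n E" using a(2) X(1) by (auto simp: mats_def dest!: elements_matD)
    then have "M n (map_mat \<theta> a) \<le> N n a" by (rule contr)
    moreover have "map_mat \<theta> a = map_mat \<theta> A" using aX a(2) AC by (intro eq_matI) auto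
    ultimately show ?thesis using a(1) by simp
  qed
  have up: "\<exists>t\<in>T. t \<le> r" if r: "M n (map_mat \<theta> A) < r" for r
  proof -
    obtain A' where A': "A' \<in> mats n X" "map_mat \<theta> A' = map_mat \<theta> A" "N n A' \<le> r"
      using lift[OF r] by blast
    have A'C: "A' \<in> carrier_mat n n" using A' by (simp add: mats_def)
    have "A' $$ (i, j) \<in> coset (ker_on X \<theta>) (A $$ (i, j))" if ij: "i < n" "j < n" for i j
    proof -
      have x: "A' $$ (i, j) \<in> X" using A'(1) elements_matI[OF A'C ij refl] by (auto simp: mats_def)
      have "map_mat \<theta> A' $$ (i, j) = map_mat \<theta> A $$ (i, j)" using A'(2) by simp
      then have "\<theta> (A' $$ (i, j)) = \<theta> (A $$ (i, j))" using ij AC A'C by simp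
      then have "A' $$ (i, j) - A $$ (i, j) \<in> ker_on X \<theta>"
        using x AX[OF ij] X theta_diff[of "A' $$ (i, j)" "A $$ (i, j)"] by (auto simp: ker_on_def)
      then show ?thesis unfolding coset_def by force
    qed
    then have "N n A' \<in> T" unfolding T_def using A'C AC by auto
    then show ?thesis using A'(3) by blast
  qed
  have "Inf T = M n (map_mat \<theta> A)"
  proof (rule antisym)
    have bdd: "bdd_below T" using low by (rule bdd_belowI)
    show "Inf T \<le> M n (map_mat \<theta> A)"
    proof (rule field_le_epsilon)
      fix e :: real assume "0 < e"
      then obtain t where "t \<in> T" "t \<le> M n (map_mat \<theta> A) + e" using up[of "M n (map_mat \<theta> A) + e"] by auto
      then show "Inf T \<le> M n (map_mat \<theta> A) + e" using cInf_lower[OF _ bdd] by force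
    qed
    have "T \<noteq> {}" using up[of "M n (map_mat \<theta> A) + 1"] by auto
    then show "M n (map_mat \<theta> A) \<le> Inf T" using low by (rule cInf_greatest)
  qed
  then show ?thesis by (simp add: quotient_norm_def T_def)
qed

lemma M_nonneg: "A \<in> carrier_mat n n \<Longrightarrow> 0 \<le> M n A"
  using M unfolding cstar_matrix_norms_def cstar_norm_on_mats_def by blast

lemma quotient_norm_B:
  assumes A: "A \<in> mats n B"
  shows "quotient_norm N n (map_mat (coset (ker_on B \<theta>)) A) = M n (map_mat \<theta> A)"
proof (rule quotient_norm_eq[OF A BE B_diff B_add])
  fix r assume r: "M n (map_mat \<theta> A) < r"
  have "0 \<le> M n (map_mat \<theta> A)" using A by (intro M_nonneg) (simp add: mats_def)
  then have "0 < r" using r by simp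
  then obtain A' where "A' \<in> mats n B" "map_mat \<theta> A' = map_mat \<theta> A" "N n A' \<le> r"
    using lift_matrix[OF A less_imp_le[OF r]] by blast
  then show "\<exists>A'\<in>mats n B. map_mat \<theta> A' = map_mat \<theta> A \<and> N n A' \<le> r" by blast
qed

lemma quotient_norm_E:
  assumes A: "A \<in> mats n E"
  shows "quotient_norm N n (map_mat (coset (ker_on E \<theta>)) A) = M n (map_mat \<theta> A)"
proof (rule quotient_norm_eq[OF A order_refl E_diff E_add])
  fix r assume "M n (map_mat \<theta> A) < r"
  then obtain A' where A': "A' \<in> carrier_mat n n" "N n A' < r"
    "\<forall>i<n. \<forall>j<n. A' $$ (i, j) - A $$ (i, j) \<in> ker_on E \<theta>" using quot[OF A] by blast
  have AC: "A \<in> carrier_mat n n" using A by (simp add: mats_def)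
  have *: "A' $$ (i, j) \<in> E \<and> \<theta> (A' $$ (i, j)) = \<theta> (A $$ (i, j))" if ij: "i < n" "j < n" for i j
  proof -
    have AE: "A $$ (i, j) \<in> E" using A elements_matI[OF AC ij refl] by (auto simp: mats_def)
    have d: "A' $$ (i, j) - A $$ (i, j) \<in> E" "\<theta> (A' $$ (i, j) - A $$ (i, j)) = 0"
      using A'(3) ij by (auto simp: ker_on_def)
    show ?thesis using E_add[OF AE d(1)] theta_add[OF AE d(1)] d(2) by simp
  qed
  have "A' \<in> mats n E" using A'(1) * by (auto simp: mats_def dest!: elements_matD)
  moreover have "map_mat \<theta> A' = map_mat \<theta> A" using A'(1) AC * by (intro eq_matI) auto
  ultimately show "\<exists>A'\<in>mats n E. map_mat \<theta> A' = map_mat \<theta> A \<and> N n A' \<le> r" using A'(2) by force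
qed

end

section \<open>Cosets and the induced maps\<close>

lemma induced_map_coset:
  assumes "\<And>k. k \<in> K \<Longrightarrow> u (x + k) = u x" "0 \<in> K"
  shows "induced_map u (coset K x) = u x"
proof -
  have "u ` coset K x = {u x}"
    using assms by (auto simp: coset_def image_iff intro: exI[of _ x] exI[of _ 0])
  then show ?thesis by (simp add: induced_map_def)
qed

context cai_quotient
begin

lemma mem_ker: "k \<in> ker_on X \<theta> \<longleftrightarrow> k \<in> X \<and> \<theta> k = 0"
  by (simp add: ker_on_def)

text \<open>Cosets are the level sets of \<open>\<theta>\<close> in \<open>X\<close>, which turns
  the coset identities below into equations between values of \<open>\<theta>\<close>.\<close>

lemma mem_coset:
  assumes "operator_algebra X" "X \<subseteq> E" "x \<in> X"
  shows "p \<in> coset (ker_on X \<theta>) x \<longleftrightarrow> p \<in> X \<and> \<theta> p = \<theta> x"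
proof
  assume "p \<in> coset (ker_on X \<theta>) x"
  then obtain k where "p = x + k" "k \<in> X" "\<theta> k = 0" by (auto simp: coset_def ker_on_def)
  then show "p \<in> X \<and> \<theta> p = \<theta> x"
    using assms theta_add[of x k] by (auto simp: operator_algebra_def)
next
  assume p: "p \<in> X \<and> \<theta> p = \<theta> x"
  then have "p - x \<in> ker_on X \<theta>"
    using assms theta_diff[of p x] operator_algebra_diff[OF assms(1), of p x] by (auto simp: ker_on_def)
  moreover have "p = x + (p - x)" by simp
  ultimately show "p \<in> coset (ker_on X \<theta>) x" unfolding coset_def by blast
qed

context
  fixes X assumes X: "operator_algebra X" "X \<subseteq> E"
begin

lemma X_closed: "x \<in> X \<Longrightarrow> y \<in> X \<Longrightarrow> x + y \<in> X" "x \<in> X \<Longrightarrow> y \<in> X \<Longrightarrow> x * y \<in> X"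
    "x \<in> X \<Longrightarrow> scaleC c x \<in> X" "x \<in> X \<Longrightarrow> y \<in> X \<Longrightarrow> x - y \<in> X" "x \<in> X \<Longrightarrow> x \<in> E"
  using X operator_algebra_diff[OF X(1)] by (auto simp: operator_algebra_def)

lemma coset_add:
  assumes "x \<in> X" "y \<in> X"
  shows "{p + q | p q. p \<in> coset (ker_on X \<theta>) x \<and> q \<in> coset (ker_on X \<theta>) y} = coset (ker_on X \<theta>) (x + y)"
proof (intro equalityI subsetI)
  fix r assume "r \<in> {p + q | p q. p \<in> coset (ker_on X \<theta>) x \<and> q \<in> coset (ker_on X \<theta>) y}"
  then show "r \<in> coset (ker_on X \<theta>) (x + y)"
    using assms by (auto simp: mem_coset[OF X] X_closed theta_add)
next
  fix r assume "r \<in> coset (ker_on X \<theta>) (x + y)"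
  then have r: "r \<in> X" "\<theta> r = \<theta> x + \<theta> y" using assms by (auto simp: mem_coset[OF X] X_closed theta_add)
  have "r = x + (r - x)" by simp
  moreover have "x \<in> coset (ker_on X \<theta>) x" "r - x \<in> coset (ker_on X \<theta>) y"
    using assms r by (auto simp: mem_coset[OF X] X_closed theta_diff)
  ultimately show "r \<in> {p + q | p q. p \<in> coset (ker_on X \<theta>) x \<and> q \<in> coset (ker_on X \<theta>) y}" by blast
qed

lemma coset_scaleC:
  assumes "x \<in> X"
  shows "{scaleC c p + k | p k. p \<in> coset (ker_on X \<theta>) x \<and> k \<in> ker_on X \<theta>} = coset (ker_on X \<theta>) (scaleC c x)"
proof (intro equalityI subsetI)
  fix r assume "r \<in> {scaleC c p + k | p k. p \<in> coset (ker_on X \<theta>) x \<and> k \<in> ker_on X \<theta>}"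
  then show "r \<in> coset (ker_on X \<theta>) (scaleC c x)"
    using assms by (auto simp: mem_coset[OF X] X_closed theta_add theta_scaleC mem_ker)
next
  fix r assume "r \<in> coset (ker_on X \<theta>) (scaleC c x)"
  then have r: "r \<in> X" "\<theta> r = scaleC c (\<theta> x)" using assms by (auto simp: mem_coset[OF X] X_closed theta_scaleC)
  have "r = scaleC c x + (r - scaleC c x)" by simp
  moreover have "x \<in> coset (ker_on X \<theta>) x" "r - scaleC c x \<in> ker_on X \<theta>"
    using assms r by (auto simp: mem_coset[OF X] X_closed theta_diff theta_scaleC mem_ker)
  ultimately show "r \<in> {scaleC c p + k | p k. p \<in> coset (ker_on X \<theta>) x \<and> k \<in> ker_on X \<theta>}" by blast
qed

lemma coset_mult:
  assumes "x \<in> X" "y \<in> X"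
  shows "{p * q + k | p q k. p \<in> coset (ker_on X \<theta>) x \<and> q \<in> coset (ker_on X \<theta>) y \<and> k \<in> ker_on X \<theta>} =
    coset (ker_on X \<theta>) (x * y)"
proof (intro equalityI subsetI)
  fix r assume "r \<in> {p * q + k | p q k. p \<in> coset (ker_on X \<theta>) x \<and> q \<in> coset (ker_on X \<theta>) y \<and> k \<in> ker_on X \<theta>}"
  then show "r \<in> coset (ker_on X \<theta>) (x * y)"
    using assms by (auto simp: mem_coset[OF X] X_closed theta_add theta_mult mem_ker)
next
  fix r assume "r \<in> coset (ker_on X \<theta>) (x * y)"
  then have r: "r \<in> X" "\<theta> r = \<theta> x * \<theta> y" using assms by (auto simp: mem_coset[OF X] X_closed theta_mult)
  have "r = x * y + (r - x * y)" by simp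
  moreover have "x \<in> coset (ker_on X \<theta>) x" "y \<in> coset (ker_on X \<theta>) y" "r - x * y \<in> ker_on X \<theta>"
    using assms r by (auto simp: mem_coset[OF X] X_closed theta_diff theta_mult mem_ker)
  ultimately show "r \<in> {p * q + k | p q k. p \<in> coset (ker_on X \<theta>) x \<and> q \<in> coset (ker_on X \<theta>) y \<and> k \<in> ker_on X \<theta>}"
    by blast
qed

lemma induced_map_eq: "x \<in> X \<Longrightarrow> induced_map \<theta> (coset (ker_on X \<theta>) x) = \<theta> x"
  by (rule induced_map_coset) (auto simp: ker_on_def theta_add X_closed X(1)[unfolded operator_algebra_def])

end

lemmas BX = B BE
lemmas EX = E order_refl[of E]

lemma quotient_incl_eq:
  assumes b: "b \<in> B"
  shows "quotient_incl (ker_on E \<theta>) (coset (ker_on B \<theta>) b) = coset (ker_on E \<theta>) b"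
  unfolding quotient_incl_def
proof (intro equalityI subsetI)
  fix r assume "r \<in> {x + j | x j. x \<in> coset (ker_on B \<theta>) b \<and> j \<in> ker_on E \<theta>}"
  then show "r \<in> coset (ker_on E \<theta>) b"
    using b by (auto simp: mem_coset[OF BX] mem_coset[OF EX] B_E E_add theta_add mem_ker)
next
  fix r assume "r \<in> coset (ker_on E \<theta>) b"
  then have r: "r \<in> E" "\<theta> r = \<theta> b" using b by (auto simp: mem_coset[OF EX] B_E)
  have "r = b + (r - b)" by simp
  moreover have "b \<in> coset (ker_on B \<theta>) b" "r - b \<in> ker_on E \<theta>"
    using b r by (auto simp: mem_coset[OF BX] B_E E_diff theta_diff mem_ker)
  ultimately show "r \<in> {x + j | x j. x \<in> coset (ker_on B \<theta>) b \<and> j \<in> ker_on E \<theta>}" by blast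
qed

lemma coset_eq_iff:
  assumes "x \<in> B" "y \<in> B"
  shows "coset (ker_on B \<theta>) x = coset (ker_on B \<theta>) y \<longleftrightarrow> \<theta> x = \<theta> y"
  using assms by (auto simp: set_eq_iff mem_coset[OF BX])

lemma induced_map_hom: "homomorphism (quotient_alg N B (ker_on B \<theta>)) (sub_alg M (\<theta> ` B)) (induced_map \<theta>)"
  by (auto simp: homomorphism_def linear_map_def quotient_alg_def sub_alg_def induced_map_eq[OF BX]
      coset_add[OF BX] coset_scaleC[OF BX] coset_mult[OF BX] B_add B_mult B_scaleC
      theta_add theta_mult theta_scaleC B_E)

lemma induced_map_bij: "bij_betw (induced_map \<theta>) (coset (ker_on B \<theta>) ` B) (\<theta> ` B)"
  unfolding bij_betw_def inj_on_def
  by (auto simp: induced_map_eq[OF BX] coset_eq_iff image_image)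

lemma quotient_incl_hom:
  "homomorphism (quotient_alg N B (ker_on B \<theta>)) (quotient_alg N E (ker_on E \<theta>)) (quotient_incl (ker_on E \<theta>))"
  by (auto simp: homomorphism_def linear_map_def quotient_alg_def quotient_incl_eq
      coset_add[OF BX] coset_scaleC[OF BX] coset_mult[OF BX] coset_add[OF EX] coset_scaleC[OF EX] coset_mult[OF EX]
      B_add B_mult B_scaleC B_E)

lemma quotient_incl_inj: "inj_on (quotient_incl (ker_on E \<theta>)) (coset (ker_on B \<theta>) ` B)"
proof (rule inj_onI)
  fix P Q assume "P \<in> coset (ker_on B \<theta>) ` B" "Q \<in> coset (ker_on B \<theta>) ` B"
    and eq: "quotient_incl (ker_on E \<theta>) P = quotient_incl (ker_on E \<theta>) Q"
  then obtain x y where x: "x \<in> B" "P = coset (ker_on B \<theta>) x" and y: "y \<in> B" "Q = coset (ker_on B \<theta>) y" by blast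
  have "coset (ker_on E \<theta>) x = coset (ker_on E \<theta>) y" using eq x y by (simp add: quotient_incl_eq)
  then have "\<theta> x = \<theta> y" using induced_map_eq[OF EX B_E] x y by metis
  then show "P = Q" using x y by (simp add: coset_eq_iff)
qed

lemma map_mat_coset:
  assumes "Q \<in> mats n (coset (ker_on B \<theta>) ` B)"
  obtains A where "A \<in> mats n B" "Q = map_mat (coset (ker_on B \<theta>)) A"
    "map_mat (induced_map \<theta>) Q = map_mat \<theta> A"
    "map_mat (quotient_incl (ker_on E \<theta>)) Q = map_mat (coset (ker_on E \<theta>)) A"
proof -
  obtain A where A: "A \<in> mats n B" "map_mat (coset (ker_on B \<theta>)) A = Q" using mats_image[OF assms] .
  have AC: "A \<in> carrier_mat n n" using A by (simp add: mats_def)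
  have AB: "A $$ (i, j) \<in> B" if "i < n" "j < n" for i j
    using A(1) elements_matI[OF AC that refl] by (auto simp: mats_def)
  show thesis
  proof (rule that[OF A(1) A(2)[symmetric]])
    show "map_mat (induced_map \<theta>) Q = map_mat \<theta> A"
      unfolding A(2)[symmetric] using AC AB by (intro eq_matI) (auto simp: induced_map_eq[OF BX])
    show "map_mat (quotient_incl (ker_on E \<theta>)) Q = map_mat (coset (ker_on E \<theta>)) A"
      unfolding A(2)[symmetric] using AC AB by (intro eq_matI) (auto simp: quotient_incl_eq)
  qed
qed

lemma induced_map_isometry:
  "complete_isometry (quotient_alg N B (ker_on B \<theta>)) (sub_alg M (\<theta> ` B)) (induced_map \<theta>)"
  unfolding complete_isometry_def
proof (intro allI ballI)
  fix n Q assume "Q \<in> mats n (mn_carrier (quotient_alg N B (ker_on B \<theta>)))"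
  then have Q: "Q \<in> mats n (coset (ker_on B \<theta>) ` B)" by (simp add: quotient_alg_def)
  obtain A where "A \<in> mats n B" "Q = map_mat (coset (ker_on B \<theta>)) A"
    "map_mat (induced_map \<theta>) Q = map_mat \<theta> A" using map_mat_coset[OF Q] .
  then show "mn_norm (sub_alg M (\<theta> ` B)) n (map_mat (induced_map \<theta>) Q) =
      mn_norm (quotient_alg N B (ker_on B \<theta>)) n Q"
    using quotient_norm_B[of A n] by (simp add: sub_alg_def quotient_alg_def)
qed

text \<open>Both quotient norms of a matrix of cosets equal the norm of its image under
  \<open>\<theta>\<close>.\<close>

lemma quotient_incl_isometry:
  "complete_isometry (quotient_alg N B (ker_on B \<theta>)) (quotient_alg N E (ker_on E \<theta>)) (quotient_incl (ker_on E \<theta>))"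
  unfolding complete_isometry_def
proof (intro allI ballI)
  fix n Q assume "Q \<in> mats n (mn_carrier (quotient_alg N B (ker_on B \<theta>)))"
  then have Q: "Q \<in> mats n (coset (ker_on B \<theta>) ` B)" by (simp add: quotient_alg_def)
  obtain A where A: "A \<in> mats n B" "Q = map_mat (coset (ker_on B \<theta>)) A"
    "map_mat (quotient_incl (ker_on E \<theta>)) Q = map_mat (coset (ker_on E \<theta>)) A" using map_mat_coset[OF Q] .
  then show "mn_norm (quotient_alg N E (ker_on E \<theta>)) n (map_mat (quotient_incl (ker_on E \<theta>)) Q) =
      mn_norm (quotient_alg N B (ker_on B \<theta>)) n Q"
    using quotient_norm_B[OF A(1)] quotient_norm_E[OF mats_mono[OF BE A(1)]] by (simp add: quotient_alg_def)
qed

lemma restriction_complete_quotient_map: "complete_quotient_map N B M (\<theta> ` B) \<theta>"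
  unfolding complete_quotient_map_def
proof (intro conjI induced_map_isometry refl)
  show "linear_map (sub_alg N B) (sub_alg M (\<theta> ` B)) \<theta>"
    by (auto simp: linear_map_def sub_alg_def theta_add theta_scaleC B_E)
  show "completely_contractive (sub_alg N B) (sub_alg M (\<theta> ` B)) \<theta>"
    using contr[OF mats_mono[OF BE]] by (auto simp: completely_contractive_def sub_alg_def)
qed

end

section \<open>Approximate units near \<open>B\<close> and the assembly of the theorem\<close>

lemma convex_approximate_units:
  fixes J S :: "'a::cstar_algebra set"
  assumes "subspace J"
  shows "convex {x \<in> J. norm x \<le> 1 \<and> (\<forall>s\<in>S. norm (x * s - s) \<le> \<eta> \<and> norm (s * x - s) \<le> \<eta>)}"
proof (rule convexI)
  fix x y :: 'a and u v :: real
  let ?C = "{x \<in> J. norm x \<le> 1 \<and> (\<forall>s\<in>S. norm (x * s - s) \<le> \<eta> \<and> norm (s * x - s) \<le> \<eta>)}"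
  assume x: "x \<in> ?C" and y: "y \<in> ?C" and uv: "0 \<le> u" "0 \<le> v" "u + v = 1"
  have comb: "norm (u *\<^sub>R a + v *\<^sub>R b) \<le> K" if "norm a \<le> K" "norm b \<le> K" for a b :: 'a and K
    using convex_bound_le[OF that uv] norm_triangle_ineq[of "u *\<^sub>R a" "v *\<^sub>R b"] uv by simp
  show "u *\<^sub>R x + v *\<^sub>R y \<in> ?C"
  proof (intro CollectI conjI ballI)
    show "u *\<^sub>R x + v *\<^sub>R y \<in> J" using x y assms by (simp add: subspace_add subspace_scale)
    show "norm (u *\<^sub>R x + v *\<^sub>R y) \<le> 1" using x y by (intro comb) auto
    fix s assume s: "s \<in> S"
    have ss: "u *\<^sub>R s + v *\<^sub>R s = s" using uv by (simp flip: scaleR_left_distrib)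
    have "(u *\<^sub>R x + v *\<^sub>R y) * s - (u *\<^sub>R s + v *\<^sub>R s) = u *\<^sub>R (x * s - s) + v *\<^sub>R (y * s - s)"
      "s * (u *\<^sub>R x + v *\<^sub>R y) - (u *\<^sub>R s + v *\<^sub>R s) = u *\<^sub>R (s * x - s) + v *\<^sub>R (s * y - s)"
      by (simp_all add: algebra_simps)
    note this[unfolded ss]
    moreover have "norm (u *\<^sub>R (x * s - s) + v *\<^sub>R (y * s - s)) \<le> \<eta>" "norm (u *\<^sub>R (s * x - s) + v *\<^sub>R (s * y - s)) \<le> \<eta>"
      using x y s by (auto intro!: comb)
    ultimately show "norm ((u *\<^sub>R x + v *\<^sub>R y) * s - s) \<le> \<eta>" "norm (s * (u *\<^sub>R x + v *\<^sub>R y) - s) \<le> \<eta>" by simp_all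
  qed
qed

text \<open>The good approximate units for a given \<open>S\<close> form a convex set
  \<open>C\<close> that eventually contains the cai. In the first case any such member lies in
  \<open>B\<close>; in the second, separation moves within \<open>C\<close> to a point near
  \<open>B\<close>, and convexity ensures that the unit property survives.\<close>

lemma approximate_units_near_subalgebra:
  fixes E B J S :: "'a::cstar_algebra set"
  assumes E: "operator_algebra E" and B: "operator_algebra B" "B \<subseteq> E" and J: "subspace J" "J \<subseteq> E"
    and e: "cai J \<F> e"
    and cases: "(\<forall>i. e i \<in> B) \<or> (\<exists>p\<in>perp_perp E B.
      net_limit_point (weak_star_topology E) \<F> (\<lambda>i. bidual_embedding E (e i)) p)"
    and S: "finite S" "S \<subseteq> J" and \<eta>: "0 < \<eta>"
  shows "\<exists>x\<in>J. norm x \<le> 1 \<and> (\<exists>b\<in>B. norm (x - b) \<le> \<eta>) \<and>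
    (\<forall>s\<in>S. norm (x * s - s) \<le> \<eta> \<and> norm (s * x - s) \<le> \<eta>)"
proof -
  define C where "C = {x \<in> J. norm x \<le> 1 \<and> (\<forall>s\<in>S. norm (x * s - s) \<le> \<eta> \<and> norm (s * x - s) \<le> \<eta>)}"
  have near: "\<forall>\<^sub>F i in \<F>. norm (f i - s) \<le> \<eta>" if "(f \<longlongrightarrow> s) \<F>" for f and s :: 'a
    using tendstoD[OF that \<eta>] by (rule eventually_mono) (simp add: dist_norm)
  have "\<forall>s\<in>S. \<forall>\<^sub>F i in \<F>. norm (e i * s - s) \<le> \<eta> \<and> norm (s * e i - s) \<le> \<eta>"
    using e S near by (auto simp: cai_def intro!: eventually_conj)
  then have "\<forall>\<^sub>F i in \<F>. \<forall>s\<in>S. norm (e i * s - s) \<le> \<eta> \<and> norm (s * e i - s) \<le> \<eta>"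
    using S by (simp add: eventually_ball_finite_distrib)
  then have ev: "\<forall>\<^sub>F i in \<F>. e i \<in> C"
    by (rule eventually_mono) (use e in \<open>auto simp: C_def cai_def\<close>)
  have "\<exists>c\<in>C. \<exists>b\<in>B. norm (c - b) \<le> \<eta>"
    using cases
  proof
    assume eB: "\<forall>i. e i \<in> B"
    have "\<F> \<noteq> bot" using e by (simp add: cai_def)
    then obtain i where "e i \<in> C" using ev eventually_happens' by blast
    then show ?thesis using eB \<eta> by (intro bexI[of _ "e i"] bexI[of _ "e i"]) auto
  next
    assume "\<exists>p\<in>perp_perp E B. net_limit_point (weak_star_topology E) \<F> (\<lambda>i. bidual_embedding E (e i)) p"
    then obtain p where p: "p \<in> perp_perp E B"
      "net_limit_point (weak_star_topology E) \<F> (\<lambda>i. bidual_embedding E (e i)) p" by blast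
    have "convex C" unfolding C_def by (rule convex_approximate_units[OF J(1)])
    moreover have "C \<subseteq> E" using J by (auto simp: C_def)
    ultimately have "\<exists>c\<in>C. \<exists>b\<in>B. norm (c - b) < \<eta>"
      using near_subalgebra_of_limit_point[OF E B _ _ ev p \<eta>] by blast
    then show ?thesis by (meson less_imp_le)
  qed
  then show ?thesis unfolding C_def by blast
qed

theorem lemma2p1:
  fixes E B :: "'a::cstar_algebra set" and F :: "'b::cstar_algebra set"
    and N :: "nat \<Rightarrow> 'a mat \<Rightarrow> real" and M :: "nat \<Rightarrow> 'b mat \<Rightarrow> real"
    and \<theta> :: "'a \<Rightarrow> 'b"
    and e :: "'i \<Rightarrow> 'a" and \<F> :: "'i filter"
  assumes "cstar_matrix_norms N" and "cstar_matrix_norms M"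
    and "operator_algebra E" and "operator_algebra F"
    and "homomorphism (sub_alg N E) (sub_alg M F) \<theta>"
    and "completely_contractive (sub_alg N E) (sub_alg M F) \<theta>"
    and "complete_quotient_map N E M F \<theta>"
    and "operator_algebra B" and "B \<subseteq> E"
    and "cai (ker_on E \<theta>) \<F> e"
    and "(\<forall>i. e i \<in> B) \<or>
         (\<exists>p\<in>perp_perp E B.
            net_limit_point (weak_star_topology E) \<F> (\<lambda>i. bidual_embedding E (e i)) p)"
  shows
    "closed (\<theta> ` B) \<and>
     complete_quotient_map N B M (\<theta> ` B) \<theta> \<and>
     \<theta> ` (B \<inter> cball 0 1) = \<theta> ` B \<inter> cball 0 1 \<and>
     (\<forall>n. map_mat \<theta> ` mat_ball N n B = mat_ball M n (\<theta> ` B)) \<and>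
     (let J = ker_on E \<theta>; K = ker_on B \<theta>;
          BK = quotient_alg N B K; EJ = quotient_alg N E J in
        homomorphism BK (sub_alg M (\<theta> ` B)) (induced_map \<theta>) \<and>
        bij_betw (induced_map \<theta>) (mn_carrier BK) (\<theta> ` B) \<and>
        complete_isometry BK (sub_alg M (\<theta> ` B)) (induced_map \<theta>) \<and>
        homomorphism BK EJ (quotient_incl J) \<and>
        inj_on (quotient_incl J) (mn_carrier BK) \<and>
        complete_isometry BK EJ (quotient_incl J) \<and>
        (\<forall>b\<in>B. induced_map \<theta> (coset K b) = \<theta> b \<and>
               quotient_incl J (coset K b) = coset J b \<and>
               induced_map \<theta> (coset J b) = \<theta> b))"
proof -
  have add: "\<theta> (x + y) = \<theta> x + \<theta> y" and mult: "\<theta> (x * y) = \<theta> x * \<theta> y"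
    if "x \<in> E" "y \<in> E" for x y
    using assms(5) that by (auto simp: homomorphism_def linear_map_def sub_alg_def)
  have scale: "\<theta> (scaleC c x) = scaleC c (\<theta> x)" if "x \<in> E" for c x
    using assms(5) that by (auto simp: homomorphism_def linear_map_def sub_alg_def)
  have E0: "0 \<in> E" and Ecl: "x \<in> E \<Longrightarrow> y \<in> E \<Longrightarrow> x + y \<in> E" for x y
    using assms(3) by (auto simp: operator_algebra_def)
  have scaleR: "\<theta> (r *\<^sub>R x) = r *\<^sub>R \<theta> x" if "x \<in> E" for r x
    using scale[OF that, of "complex_of_real r"] by (simp add: scaleC_of_real)
  have zero: "\<theta> 0 = 0" using scaleR[OF E0, of 0] by simp
  have J: "subspace (ker_on E \<theta>)" "ker_on E \<theta> \<subseteq> E"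
    using E0 zero by (auto simp: subspace_def ker_on_def add scaleR Ecl operator_algebra_scaleR[OF assms(3)])
  \<comment> \<open>The quotient norm is an infimum over entrywise representatives, so a value below
    \<open>r\<close> is witnessed by one of them.\<close>
  have quot: "\<exists>A'\<in>carrier_mat n n. (\<forall>i<n. \<forall>j<n. A' $$ (i, j) - A $$ (i, j) \<in> ker_on E \<theta>) \<and> N n A' < r"
    if A: "A \<in> mats n E" and r: "M n (map_mat \<theta> A) < r" for n A r
  proof -
    have AC: "A \<in> carrier_mat n n" using A by (simp add: mats_def)
    have AE: "A $$ (i, j) \<in> E" if "i < n" "j < n" for i j
      using A elements_matI[OF AC that refl] by (auto simp: mats_def)
    define Q where "Q = map_mat (coset (ker_on E \<theta>)) A"
    have "map_mat (induced_map \<theta>) Q = map_mat \<theta> A"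
    proof (rule eq_matI)
      fix i j assume "i < dim_row (map_mat \<theta> A)" "j < dim_col (map_mat \<theta> A)"
      then have ij: "i < n" "j < n" using AC by auto
      have "induced_map \<theta> (coset (ker_on E \<theta>) (A $$ (i, j))) = \<theta> (A $$ (i, j))"
        using AE[OF ij] E0 zero by (intro induced_map_coset) (auto simp: ker_on_def add)
      then show "map_mat (induced_map \<theta>) Q $$ (i, j) = map_mat \<theta> A $$ (i, j)" using ij AC by (simp add: Q_def)
    qed (use AC in \<open>auto simp: Q_def\<close>)
    moreover have "Q \<in> mats n (coset (ker_on E \<theta>) ` E)" using A by (simp add: Q_def map_mat_mats)
    then have "M n (map_mat (induced_map \<theta>) Q) = quotient_norm N n Q"
      using assms(7) unfolding complete_quotient_map_def complete_isometry_def
      by (simp add: quotient_alg_def sub_alg_def)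
    ultimately have less: "quotient_norm N n Q < r" using r by simp
    define T where "T = {N n a | a. a \<in> carrier_mat n n \<and> (\<forall>i<n. \<forall>j<n. a $$ (i, j) \<in> Q $$ (i, j))}"
    have "A \<in> carrier_mat n n \<and> (\<forall>i<n. \<forall>j<n. A $$ (i, j) \<in> Q $$ (i, j))"
      using AC E0 zero by (auto simp: Q_def coset_def ker_on_def)
    then have "N n A \<in> T" unfolding T_def by blast
    then have "T \<noteq> {}" by blast
    moreover have "Inf T < r" using less by (simp add: quotient_norm_def T_def)
    ultimately obtain t where "t \<in> T" "t < r" using cInf_lessD by blast
    then obtain a where a: "a \<in> carrier_mat n n" "\<forall>i<n. \<forall>j<n. a $$ (i, j) \<in> Q $$ (i, j)" "N n a < r"
      unfolding T_def by blast
    have "\<forall>i<n. \<forall>j<n. a $$ (i, j) - A $$ (i, j) \<in> ker_on E \<theta>"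
    proof (intro allI impI)
      fix i j assume ij: "i < n" "j < n"
      then have "a $$ (i, j) \<in> coset (ker_on E \<theta>) (A $$ (i, j))" using a(2) AC by (auto simp: Q_def)
      then obtain k where "a $$ (i, j) = A $$ (i, j) + k" "k \<in> ker_on E \<theta>" by (auto simp: coset_def)
      then show "a $$ (i, j) - A $$ (i, j) \<in> ker_on E \<theta>" by simp
    qed
    then show ?thesis using a by blast
  qed
  interpret cai_quotient E B N M \<theta>
  proof
    show "M n (map_mat \<theta> A) \<le> N n A" if "A \<in> mats n E" for A n
      using assms(6) that by (simp add: completely_contractive_def sub_alg_def)
    show "\<exists>x\<in>ker_on E \<theta>. norm x \<le> 1 \<and> (\<exists>b\<in>B. norm (x - b) \<le> \<eta>) \<and>
        (\<forall>s\<in>S. norm (x * s - s) \<le> \<eta> \<and> norm (s * x - s) \<le> \<eta>)"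
      if "finite S" "S \<subseteq> ker_on E \<theta>" "0 < \<eta>" for S \<eta>
      using approximate_units_near_subalgebra[OF assms(3,8,9) J assms(10,11) that] .
  qed (fact assms add mult scale quot)+
  have carrier: "mn_carrier (quotient_alg N B (ker_on B \<theta>)) = coset (ker_on B \<theta>) ` B"
    by (simp add: quotient_alg_def)
  show ?thesis
    unfolding Let_def carrier
  proof (intro conjI allI ballI closed_image restriction_complete_quotient_map unit_ball_image ball_image
      induced_map_hom induced_map_bij induced_map_isometry quotient_incl_hom quotient_incl_inj
      quotient_incl_isometry)
    fix b assume b: "b \<in> B"
    show "induced_map \<theta> (coset (ker_on B \<theta>) b) = \<theta> b" using b by (rule induced_map_eq[OF BX])
    show "quotient_incl (ker_on E \<theta>) (coset (ker_on B \<theta>) b) = coset (ker_on E \<theta>) b"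
      using b by (rule quotient_incl_eq)
    show "induced_map \<theta> (coset (ker_on E \<theta>) b) = \<theta> b" using B_E[OF b] by (rule induced_map_eq[OF EX])
  qed
qed

end
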